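(* (i) On a compact complex manifold $M$, there exists at most one balanced complex Finsler metric (up to constant multiples) in each conformal class of strongly pseudoconvex complex Finsler metrics. (ii) Let $(M,F)$ be a non-compact strongly pseudoconvex Rund Kähler-Finsler-like manifold and let $\rho$ be a smooth real function on $M$. Then the conformal metric $\tilde F(z,v)=e^{\frac12\rho(z)}F(z,v)$ is Rund Kähler-Finsler-like if and only if $\partial\bar\partial\rho=0$.
   Context: Basic notation. $M$ is a connected complex manifold with $n=\dim_{\mathbb C}M\ge 2$. Local holomorphic coordinates $z^1,\dots,z^n$ on $M$ induce coordinates $(z,v)$ on the holomorphic tangent bundle $T^{1,0}M$ via $v=v^\alpha\partial/\partial z^\alpha$; $\tilde M=T^{1,0}M\setminus\{0\}$ is the complement of the zero section. Greek indices run from $1$ to $n$, repeated indices are summed, and barred indices refer to conjugate variables/objects. A complex Finsler metric is a continuous $F:T^{1,0}M\to[0,\infty)$ with $G=F^2$ smooth on $\tilde M$, $F>0$ on $\tilde M$, and $F(z,\zeta v)=|\zeta|F(z,v)$ for $\zeta\in\mathbb C$. Put $G_{\alpha\bar\beta}=\partial^2G/\partial v^\alpha\partial\bar v^\beta$. $F$ is strongly pseudoconvex if $(G_{\alpha\bar\beta})$ is positive definite on $\tilde M$; $(G^{\bar\beta\alpha})$ is the inverse matrix. Put $\dot\partial_\alpha=\partial/\partial v^\alpha$, $\Gamma^\alpha_{;\mu}=G^{\bar\lambda\alpha}\,\partial^2G/\partial\bar v^\lambda\partial z^\mu$, $\delta_\mu=\partial/\partial z^\mu-\Gamma^\alpha_{;\mu}\dot\partial_\alpha$,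 $\delta_{\bar\mu}=\overline{\delta_\mu}$, $\delta v^\alpha=dv^\alpha+\Gamma^\alpha_{;\beta}dz^\beta$, $\Gamma^\alpha_{\beta;\mu}=G^{\bar\lambda\alpha}\delta_\mu(G_{\beta\bar\lambda})$. Two strongly pseudoconvex complex Finsler metrics $F,\tilde F$ on $M$ are conformal (in the same conformal class) if $\tilde F(z,v)=e^{\frac12\rho(z)}F(z,v)$ for some smooth real function $\rho$ on $M$. Rund Kähler-Finsler-like. The complex Rund connection has connection forms $\hat\theta^\alpha_\beta=\Gamma^\alpha_{\beta;\mu}dz^\mu$; the horizontal part of its curvature form is $\hat\Omega^\alpha_{\beta;\mu\bar\nu}dz^\mu\wedge d\bar z^\nu$ with $\hat\Omega^\alpha_{\beta;\mu\bar\nu}=-\delta_{\bar\nu}(\Gamma^\alpha_{\beta;\mu})$. A strongly pseudoconvex $F$ is Rund Kähler-Finsler-like if $\hat\Omega^\alpha_{\beta;\mu\bar\nu}=\hat\Omega^\alpha_{\mu;\beta\bar\nu}$ for all $\alpha,\beta,\mu,\nu$. Horizontal forms and balanced metrics. $\mathbb P\tilde M=\tilde M/(\mathbb C\setminus\{0\})$ is the projectivized tangent bundle. Put $\omega_{\mathcal V}=\sqrt{-1}\,(\log G)_{\alpha\bar\beta}\,\delta v^\alpha\wedge\delta\bar v^\beta$ (subscripts denote $v$-derivatives), $\omega_{\mathcal H}=\sqrt{-1}\,G_{\alpha\bar\beta}\,dz^\alpha\wedge d\bar z^\beta$, and $d\mu_{\mathbb P\tilde M}=\frac{\omega_{\mathcal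 V}^{n-1}}{(n-1)!}\wedge\frac{\omega_{\mathcal H}^n}{n!}$. $\mathcal A^{p,q}$ is the space of smooth horizontal $(p,q)$-forms on $\mathbb P\tilde M$: $\varphi=\frac1{p!q!}\varphi_{\alpha_1\cdots\alpha_p\bar\beta_1\cdots\bar\beta_q}dz^{\alpha_1}\wedge\cdots\wedge dz^{\alpha_p}\wedge d\bar z^{\beta_1}\wedge\cdots\wedge d\bar z^{\beta_q}$ (coefficients skew-symmetric, invariant under $v\mapsto\zeta v$). The operators $\partial_{\mathcal H}:\mathcal A^{p,q}\to\mathcal A^{p+1,q}$ and $\bar\partial_{\mathcal H}:\mathcal A^{p,q}\to\mathcal A^{p,q+1}$ are given by the usual coordinate formulas for $\partial,\bar\partial$ with $\partial/\partial z^\mu,\partial/\partial\bar z^\nu$ replaced by $\delta_\mu,\delta_{\bar\nu}$. The pointwise inner product is $\langle\varphi,\psi\rangle_{\mathbb P\tilde M}=\frac1{p!q!}\varphi_{\alpha_1\cdots\alpha_p\bar\beta_1\cdots\bar\beta_q}G^{\bar\gamma_1\alpha_1}\cdots G^{\bar\gamma_p\alpha_p}G^{\bar\beta_1\kappa_1}\cdots G^{\bar\beta_q\kappa_q}\overline{\psi_{\gamma_1\cdots\gamma_p\bar\kappa_1\cdots\bar\kappa_q}}$. For $M$ compact, $(\varphi,\psi)_{\mathbb P\tilde M}=\int_{\mathbb P\tilde M}\langle\varphi,\psi\rangle_{\mathbb P\tilde M}\,d\mu_{\mathbb P\tilde M}$, and $\partial_{\mathcal H}^*,\bar\partial_{\mathcal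 H}^*$ are the formal adjoints of $\partial_{\mathcal H},\bar\partial_{\mathcal H}$. A strongly pseudoconvex $F$ on a compact $M$ is balanced if $(\partial_{\mathcal H}^*+\bar\partial_{\mathcal H}^* )\omega_{\mathcal H}=0$. *)

theory Defs
  imports "HOL-Analysis.Analysis"
begin

section \<open>Smooth and holomorphic maps, Wirtinger derivatives\<close>

text \<open>All predicates in this section are meant for open sets.\<close>

fun Ck_on :: "nat \<Rightarrow> ('e::real_normed_vector \<Rightarrow> 'f::real_normed_vector) \<Rightarrow> 'e set \<Rightarrow> bool" where
  "Ck_on 0 f S \<longleftrightarrow> continuous_on S f"
| "Ck_on (Suc k) f S \<longleftrightarrow>
     (\<forall>x\<in>S. f differentiable (at x)) \<and> (\<forall>e. Ck_on k (\<lambda>x. frechet_derivative f (at x) e) S)"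

definition smooth_on :: "'e set \<Rightarrow> ('e::real_normed_vector \<Rightarrow> 'f::real_normed_vector) \<Rightarrow> bool" where
  "smooth_on S f \<longleftrightarrow> (\<forall>k. Ck_on k f S)"

definition holomorphic_map_on :: "(complex^'n) set \<Rightarrow> (complex^'n \<Rightarrow> complex^'m) \<Rightarrow> bool" where
  "holomorphic_map_on S f \<longleftrightarrow>
     (\<forall>z\<in>S. \<exists>D. (f has_derivative D) (at z) \<and> (\<forall>\<zeta> v. D (\<zeta> *s v) = \<zeta> *s D v))"

text \<open>If \<open>e\<close> and \<open>e'\<close> are the coordinate vectors of \<open>\<partial>/\<partial>x\<close> and \<open>\<partial>/\<partial>y\<close>, these are the derivatives by
  \<open>z = x + \<i> y\<close> and by its conjugate.\<close>

definition wirtinger :: "'e \<Rightarrow> 'e \<Rightarrow> ('e::real_normed_vector \<Rightarrow> complex) \<Rightarrow> 'e \<Rightarrow> complex" where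
  "wirtinger e e' f x =
     (frechet_derivative f (at x) e - \<i> * frechet_derivative f (at x) e') / 2"

definition wirtinger_bar :: "'e \<Rightarrow> 'e \<Rightarrow> ('e::real_normed_vector \<Rightarrow> complex) \<Rightarrow> 'e \<Rightarrow> complex" where
  "wirtinger_bar e e' f x =
     (frechet_derivative f (at x) e + \<i> * frechet_derivative f (at x) e') / 2"

text \<open>A point \<open>(z, v)\<close> of \<open>complex^'n \<times> complex^'n\<close> stands for the induced coordinates on the
  holomorphic tangent bundle.\<close>

definition d_z :: "'n \<Rightarrow> ((complex^'n) \<times> (complex^'n) \<Rightarrow> complex) \<Rightarrow> (complex^'n) \<times> (complex^'n) \<Rightarrow> complex" where
  "d_z \<mu> = wirtinger (axis \<mu> 1, 0) (axis \<mu> \<i>, 0)"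

definition d_zbar :: "'n \<Rightarrow> ((complex^'n) \<times> (complex^'n) \<Rightarrow> complex) \<Rightarrow> (complex^'n) \<times> (complex^'n) \<Rightarrow> complex" where
  "d_zbar \<mu> = wirtinger_bar (axis \<mu> 1, 0) (axis \<mu> \<i>, 0)"

definition d_v :: "'n \<Rightarrow> ((complex^'n) \<times> (complex^'n) \<Rightarrow> complex) \<Rightarrow> (complex^'n) \<times> (complex^'n) \<Rightarrow> complex" where
  "d_v \<alpha> = wirtinger (0, axis \<alpha> 1) (0, axis \<alpha> \<i>)"

definition d_vbar :: "'n \<Rightarrow> ((complex^'n) \<times> (complex^'n) \<Rightarrow> complex) \<Rightarrow> (complex^'n) \<times> (complex^'n) \<Rightarrow> complex" where
  "d_vbar \<alpha> = wirtinger_bar (0, axis \<alpha> 1) (0, axis \<alpha> \<i>)"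


section \<open>Complex manifolds and the holomorphic tangent bundle\<close>

text \<open>The manifold is the whole type \<open>'a\<close>, its dimension is \<open>CARD('n)\<close>. A chart is a pair of its domain
  and its coordinate map, whose values outside the domain are irrelevant.\<close>

type_synonym ('a, 'n) chart = "'a set \<times> ('a \<Rightarrow> complex^'n)"

definition chart_inv :: "('a, 'n::finite) chart \<Rightarrow> complex^'n \<Rightarrow> 'a" where
  "chart_inv c = inv_into (fst c) (snd c)"

definition chart_img :: "('a, 'n::finite) chart \<Rightarrow> (complex^'n) set" where
  "chart_img c = snd c ` fst c"

definition transition :: "('a, 'n::finite) chart \<Rightarrow> ('a, 'n) chart \<Rightarrow> complex^'n \<Rightarrow> complex^'n" where
  "transition c d = snd d \<circ> chart_inv c"

definition transition_deriv ::
  "('a, 'n::finite) chart \<Rightarrow> ('a, 'n) chart \<Rightarrow> complex^'n \<Rightarrow> complex^'n \<Rightarrow> complex^'n" where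
  "transition_deriv c d z = frechet_derivative (transition c d) (at z)"

definition complex_atlas :: "('a::topological_space, 'n::finite) chart set \<Rightarrow> bool" where
  "complex_atlas A \<longleftrightarrow>
     (\<Union>c\<in>A. fst c) = UNIV \<and>
     (\<forall>c\<in>A. open (fst c) \<and> open (chart_img c) \<and>
             homeomorphism (fst c) (chart_img c) (snd c) (chart_inv c)) \<and>
     (\<forall>c\<in>A. \<forall>d\<in>A. holomorphic_map_on (snd c ` (fst c \<inter> fst d)) (transition c d))"

definition smooth_fun :: "('a, 'n::finite) chart set \<Rightarrow> ('a \<Rightarrow> real) \<Rightarrow> bool" where
  "smooth_fun A \<rho> \<longleftrightarrow> (\<forall>c\<in>A. smooth_on (chart_img c) (\<rho> \<circ> chart_inv c))"

text \<open>A holomorphic tangent vector at \<open>p\<close> is given by its components in all charts at \<open>p\<close>, related by the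
  Jacobians of the transition maps; the component function is \<open>0\<close> at all other charts.\<close>

type_synonym ('a, 'n) tvec = "'a \<times> (('a, 'n) chart \<Rightarrow> complex^'n)"

definition TM :: "('a, 'n::finite) chart set \<Rightarrow> ('a, 'n) tvec set" where
  "TM A = {(p, \<xi>).
     (\<forall>c\<in>A. \<forall>d\<in>A. p \<in> fst c \<inter> fst d \<longrightarrow> \<xi> d = transition_deriv c d (snd c p) (\<xi> c)) \<and>
     (\<forall>c. c \<notin> A \<or> p \<notin> fst c \<longrightarrow> \<xi> c = 0)}"

definition TM0 :: "('a, 'n::finite) chart set \<Rightarrow> ('a, 'n) tvec set" where
  "TM0 A = {t \<in> TM A. snd t \<noteq> (\<lambda>_. 0)}"

definition tscale :: "complex \<Rightarrow> ('a, 'n::finite) tvec \<Rightarrow> ('a, 'n) tvec" where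
  "tscale \<zeta> t = (fst t, \<lambda>c. \<zeta> *s snd t c)"

text \<open>The tangent vector with coordinates \<open>(z, v)\<close> in the chart \<open>c\<close>.\<close>

definition tvec_of :: "('a, 'n::finite) chart set \<Rightarrow> ('a, 'n) chart \<Rightarrow> (complex^'n) \<times> (complex^'n) \<Rightarrow> ('a, 'n) tvec" where
  "tvec_of A c x = (chart_inv c (fst x),
     \<lambda>d. if d \<in> A \<and> chart_inv c (fst x) \<in> fst d then transition_deriv c d (fst x) (snd x) else 0)"

definition TM_coords :: "('a, 'n::finite) chart \<Rightarrow> ((complex^'n) \<times> (complex^'n)) set" where
  "TM_coords c = chart_img c \<times> UNIV"

definition TM0_coords :: "('a, 'n::finite) chart \<Rightarrow> ((complex^'n) \<times> (complex^'n)) set" where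
  "TM0_coords c = chart_img c \<times> (- {0})"


section \<open>Complex Finsler metrics\<close>

definition G_loc :: "('a, 'n::finite) chart set \<Rightarrow> (('a, 'n) tvec \<Rightarrow> real) \<Rightarrow> ('a, 'n) chart \<Rightarrow>
    (complex^'n) \<times> (complex^'n) \<Rightarrow> real" where
  "G_loc A F c x = (F (tvec_of A c x))\<^sup>2"

definition complex_finsler :: "('a, 'n::finite) chart set \<Rightarrow> (('a, 'n) tvec \<Rightarrow> real) \<Rightarrow> bool" where
  "complex_finsler A F \<longleftrightarrow>
     (\<forall>c\<in>A. continuous_on (TM_coords c) (\<lambda>x. F (tvec_of A c x))) \<and>
     (\<forall>c\<in>A. smooth_on (TM0_coords c) (G_loc A F c)) \<and>
     (\<forall>t\<in>TM A. F t \<ge> 0) \<and> (\<forall>t\<in>TM0 A. F t > 0) \<and>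
     (\<forall>t\<in>TM A. \<forall>\<zeta>. F (tscale \<zeta> t) = cmod \<zeta> * F t)"

definition Gc :: "('a, 'n::finite) chart set \<Rightarrow> (('a, 'n) tvec \<Rightarrow> real) \<Rightarrow> ('a, 'n) chart \<Rightarrow>
    (complex^'n) \<times> (complex^'n) \<Rightarrow> complex" where
  "Gc A F c x = complex_of_real (G_loc A F c x)"

text \<open>Entry \<open>(\<alpha>, \<beta>)\<close> of \<open>Gmat\<close> is \<open>\<partial>\<^sup>2 G / \<partial>v\<^sup>\<alpha> \<partial>vbar\<^sup>\<beta>\<close>; entry \<open>(\<beta>, \<alpha>)\<close> of \<open>Ginv\<close> is the upper-index
  coefficient with first index \<open>\<beta>\<close> barred and second index \<open>\<alpha>\<close> unbarred.\<close>

definition Gmat :: "('a, 'n::finite) chart set \<Rightarrow> (('a, 'n) tvec \<Rightarrow> real) \<Rightarrow> ('a, 'n) chart \<Rightarrow>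
    (complex^'n) \<times> (complex^'n) \<Rightarrow> complex^'n^'n" where
  "Gmat A F c x = (\<chi> \<alpha> \<beta>. d_v \<alpha> (d_vbar \<beta> (Gc A F c)) x)"

definition Ginv :: "('a, 'n::finite) chart set \<Rightarrow> (('a, 'n) tvec \<Rightarrow> real) \<Rightarrow> ('a, 'n) chart \<Rightarrow>
    (complex^'n) \<times> (complex^'n) \<Rightarrow> complex^'n^'n" where
  "Ginv A F c x = matrix_inv (Gmat A F c x)"

definition positive_definite :: "complex^'n^'n \<Rightarrow> bool" where
  "positive_definite H \<longleftrightarrow>
     (\<forall>\<alpha> \<beta>. H $ \<beta> $ \<alpha> = cnj (H $ \<alpha> $ \<beta>)) \<and>
     (\<forall>w. w \<noteq> 0 \<longrightarrow> Re (\<Sum>\<alpha>\<in>UNIV. \<Sum>\<beta>\<in>UNIV. H $ \<alpha> $ \<beta> * w $ \<alpha> * cnj (w $ \<beta>)) > 0)"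

definition strongly_pseudoconvex :: "('a, 'n::finite) chart set \<Rightarrow> (('a, 'n) tvec \<Rightarrow> real) \<Rightarrow> bool" where
  "strongly_pseudoconvex A F \<longleftrightarrow>
     complex_finsler A F \<and> (\<forall>c\<in>A. \<forall>x\<in>TM0_coords c. positive_definite (Gmat A F c x))"

text \<open>\<open>Gamma A F c \<alpha> \<mu>\<close> is \<open>\<Gamma>\<^sup>\<alpha>\<close> with lower index \<open>;\<mu>\<close>, and \<open>Gamma2 A F c \<alpha> \<beta> \<mu>\<close> is \<open>\<Gamma>\<^sup>\<alpha>\<close> with lower
  indices \<open>\<beta>;\<mu>\<close>.\<close>

definition Gamma :: "('a, 'n::finite) chart set \<Rightarrow> (('a, 'n) tvec \<Rightarrow> real) \<Rightarrow> ('a, 'n) chart \<Rightarrow>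
    'n \<Rightarrow> 'n \<Rightarrow> (complex^'n) \<times> (complex^'n) \<Rightarrow> complex" where
  "Gamma A F c \<alpha> \<mu> x = (\<Sum>\<kappa>\<in>UNIV. Ginv A F c x $ \<kappa> $ \<alpha> * d_vbar \<kappa> (d_z \<mu> (Gc A F c)) x)"

definition delta :: "('a, 'n::finite) chart set \<Rightarrow> (('a, 'n) tvec \<Rightarrow> real) \<Rightarrow> ('a, 'n) chart \<Rightarrow>
    'n \<Rightarrow> ((complex^'n) \<times> (complex^'n) \<Rightarrow> complex) \<Rightarrow> (complex^'n) \<times> (complex^'n) \<Rightarrow> complex" where
  "delta A F c \<mu> f x = d_z \<mu> f x - (\<Sum>\<alpha>\<in>UNIV. Gamma A F c \<alpha> \<mu> x * d_v \<alpha> f x)"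

definition delta_bar :: "('a, 'n::finite) chart set \<Rightarrow> (('a, 'n) tvec \<Rightarrow> real) \<Rightarrow> ('a, 'n) chart \<Rightarrow>
    'n \<Rightarrow> ((complex^'n) \<times> (complex^'n) \<Rightarrow> complex) \<Rightarrow> (complex^'n) \<times> (complex^'n) \<Rightarrow> complex" where
  "delta_bar A F c \<mu> f x = d_zbar \<mu> f x - (\<Sum>\<alpha>\<in>UNIV. cnj (Gamma A F c \<alpha> \<mu> x) * d_vbar \<alpha> f x)"

definition Gamma2 :: "('a, 'n::finite) chart set \<Rightarrow> (('a, 'n) tvec \<Rightarrow> real) \<Rightarrow> ('a, 'n) chart \<Rightarrow>
    'n \<Rightarrow> 'n \<Rightarrow> 'n \<Rightarrow> (complex^'n) \<times> (complex^'n) \<Rightarrow> complex" where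
  "Gamma2 A F c \<alpha> \<beta> \<mu> x =
     (\<Sum>\<kappa>\<in>UNIV. Ginv A F c x $ \<kappa> $ \<alpha> * delta A F c \<mu> (\<lambda>y. Gmat A F c y $ \<beta> $ \<kappa>) x)"

definition rund_curvature :: "('a, 'n::finite) chart set \<Rightarrow> (('a, 'n) tvec \<Rightarrow> real) \<Rightarrow> ('a, 'n) chart \<Rightarrow>
    'n \<Rightarrow> 'n \<Rightarrow> 'n \<Rightarrow> 'n \<Rightarrow> (complex^'n) \<times> (complex^'n) \<Rightarrow> complex" where
  "rund_curvature A F c \<alpha> \<beta> \<mu> \<nu> x = - delta_bar A F c \<nu> (Gamma2 A F c \<alpha> \<beta> \<mu>) x"

definition rund_kaehler_finsler_like :: "('a, 'n::finite) chart set \<Rightarrow> (('a, 'n) tvec \<Rightarrow> real) \<Rightarrow> bool" where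
  "rund_kaehler_finsler_like A F \<longleftrightarrow>
     strongly_pseudoconvex A F \<and>
     (\<forall>c\<in>A. \<forall>x\<in>TM0_coords c. \<forall>\<alpha> \<beta> \<mu> \<nu>.
        rund_curvature A F c \<alpha> \<beta> \<mu> \<nu> x = rund_curvature A F c \<alpha> \<mu> \<beta> \<nu> x)"


section \<open>Conformal changes\<close>

definition conformal_change :: "('a \<Rightarrow> real) \<Rightarrow> (('a, 'n::finite) tvec \<Rightarrow> real) \<Rightarrow> ('a, 'n) tvec \<Rightarrow> real" where
  "conformal_change \<rho> F t = exp (\<rho> (fst t) / 2) * F t"

text \<open>A metric matters only through its values on the tangent bundle.\<close>

definition conformal_class :: "('a, 'n::finite) chart set \<Rightarrow> (('a, 'n) tvec \<Rightarrow> real) \<Rightarrow> (('a, 'n) tvec \<Rightarrow> real) set" where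
  "conformal_class A F = {F'. strongly_pseudoconvex A F' \<and>
     (\<exists>\<rho>. smooth_fun A \<rho> \<and> (\<forall>t\<in>TM A. F' t = conformal_change \<rho> F t))}"

text \<open>The coefficient of \<open>dz\<^sup>\<alpha> \<and> dzbar\<^sup>\<beta>\<close> in \<open>\<partial>\<partial>bar \<rho>\<close>.\<close>

definition ddbar :: "('a, 'n::finite) chart \<Rightarrow> ('a \<Rightarrow> real) \<Rightarrow> 'n \<Rightarrow> 'n \<Rightarrow> complex^'n \<Rightarrow> complex" where
  "ddbar c \<rho> \<alpha> \<beta> =
     wirtinger (axis \<alpha> 1) (axis \<alpha> \<i>)
       (wirtinger_bar (axis \<beta> 1) (axis \<beta> \<i>) (\<lambda>z. complex_of_real (\<rho> (chart_inv c z))))"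

definition ddbar_zero :: "('a, 'n::finite) chart set \<Rightarrow> ('a \<Rightarrow> real) \<Rightarrow> bool" where
  "ddbar_zero A \<rho> \<longleftrightarrow> (\<forall>c\<in>A. \<forall>z\<in>chart_img c. \<forall>\<alpha> \<beta>. ddbar c \<rho> \<alpha> \<beta> z = 0)"


section \<open>Horizontal forms on the projectivized tangent bundle\<close>

text \<open>Functions on the projectivized tangent bundle are functions of nonzero tangent vectors invariant
  under scaling. A horizontal form is given by its coefficients: \<open>\<phi> c I J\<close> is, in the chart \<open>c\<close>, the
  coefficient with unbarred indices \<open>I\<close> and barred indices \<open>J\<close>, as a function of \<open>(z, v)\<close>. Coefficients
  of the wrong degree are \<open>0\<close>, so that forms of different bidegrees can be added.\<close>

type_synonym ('a, 'n) hform =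
  "('a, 'n) chart \<Rightarrow> 'n list \<Rightarrow> 'n list \<Rightarrow> (complex^'n) \<times> (complex^'n) \<Rightarrow> complex"

definition swap_entries :: "nat \<Rightarrow> nat \<Rightarrow> 'n list \<Rightarrow> 'n list" where
  "swap_entries i j I = I[i := I ! j, j := I ! i]"

definition jac :: "('a, 'n::finite) chart \<Rightarrow> ('a, 'n) chart \<Rightarrow> complex^'n \<Rightarrow> 'n \<Rightarrow> 'n \<Rightarrow> complex" where
  "jac c d z \<kappa> \<alpha> = transition_deriv c d z (axis \<alpha> 1) $ \<kappa>"

definition hforms :: "('a, 'n::finite) chart set \<Rightarrow> nat \<Rightarrow> nat \<Rightarrow> ('a, 'n) hform set" where
  "hforms A p q = {\<phi>.
     (\<forall>c I J x. length I \<noteq> p \<or> length J \<noteq> q \<longrightarrow> \<phi> c I J x = 0) \<and>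
     (\<forall>c\<in>A. \<forall>I J. smooth_on (TM0_coords c) (\<phi> c I J)) \<and>
     (\<forall>c\<in>A. \<forall>I J. \<forall>x\<in>TM0_coords c.
        (\<forall>i<length I. \<forall>j<length I. i \<noteq> j \<longrightarrow> \<phi> c (swap_entries i j I) J x = - \<phi> c I J x) \<and>
        (\<forall>i<length J. \<forall>j<length J. i \<noteq> j \<longrightarrow> \<phi> c I (swap_entries i j J) x = - \<phi> c I J x)) \<and>
     (\<forall>c\<in>A. \<forall>I J. \<forall>(z, v)\<in>TM0_coords c. \<forall>\<zeta>. \<zeta> \<noteq> 0 \<longrightarrow> \<phi> c I J (z, \<zeta> *s v) = \<phi> c I J (z, v)) \<and>
     (\<forall>c\<in>A. \<forall>d\<in>A. \<forall>z\<in>snd c ` (fst c \<inter> fst d). \<forall>v. v \<noteq> 0 \<longrightarrow>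
        (\<forall>I J. length I = p \<and> length J = q \<longrightarrow>
           \<phi> c I J (z, v) =
             (\<Sum>K | length K = p. \<Sum>L | length L = q.
                (\<Prod>i<p. jac c d z (K ! i) (I ! i)) * (\<Prod>j<q. cnj (jac c d z (L ! j) (J ! j))) *
                \<phi> d K L (transition c d z, transition_deriv c d z v))))}"

definition hform_eq :: "('a, 'n::finite) chart set \<Rightarrow> ('a, 'n) hform \<Rightarrow> ('a, 'n) hform \<Rightarrow> bool" where
  "hform_eq A \<phi> \<psi> \<longleftrightarrow> (\<forall>c\<in>A. \<forall>I J. \<forall>x\<in>TM0_coords c. \<phi> c I J x = \<psi> c I J x)"

definition hform_add :: "('a, 'n::finite) hform \<Rightarrow> ('a, 'n) hform \<Rightarrow> ('a, 'n) hform" where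
  "hform_add \<phi> \<psi> = (\<lambda>c I J x. \<phi> c I J x + \<psi> c I J x)"

definition hform_zero :: "('a, 'n::finite) hform" where
  "hform_zero = (\<lambda>c I J x. 0)"

definition remove_nth :: "nat \<Rightarrow> 'n list \<Rightarrow> 'n list" where
  "remove_nth i I = take i I @ drop (Suc i) I"

definition del_H :: "('a, 'n::finite) chart set \<Rightarrow> (('a, 'n) tvec \<Rightarrow> real) \<Rightarrow> ('a, 'n) hform \<Rightarrow> ('a, 'n) hform" where
  "del_H A F \<phi> = (\<lambda>c I J x.
     \<Sum>i<length I. (-1) ^ i * delta A F c (I ! i) (\<phi> c (remove_nth i I) J) x)"

text \<open>The sign \<open>(-1) ^ length I\<close> comes from moving the new barred differential past the unbarred ones.\<close>

definition delbar_H :: "('a, 'n::finite) chart set \<Rightarrow> (('a, 'n) tvec \<Rightarrow> real) \<Rightarrow> ('a, 'n) hform \<Rightarrow> ('a, 'n) hform" where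
  "delbar_H A F \<phi> = (\<lambda>c I J x.
     (-1) ^ length I *
     (\<Sum>j<length J. (-1) ^ j * delta_bar A F c (J ! j) (\<phi> c I (remove_nth j J)) x))"

definition omega_H :: "('a, 'n::finite) chart set \<Rightarrow> (('a, 'n) tvec \<Rightarrow> real) \<Rightarrow> ('a, 'n) hform" where
  "omega_H A F = (\<lambda>c I J x.
     if length I = 1 \<and> length J = 1 then \<i> * Gmat A F c x $ (I ! 0) $ (J ! 0) else 0)"

definition inner_pt :: "('a, 'n::finite) chart set \<Rightarrow> (('a, 'n) tvec \<Rightarrow> real) \<Rightarrow> nat \<Rightarrow> nat \<Rightarrow>
    ('a, 'n) hform \<Rightarrow> ('a, 'n) hform \<Rightarrow> ('a, 'n) chart \<Rightarrow> (complex^'n) \<times> (complex^'n) \<Rightarrow> complex" where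
  "inner_pt A F p q \<phi> \<psi> c x =
     (1 / (fact p * fact q)) *
     (\<Sum>I | length I = p. \<Sum>J | length J = q. \<Sum>K | length K = p. \<Sum>L | length L = q.
        \<phi> c I J x *
        (\<Prod>i<p. Ginv A F c x $ (K ! i) $ (I ! i)) * (\<Prod>j<q. Ginv A F c x $ (J ! j) $ (L ! j)) *
        cnj (\<psi> c K L x))"


section \<open>The volume form and integration on the projectivized tangent bundle\<close>

text \<open>The real two-form \<open>\<i> H\<^sub>\<alpha>\<^sub>\<beta> \<theta>\<^sup>\<alpha> \<and> \<theta>bar\<^sup>\<beta>\<close>, evaluated at two tangent vectors. Tangent vectors of the
  tangent bundle are given in real terms by their components in \<open>complex^'n \<times> complex^'n\<close>.\<close>

definition two_form :: "complex^'n^'n \<Rightarrow> ('e \<Rightarrow> complex^'n) \<Rightarrow> 'e \<Rightarrow> 'e \<Rightarrow> complex" where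
  "two_form H \<theta> X Y =
     \<i> * (\<Sum>\<alpha>\<in>UNIV. \<Sum>\<beta>\<in>UNIV. H $ \<alpha> $ \<beta> *
            (\<theta> X $ \<alpha> * cnj (\<theta> Y $ \<beta>) - \<theta> Y $ \<alpha> * cnj (\<theta> X $ \<beta>)))"

definition delta_v :: "('a, 'n::finite) chart set \<Rightarrow> (('a, 'n) tvec \<Rightarrow> real) \<Rightarrow> ('a, 'n) chart \<Rightarrow>
    (complex^'n) \<times> (complex^'n) \<Rightarrow> (complex^'n) \<times> (complex^'n) \<Rightarrow> complex^'n" where
  "delta_v A F c x X = (\<chi> \<alpha>. snd X $ \<alpha> + (\<Sum>\<beta>\<in>UNIV. Gamma A F c \<alpha> \<beta> x * fst X $ \<beta>))"

definition logG_mat :: "('a, 'n::finite) chart set \<Rightarrow> (('a, 'n) tvec \<Rightarrow> real) \<Rightarrow> ('a, 'n) chart \<Rightarrow>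
    (complex^'n) \<times> (complex^'n) \<Rightarrow> complex^'n^'n" where
  "logG_mat A F c x =
     (\<chi> \<alpha> \<beta>. d_v \<alpha> (d_vbar \<beta> (\<lambda>y. complex_of_real (ln (G_loc A F c y)))) x)"

definition omega_V_form :: "('a, 'n::finite) chart set \<Rightarrow> (('a, 'n) tvec \<Rightarrow> real) \<Rightarrow> ('a, 'n) chart \<Rightarrow>
    (complex^'n) \<times> (complex^'n) \<Rightarrow> (complex^'n) \<times> (complex^'n) \<Rightarrow> (complex^'n) \<times> (complex^'n) \<Rightarrow> complex" where
  "omega_V_form A F c x = two_form (logG_mat A F c x) (delta_v A F c x)"

definition omega_H_form :: "('a, 'n::finite) chart set \<Rightarrow> (('a, 'n) tvec \<Rightarrow> real) \<Rightarrow> ('a, 'n) chart \<Rightarrow>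
    (complex^'n) \<times> (complex^'n) \<Rightarrow> (complex^'n) \<times> (complex^'n) \<Rightarrow> (complex^'n) \<times> (complex^'n) \<Rightarrow> complex" where
  "omega_H_form A F c x = two_form (Gmat A F c x) fst"

text \<open>The wedge product of the two-forms \<open>\<omega> s\<close>, \<open>s \<in> S\<close>, evaluated at the vectors
  \<open>e (s, False), e (s, True)\<close>, \<open>s \<in> S\<close>, where the two vectors of each \<open>s\<close> are adjacent. As two-forms
  commute, the order of the pairs is irrelevant.\<close>

definition wedge_two_forms :: "'s set \<Rightarrow> ('s \<Rightarrow> 'e \<Rightarrow> 'e \<Rightarrow> complex) \<Rightarrow> ('s \<times> bool \<Rightarrow> 'e) \<Rightarrow> complex" where
  "wedge_two_forms S \<omega> e =
     (\<Sum>\<sigma> | \<sigma> permutes (S \<times> UNIV).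
        of_int (sign \<sigma>) * (\<Prod>s\<in>S. \<omega> s (e (\<sigma> (s, False))) (e (\<sigma> (s, True))))) / 2 ^ card S"

text \<open>For \<open>a :: 'n\<close>, the part \<open>v\<^sup>a \<noteq> 0\<close> of the projectivized tangent bundle over the domain of \<open>c\<close> has the
  coordinates \<open>z\<close> and \<open>w\<^sup>b = v\<^sup>b / v\<^sup>a\<close>, \<open>b \<noteq> a\<close>; forms on it are pulled back by the section \<open>v\<^sup>a = 1\<close>. The
  slots \<open>Inl \<alpha>\<close> and \<open>Inr b\<close> index \<open>z\<^sup>\<alpha>\<close> and \<open>w\<^sup>b\<close>; the flag selects real or imaginary part.\<close>

definition affine_vec :: "'n \<Rightarrow> ('n::finite \<Rightarrow> complex) \<Rightarrow> complex^'n" where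
  "affine_vec a w = (\<chi> b. if b = a then 1 else w b)"

fun frame :: "('n::finite + 'n) \<times> bool \<Rightarrow> (complex^'n) \<times> (complex^'n)" where
  "frame (Inl \<alpha>, r) = (axis \<alpha> (if r then \<i> else 1), 0)"
| "frame (Inr b, r) = (0, axis b (if r then \<i> else 1))"

definition vol_density :: "('a, 'n::finite) chart set \<Rightarrow> (('a, 'n) tvec \<Rightarrow> real) \<Rightarrow> ('a, 'n) chart \<Rightarrow> 'n \<Rightarrow>
    (complex^'n) \<times> (complex^'n) \<Rightarrow> complex" where
  "vol_density A F c a x =
     wedge_two_forms (UNIV <+> (UNIV - {a}))
       (case_sum (\<lambda>_. omega_H_form A F c x) (\<lambda>_. omega_V_form A F c x)) frame
     / (fact (CARD('n) - 1) * fact CARD('n))"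

text \<open>A finite partition of unity on the projectivized tangent bundle, each of whose members vanishes
  outside a compact subset of one of the above coordinate domains.\<close>

definition PTM_partition :: "('a, 'n::finite) chart set \<Rightarrow> (('a, 'n) chart \<times> 'n) set \<Rightarrow>
    (('a, 'n) chart \<times> 'n \<Rightarrow> ('a, 'n) tvec \<Rightarrow> real) \<Rightarrow> bool" where
  "PTM_partition A I \<theta> \<longleftrightarrow>
     finite I \<and> I \<subseteq> A \<times> UNIV \<and>
     (\<forall>k\<in>I. \<forall>d\<in>A. continuous_on (TM0_coords d) (\<lambda>x. \<theta> k (tvec_of A d x))) \<and>
     (\<forall>k\<in>I. \<forall>t\<in>TM0 A. \<theta> k t \<ge> 0 \<and> (\<forall>\<zeta>. \<zeta> \<noteq> 0 \<longrightarrow> \<theta> k (tscale \<zeta> t) = \<theta> k t)) \<and>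
     (\<forall>(c, a)\<in>I. \<exists>K. compact K \<and> K \<subseteq> chart_img c \<times> {v. v $ a = 1} \<and>
        (\<forall>t\<in>TM0 A. \<theta> (c, a) t \<noteq> 0 \<longrightarrow>
           fst t \<in> fst c \<and> snd t c $ a \<noteq> 0 \<and>
           (snd c (fst t), (1 / (snd t c $ a)) *s snd t c) \<in> K)) \<and>
     (\<forall>t\<in>TM0 A. (\<Sum>k\<in>I. \<theta> k t) = 1)"

text \<open>The integral of \<open>f d\<mu>\<close> over the projectivized tangent bundle of a compact manifold, where \<open>f\<close> is a
  function on it expressed in all charts. It does not depend on the partition of unity.\<close>

definition PTM_integral_wrt :: "(('a, 'n) chart \<times> 'n) set \<Rightarrow> (('a, 'n) chart \<times> 'n \<Rightarrow> ('a, 'n) tvec \<Rightarrow> real) \<Rightarrow>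
    ('a, 'n::finite) chart set \<Rightarrow> (('a, 'n) tvec \<Rightarrow> real) \<Rightarrow>
    (('a, 'n) chart \<Rightarrow> (complex^'n) \<times> (complex^'n) \<Rightarrow> complex) \<Rightarrow> complex" where
  "PTM_integral_wrt I \<theta> A F f =
     (\<Sum>(c, a)\<in>I.
        \<integral>y. (let x = (fst y, affine_vec a (snd y)) in
              indicator (chart_img c) (fst y) * complex_of_real (\<theta> (c, a) (tvec_of A c x)) *
              f c x * vol_density A F c a x)
        \<partial>(lborel \<Otimes>\<^sub>M Pi\<^sub>M (UNIV - {a}) (\<lambda>_. lborel)))"

definition PTM_integral :: "('a, 'n::finite) chart set \<Rightarrow> (('a, 'n) tvec \<Rightarrow> real) \<Rightarrow>
    (('a, 'n) chart \<Rightarrow> (complex^'n) \<times> (complex^'n) \<Rightarrow> complex) \<Rightarrow> complex" where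
  "PTM_integral A F f =
     (let (I, \<theta>) = (SOME P. PTM_partition A (fst P) (snd P)) in PTM_integral_wrt I \<theta> A F f)"

definition inner_PTM :: "('a, 'n::finite) chart set \<Rightarrow> (('a, 'n) tvec \<Rightarrow> real) \<Rightarrow> nat \<Rightarrow> nat \<Rightarrow>
    ('a, 'n) hform \<Rightarrow> ('a, 'n) hform \<Rightarrow> complex" where
  "inner_PTM A F p q \<phi> \<psi> = PTM_integral A F (inner_pt A F p q \<phi> \<psi>)"


section \<open>Balanced metrics\<close>

text \<open>\<open>del_H_adjoint A F p q \<psi> \<eta>\<close> says that the formal adjoint of \<open>\<partial>\<^sub>H\<close> from \<open>(p, q)\<close>- to \<open>(p + 1, q)\<close>-forms
  takes \<open>\<psi>\<close> to \<open>\<eta>\<close>; similarly for its conjugate.\<close>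

definition del_H_adjoint :: "('a, 'n::finite) chart set \<Rightarrow> (('a, 'n) tvec \<Rightarrow> real) \<Rightarrow> nat \<Rightarrow> nat \<Rightarrow>
    ('a, 'n) hform \<Rightarrow> ('a, 'n) hform \<Rightarrow> bool" where
  "del_H_adjoint A F p q \<psi> \<eta> \<longleftrightarrow>
     \<eta> \<in> hforms A p q \<and>
     (\<forall>\<phi>\<in>hforms A p q. inner_PTM A F (Suc p) q (del_H A F \<phi>) \<psi> = inner_PTM A F p q \<phi> \<eta>)"

definition delbar_H_adjoint :: "('a, 'n::finite) chart set \<Rightarrow> (('a, 'n) tvec \<Rightarrow> real) \<Rightarrow> nat \<Rightarrow> nat \<Rightarrow>
    ('a, 'n) hform \<Rightarrow> ('a, 'n) hform \<Rightarrow> bool" where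
  "delbar_H_adjoint A F p q \<psi> \<eta> \<longleftrightarrow>
     \<eta> \<in> hforms A p q \<and>
     (\<forall>\<phi>\<in>hforms A p q. inner_PTM A F p (Suc q) (delbar_H A F \<phi>) \<psi> = inner_PTM A F p q \<phi> \<eta>)"

text \<open>Only meant for compact manifolds.\<close>

definition balanced :: "('a, 'n::finite) chart set \<Rightarrow> (('a, 'n) tvec \<Rightarrow> real) \<Rightarrow> bool" where
  "balanced A F \<longleftrightarrow>
     strongly_pseudoconvex A F \<and>
     (\<exists>\<eta> \<eta>'. del_H_adjoint A F 0 1 (omega_H A F) \<eta> \<and> delbar_H_adjoint A F 1 0 (omega_H A F) \<eta>' \<and>
        hform_eq A (hform_add \<eta> \<eta>') hform_zero)"

end

theory Submission
  imports Defs "HOL-Complex_Analysis.Cauchy_Integral_Formula"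
begin

text \<open>Let \<open>n\<close> be the dimension.

  \<^emph>\<open>Uniqueness of balanced metrics.\<close> The two adjoints in the definition of a balanced metric have different
  bidegrees, so both vanish. The vanishing of the second says that the trace of \<open>\<partial>bar\<^sub>H \<phi>\<close> with respect to
  \<open>G\<close> has integral zero for every horizontal \<open>(1,0)\<close>-form \<open>\<phi>\<close> (\<open>balanced_zero\<close>). If
  \<open>F' = exp (\<rho>/2) F\<close>, then \<open>G' = exp \<rho> G\<close>, while \<open>\<omega>\<^sub>V\<close> does not change and \<open>\<omega>\<^sub>H\<close> is multiplied by
  \<open>exp \<rho>\<close>; hence \<open>d\<mu>' = exp (n \<rho>) d\<mu>\<close>, and the trace is multiplied by \<open>exp (-\<rho>)\<close>. With
  \<open>u = exp ((n - 1) \<rho>)\<close>, the condition on \<open>F'\<close> therefore reads \<open>\<integral> u tr(\<partial>bar \<phi>) d\<mu> = 0\<close>. Test \<open>F\<close>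
  with \<open>\<phi> = \<partial>(u\<^sup>2/2)\<close> and \<open>F'\<close> with \<open>\<phi> = \<partial>u\<close>. Both forms are pulled back from the manifold, so
  the operators \<open>\<delta>\<close> act on them as ordinary derivatives, and since
  \<open>\<partial>bar \<partial>(u\<^sup>2/2) = u \<partial>bar \<partial>u + \<partial>bar u \<and> \<partial>u\<close>, the difference of the two conditions is
  \<open>\<integral> |\<partial>u|\<^sup>2 d\<mu> = 0\<close> (\<open>trace_hess_difference\<close>). So \<open>\<partial>u = 0\<close>, and as \<open>n \<ge> 2\<close> and the manifold is
  connected, \<open>\<rho>\<close> is constant (\<open>balanced_conformal_factor_constant\<close>). Of the integral the argument uses
  only that it is a genuine positive functional: a partition of unity exists
  (\<open>PTM_partition_exists\<close>), the integrands are continuous with compact support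
  (\<open>affine_integrable\<close>), and the volume density is positive (\<open>vol_density_pos\<close>).

  \<^emph>\<open>Rund Kaehler-Finsler-like metrics.\<close> Under the conformal change the nonlinear connection changes by
  \<open>v\<^sup>\<alpha> \<partial>\<^sub>\<mu>\<rho>\<close> (\<open>Gamma_conformal\<close>), so \<open>\<delta>\<^sub>\<mu>\<close> changes by a multiple of the Euler field. The
  coefficients \<open>G\<^sub>\<alpha>\<^sub>\<beta>\<close> and those of the Rund connection are invariant under \<open>v \<mapsto> \<zeta> v\<close>, and the Euler
  field kills such functions. Therefore the connection coefficients change by
  \<open>\<delta>\<^sup>\<alpha>\<^sub>\<beta> \<partial>\<^sub>\<mu>\<rho>\<close> and the curvature by \<open>- \<delta>\<^sup>\<alpha>\<^sub>\<beta> \<partial>bar\<^sub>\<nu> \<partial>\<^sub>\<mu> \<rho>\<close>, a Kronecker delta times a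
  second derivative (\<open>rund_curvature_conformal\<close>). That term is symmetric in \<open>\<beta>\<close> and \<open>\<mu>\<close> exactly
  when it vanishes: for given \<open>\<mu>\<close> take \<open>\<alpha> = \<beta> \<noteq> \<mu>\<close>, which is possible for \<open>n \<ge> 2\<close>.\<close>

section \<open>Calculus of smooth functions\<close>

text \<open>The choice made by \<open>frechet_derivative\<close> depends only on the germ of the function at the point, so on
  an open set values outside the set do not matter.\<close>

lemma Ck_on_cong:
  assumes "open S" "\<And>x. x \<in> S \<Longrightarrow> f x = g x"
  shows "Ck_on k f S \<longleftrightarrow> Ck_on k g S"
  using assms(2)
proof (induction k arbitrary: f g)
  case 0
  then have "continuous_on S f \<longleftrightarrow> continuous_on S g" by (intro continuous_on_cong) auto
  then show ?case by simp
next
  case (Suc k)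
  have eq: "(f has_derivative D) (at x) \<longleftrightarrow> (g has_derivative D) (at x)" if "x \<in> S" for x D
    using has_derivative_transform_within_open[OF _ assms(1) that]
    by (metis Suc.prems)
  have "f differentiable at x \<longleftrightarrow> g differentiable at x" if "x \<in> S" for x
    using eq[OF that] by (simp add: differentiable_def)
  moreover have "frechet_derivative f (at x) = frechet_derivative g (at x)" if "x \<in> S" for x
    using eq[OF that] by (simp add: frechet_derivative_def)
  moreover have "Ck_on k (\<lambda>x. frechet_derivative f (at x) e) S \<longleftrightarrow> Ck_on k (\<lambda>x. frechet_derivative g (at x) e) S"
    if "\<And>x. x \<in> S \<Longrightarrow> frechet_derivative f (at x) = frechet_derivative g (at x)" for e
    by (rule Suc.IH) (simp only: that)
  ultimately show ?case unfolding Ck_on.simps by blast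
qed

lemma Ck_on_Suc_D: "Ck_on (Suc k) f S \<Longrightarrow> Ck_on k f S"
proof (induction k arbitrary: f)
  case 0
  then show ?case
    by (metis Ck_on.simps differentiable_at_withinI differentiable_imp_continuous_on differentiable_on_def)
next
  case (Suc k)
  then show ?case by (metis Ck_on.simps(2))
qed

text \<open>Closure properties are proved by induction on the order, exhibiting the derivative and showing
  that it is again built from functions of lower order.\<close>

lemma Ck_on_SucI:
  assumes "open S" "\<And>x. x \<in> S \<Longrightarrow> (f has_derivative D x) (at x)" "\<And>e. Ck_on k (\<lambda>x. D x e) S"
  shows "Ck_on (Suc k) f S"
proof -
  have "frechet_derivative f (at x) = D x" if "x \<in> S" for x
    using frechet_derivative_at[OF assms(2)[OF that]] by simp
  then have "Ck_on k (\<lambda>x. frechet_derivative f (at x) e) S" for e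
    by (subst Ck_on_cong[OF assms(1), where g = "\<lambda>x. D x e"]) (simp_all only: assms(3))
  moreover have "\<forall>x\<in>S. f differentiable at x" using assms(2) differentiable_def by blast
  ultimately show ?thesis by simp
qed

lemma Ck_on_Suc_derivative:
  "Ck_on (Suc k) f S \<Longrightarrow> x \<in> S \<Longrightarrow> (f has_derivative frechet_derivative f (at x)) (at x)"
  by (simp add: frechet_derivative_works[symmetric])

lemma Ck_on_const: "open S \<Longrightarrow> Ck_on k (\<lambda>x. a) S"
  by (induction k arbitrary: a) (auto intro!: Ck_on_SucI[where D = "\<lambda>x e. 0"] continuous_intros simp del: Ck_on.simps(2))

lemma Ck_on_add:
  "open S \<Longrightarrow> Ck_on k f S \<Longrightarrow> Ck_on k g S \<Longrightarrow> Ck_on k (\<lambda>x. f x + g x) S"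
proof (induction k arbitrary: f g)
  case 0
  then show ?case by (auto intro: continuous_intros)
next
  case (Suc k)
  show ?case
    by (rule Ck_on_SucI[OF Suc.prems(1) has_derivative_add[OF Suc.prems(2,3)[THEN Ck_on_Suc_derivative]]])
       (use Suc in auto)
qed

lemma Ck_on_linear:
  "open S \<Longrightarrow> bounded_linear L \<Longrightarrow> Ck_on k f S \<Longrightarrow> Ck_on k (\<lambda>x. L (f x)) S"
proof (induction k arbitrary: f)
  case 0
  then show ?case by (auto intro: continuous_intros bounded_linear.continuous_on)
next
  case (Suc k)
  show ?case
    by (rule Ck_on_SucI[OF Suc.prems(1) bounded_linear.has_derivative[OF Suc.prems(2) Ck_on_Suc_derivative[OF Suc.prems(3)]]])
       (use Suc in auto)
qed

lemma Ck_on_mult: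
  fixes f g :: "'e::real_normed_vector \<Rightarrow> 'f::real_normed_algebra"
  shows "open S \<Longrightarrow> Ck_on k f S \<Longrightarrow> Ck_on k g S \<Longrightarrow> Ck_on k (\<lambda>x. f x * g x) S"
proof (induction k arbitrary: f g)
  case 0
  then show ?case by (auto intro: continuous_intros)
next
  case (Suc k)
  have d: "\<And>e. Ck_on k (\<lambda>x. frechet_derivative f (at x) e) S" "\<And>e. Ck_on k (\<lambda>x. frechet_derivative g (at x) e) S"
    using Suc.prems by simp_all
  show ?case
    by (rule Ck_on_SucI[OF Suc.prems(1) has_derivative_mult[OF Suc.prems(2,3)[THEN Ck_on_Suc_derivative]]], assumption, assumption)
       (intro Ck_on_add Suc.IH Suc.prems(1) d Suc.prems(2,3)[THEN Ck_on_Suc_D])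
qed

lemma Ck_on_exp:
  fixes f :: "'e::real_normed_vector \<Rightarrow> 'f::{real_normed_field,banach}"
  shows "open S \<Longrightarrow> Ck_on k f S \<Longrightarrow> Ck_on k (\<lambda>x. exp (f x)) S"
proof (induction k arbitrary: f)
  case 0
  then show ?case by (auto intro: continuous_intros)
next
  case (Suc k)
  have d: "\<And>e. Ck_on k (\<lambda>x. frechet_derivative f (at x) e) S"
    using Suc.prems by simp_all
  have D: "((\<lambda>x. exp (f x)) has_derivative (\<lambda>e. exp (f x) * frechet_derivative f (at x) e)) (at x)" if "x \<in> S" for x
    using has_derivative_compose[OF Ck_on_Suc_derivative[OF Suc.prems(2) that], of exp "(*) (exp (f x))"]
      DERIV_exp[of "f x"] by (simp add: has_field_derivative_def)
  show ?case
    by (rule Ck_on_SucI[OF Suc.prems(1) D], assumption) (intro Ck_on_mult Suc.IH Suc.prems(1) d Suc.prems(2)[THEN Ck_on_Suc_D])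
qed

lemma Ck_on_inverse:
  fixes f :: "'e::real_normed_vector \<Rightarrow> 'f::real_normed_field"
  shows "open S \<Longrightarrow> Ck_on k f S \<Longrightarrow> (\<And>x. x \<in> S \<Longrightarrow> f x \<noteq> 0) \<Longrightarrow> Ck_on k (\<lambda>x. inverse (f x)) S"
proof (induction k arbitrary: f)
  case 0
  then show ?case by (auto intro: continuous_intros)
next
  case (Suc k)
  have d: "\<And>e. Ck_on k (\<lambda>x. frechet_derivative f (at x) e) S"
    using Suc.prems by simp_all
  have D: "((\<lambda>x. inverse (f x)) has_derivative
      (\<lambda>e. (- 1) * (inverse (f x) * frechet_derivative f (at x) e * inverse (f x)))) (at x)" if "x \<in> S" for x
    using Deriv.has_derivative_inverse[OF Suc.prems(3)[OF that] Ck_on_Suc_derivative[OF Suc.prems(2) that]] by simp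
  show ?case
    by (rule Ck_on_SucI[OF Suc.prems(1) D], assumption)
      (intro Ck_on_mult Ck_on_const Suc.IH Suc.prems(1,3) d Suc.prems(2)[THEN Ck_on_Suc_D]; assumption)
qed

lemma Ck_on_compose_fst:
  assumes "open S" "open T"
  shows "Ck_on k f S \<Longrightarrow> Ck_on k (\<lambda>x. f (fst x)) (S \<times> T)"
proof (induction k arbitrary: f)
  case 0
  then show ?case by (auto intro!: continuous_on_compose2[of S f] continuous_intros)
next
  case (Suc k)
  have D: "((\<lambda>x. f (fst x)) has_derivative (\<lambda>e. frechet_derivative f (at (fst x)) (fst e))) (at x)"
    if "x \<in> S \<times> T" for x
  proof (rule has_derivative_compose[OF _ Ck_on_Suc_derivative[OF Suc.prems]])
    show "(fst has_derivative fst) (at x)" by (auto intro: derivative_eq_intros)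
    show "fst x \<in> S" using that by auto
  qed
  show ?case
    by (rule Ck_on_SucI[OF open_Times[OF assms] D]) (use Suc in auto)
qed

lemma smooth_on_cong:
  "open S \<Longrightarrow> (\<And>x. x \<in> S \<Longrightarrow> f x = g x) \<Longrightarrow> smooth_on S f \<longleftrightarrow> smooth_on S g"
  unfolding smooth_on_def using Ck_on_cong by blast

lemma smooth_on_differentiable: "smooth_on S f \<Longrightarrow> x \<in> S \<Longrightarrow> f differentiable (at x)"
  unfolding smooth_on_def by (metis Ck_on.simps(2))

lemma smooth_on_derivative: "smooth_on S f \<Longrightarrow> smooth_on S (\<lambda>x. frechet_derivative f (at x) e)"
  unfolding smooth_on_def by (metis Ck_on.simps(2))

lemma smooth_on_continuous: "smooth_on S f \<Longrightarrow> continuous_on S f"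
  unfolding smooth_on_def by (metis Ck_on.simps(1))

lemma smooth_on_const: "open S \<Longrightarrow> smooth_on S (\<lambda>x. a)"
  and smooth_on_add: "open S \<Longrightarrow> smooth_on S f \<Longrightarrow> smooth_on S g \<Longrightarrow> smooth_on S (\<lambda>x. f x + g x)"
  and smooth_on_linear: "open S \<Longrightarrow> bounded_linear L \<Longrightarrow> smooth_on S f \<Longrightarrow> smooth_on S (\<lambda>x. L (f x))"
  by (simp_all add: smooth_on_def Ck_on_const Ck_on_add Ck_on_linear)

lemma smooth_on_mult:
  fixes f g :: "'e::real_normed_vector \<Rightarrow> 'f::real_normed_algebra"
  shows "open S \<Longrightarrow> smooth_on S f \<Longrightarrow> smooth_on S g \<Longrightarrow> smooth_on S (\<lambda>x. f x * g x)"
  by (simp add: smooth_on_def Ck_on_mult)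

lemma smooth_on_inverse:
  fixes f :: "'e::real_normed_vector \<Rightarrow> 'f::real_normed_field"
  shows "open S \<Longrightarrow> smooth_on S f \<Longrightarrow> (\<And>x. x \<in> S \<Longrightarrow> f x \<noteq> 0) \<Longrightarrow> smooth_on S (\<lambda>x. inverse (f x))"
  by (simp add: smooth_on_def Ck_on_inverse)

lemma smooth_on_exp:
  fixes f :: "'e::real_normed_vector \<Rightarrow> 'f::{real_normed_field,banach}"
  shows "open S \<Longrightarrow> smooth_on S f \<Longrightarrow> smooth_on S (\<lambda>x. exp (f x))"
  by (simp add: smooth_on_def Ck_on_exp)

lemma smooth_on_compose_fst:
  "open S \<Longrightarrow> open T \<Longrightarrow> smooth_on S f \<Longrightarrow> smooth_on (S \<times> T) (\<lambda>x. f (fst x))"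
  by (simp add: smooth_on_def Ck_on_compose_fst)

lemma smooth_on_diff:
  "open S \<Longrightarrow> smooth_on S f \<Longrightarrow> smooth_on S g \<Longrightarrow> smooth_on S (\<lambda>x. f x - g x)"
  using smooth_on_add[OF _ _ smooth_on_linear[OF _ bounded_linear_minus[OF bounded_linear_ident]], of S f g] by simp

lemma smooth_on_divide:
  fixes f g :: "'e::real_normed_vector \<Rightarrow> 'f::real_normed_field"
  shows "open S \<Longrightarrow> smooth_on S f \<Longrightarrow> smooth_on S g \<Longrightarrow> (\<And>x. x \<in> S \<Longrightarrow> g x \<noteq> 0) \<Longrightarrow> smooth_on S (\<lambda>x. f x / g x)"
  by (simp add: divide_inverse smooth_on_mult smooth_on_inverse)

lemma smooth_on_sum:
  "open S \<Longrightarrow> (\<And>i. i \<in> I \<Longrightarrow> smooth_on S (f i)) \<Longrightarrow> smooth_on S (\<lambda>x. \<Sum>i\<in>I. f i x)"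
  by (induction I rule: infinite_finite_induct) (auto intro!: smooth_on_const smooth_on_add)

lemma smooth_on_prod:
  fixes f :: "'i \<Rightarrow> 'e::real_normed_vector \<Rightarrow> 'f::real_normed_field"
  shows "open S \<Longrightarrow> (\<And>i. i \<in> I \<Longrightarrow> smooth_on S (f i)) \<Longrightarrow> smooth_on S (\<lambda>x. \<Prod>i\<in>I. f i x)"
  by (induction I rule: infinite_finite_induct) (auto intro!: smooth_on_const smooth_on_mult)

lemma matrix_inv_inverse:
  assumes "invertible A"
  shows "A ** matrix_inv A = mat 1" "matrix_inv A ** A = mat 1"
  using assms someI_ex[of "\<lambda>B. A ** B = mat 1 \<and> B ** A = mat 1"]
  unfolding invertible_def matrix_inv_def by simp_all

text \<open>By Cramer's rule the entries of the inverse are quotients of determinants, that is, of polynomials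
  in the entries.\<close>

lemma smooth_on_matrix_inv:
  fixes M :: "'e::real_normed_vector \<Rightarrow> complex^'n^'n"
  assumes S: "open S" and M: "\<And>i j. smooth_on S (\<lambda>x. M x $ i $ j)"
    and inv: "\<And>x. x \<in> S \<Longrightarrow> invertible (M x)"
  shows "smooth_on S (\<lambda>x. matrix_inv (M x) $ k $ l)"
proof -
  let ?R = "\<lambda>x. \<chi> i j. if j = k then axis l 1 $ i else M x $ i $ j"
  have eq: "matrix_inv (M x) $ k $ l = det (?R x) / det (M x)" if "x \<in> S" for x
  proof -
    have "M x ** matrix_inv (M x) = mat 1"
      using inv[OF that] by (simp add: matrix_inv_inverse)
    then have "M x *v (matrix_inv (M x) *v axis l 1) = axis l 1"
      by (simp add: matrix_vector_mul_assoc)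
    then have "(matrix_inv (M x) *v axis l 1) $ k = det (?R x) / det (M x)"
      using inv[OF that] by (subst (asm) cramer) (auto simp: invertible_det_nz)
    moreover have "(B *v axis l 1) $ k = B $ k $ l" for B :: "complex^'n^'n"
      by (simp add: matrix_vector_mult_def axis_def if_distrib[of "\<lambda>t. _ * t"] cong: if_cong)
    ultimately show ?thesis by simp
  qed
  have det: "smooth_on S (\<lambda>x. det (N x))" if "\<And>i j. smooth_on S (\<lambda>x. N x $ i $ j)" for N :: "'e \<Rightarrow> complex^'n^'n"
    unfolding det_def using that by (intro smooth_on_sum smooth_on_mult smooth_on_const smooth_on_prod S)
  have "smooth_on S (\<lambda>x. ?R x $ i $ j)" for i j
    using M smooth_on_const[OF S] by (cases "j = k") auto
  then have "smooth_on S (\<lambda>x. det (?R x) / det (M x))"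
    using M inv by (intro smooth_on_divide det S) (auto simp: invertible_det_nz)
  then show ?thesis by (subst smooth_on_cong[OF S eq])
qed

section \<open>Wirtinger calculus\<close>

lemma frechet_derivative_eqI: "(f has_derivative D) (at x) \<Longrightarrow> frechet_derivative f (at x) = D"
  by (rule frechet_derivative_at[symmetric])

lemma frechet_derivative_has: "f differentiable (at x) \<Longrightarrow> (f has_derivative frechet_derivative f (at x)) (at x)"
  by (simp add: frechet_derivative_works[symmetric])

lemma frechet_derivative_cong_open:
  assumes "open S" "x \<in> S" "\<And>y. y \<in> S \<Longrightarrow> f y = g y"
  shows "frechet_derivative f (at x) = frechet_derivative g (at x)"
proof -
  have "(f has_derivative D) (at x) \<longleftrightarrow> (g has_derivative D) (at x)" for D
    using has_derivative_transform_within_open[OF _ assms(1,2)] assms(3) by metis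
  then show ?thesis by (simp add: frechet_derivative_def)
qed

lemma wirtinger_cong:
  assumes "open S" "x \<in> S" "\<And>y. y \<in> S \<Longrightarrow> f y = g y"
  shows "wirtinger e e' f x = wirtinger e e' g x" "wirtinger_bar e e' f x = wirtinger_bar e e' g x"
  unfolding wirtinger_def wirtinger_bar_def
  using frechet_derivative_cong_open[OF assms, of "\<lambda>x. x"] by simp_all

lemma wirtinger_const: "wirtinger e e' (\<lambda>x. c) x = 0" "wirtinger_bar e e' (\<lambda>x. c) x = 0"
  by (simp_all add: wirtinger_def wirtinger_bar_def)

lemma wirtinger_add:
  assumes "f differentiable (at x)" "g differentiable (at x)"
  shows "wirtinger e e' (\<lambda>x. f x + g x) x = wirtinger e e' f x + wirtinger e e' g x"
    "wirtinger_bar e e' (\<lambda>x. f x + g x) x = wirtinger_bar e e' f x + wirtinger_bar e e' g x"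
  unfolding wirtinger_def wirtinger_bar_def
    frechet_derivative_eqI[OF has_derivative_add[OF assms[THEN frechet_derivative_has]]]
  by (simp_all add: field_simps)

lemma wirtinger_mult:
  assumes "f differentiable (at x)" "g differentiable (at x)"
  shows "wirtinger e e' (\<lambda>x. f x * g x) x = wirtinger e e' f x * g x + f x * wirtinger e e' g x"
    "wirtinger_bar e e' (\<lambda>x. f x * g x) x = wirtinger_bar e e' f x * g x + f x * wirtinger_bar e e' g x"
  unfolding wirtinger_def wirtinger_bar_def
    frechet_derivative_eqI[OF has_derivative_mult[OF assms[THEN frechet_derivative_has]]]
  by (simp_all add: field_simps)

lemma wirtinger_cmult:
  assumes "f differentiable (at x)"
  shows "wirtinger e e' (\<lambda>x. c * f x) x = c * wirtinger e e' f x"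
    "wirtinger_bar e e' (\<lambda>x. c * f x) x = c * wirtinger_bar e e' f x"
  using wirtinger_mult[OF differentiable_const assms, of e e' c] by (simp_all add: wirtinger_const)

lemma wirtinger_cnj:
  assumes "f differentiable (at x)"
  shows "wirtinger e e' (\<lambda>x. cnj (f x)) x = cnj (wirtinger_bar e e' f x)"
    "wirtinger_bar e e' (\<lambda>x. cnj (f x)) x = cnj (wirtinger e e' f x)"
  unfolding wirtinger_def wirtinger_bar_def
    frechet_derivative_eqI[OF bounded_linear.has_derivative[OF bounded_linear_cnj assms[THEN frechet_derivative_has]]]
  by simp_all

lemma wirtinger_chain:
  assumes "f differentiable (at x)" "DERIV h (f x) :> h'"
  shows "wirtinger e e' (\<lambda>x. h (f x)) x = h' * wirtinger e e' f x"
    "wirtinger_bar e e' (\<lambda>x. h (f x)) x = h' * wirtinger_bar e e' f x"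
proof -
  have D: "frechet_derivative (\<lambda>x. h (f x)) (at x) = (\<lambda>e. h' * frechet_derivative f (at x) e)"
    using has_derivative_compose[OF frechet_derivative_has[OF assms(1)], of h "(*) h'"] assms(2)
    by (intro frechet_derivative_eqI) (simp add: has_field_derivative_def)
  show "wirtinger e e' (\<lambda>x. h (f x)) x = h' * wirtinger e e' f x"
    "wirtinger_bar e e' (\<lambda>x. h (f x)) x = h' * wirtinger_bar e e' f x"
    unfolding wirtinger_def wirtinger_bar_def D by (simp_all add: algebra_simps)
qed

lemma wirtinger_of_real:
  fixes f :: "'e::real_normed_vector \<Rightarrow> real"
  assumes "f differentiable (at x)"
  shows "wirtinger e e' (\<lambda>x. complex_of_real (f x)) x = cnj (wirtinger_bar e e' (\<lambda>x. complex_of_real (f x)) x)"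
proof -
  have "(\<lambda>x. complex_of_real (f x)) differentiable (at x)"
    using frechet_derivative_has[OF assms] has_derivative_of_real unfolding differentiable_def by blast
  from wirtinger_cnj(1)[OF this, of e e'] show ?thesis by simp
qed

lemma wirtinger_smooth:
  assumes "open S" "smooth_on S f"
  shows "smooth_on S (wirtinger e e' f)" "smooth_on S (wirtinger_bar e e' f)"
proof -
  have a: "smooth_on S (\<lambda>x. frechet_derivative f (at x) e)" for e
    by (rule smooth_on_derivative[OF assms(2)])
  have b: "wirtinger e e' f = (\<lambda>x. (1/2) * (frechet_derivative f (at x) e - \<i> * frechet_derivative f (at x) e'))"
    "wirtinger_bar e e' f = (\<lambda>x. (1/2) * (frechet_derivative f (at x) e + \<i> * frechet_derivative f (at x) e'))"
    by (auto simp: wirtinger_def wirtinger_bar_def)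
  show "smooth_on S (wirtinger e e' f)" "smooth_on S (wirtinger_bar e e' f)"
    unfolding b by (intro smooth_on_mult smooth_on_const smooth_on_diff smooth_on_add assms a)+
qed

text \<open>A real linear form on \<open>complex^'n\<close> is the sum of a complex linear and a conjugate linear one; the
  Wirtinger derivatives of a function are the coefficients of this splitting of its differential.\<close>

lemma real_linear_expansion:
  fixes L :: "complex^'n \<Rightarrow> complex"
  assumes "linear L"
  shows "L a = (\<Sum>\<alpha>\<in>UNIV. a $ \<alpha> * ((L (axis \<alpha> 1) - \<i> * L (axis \<alpha> \<i>)) / 2)
                        + cnj (a $ \<alpha>) * ((L (axis \<alpha> 1) + \<i> * L (axis \<alpha> \<i>)) / 2))"
proof -
  have "a = (\<Sum>\<alpha>\<in>UNIV. Re (a $ \<alpha>) *\<^sub>R axis \<alpha> 1 + Im (a $ \<alpha>) *\<^sub>R axis \<alpha> \<i>)"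
  proof (subst vec_eq_iff, intro allI)
    fix i
    have "(\<Sum>\<alpha>\<in>UNIV. Re (a $ \<alpha>) *\<^sub>R axis \<alpha> 1 + Im (a $ \<alpha>) *\<^sub>R axis \<alpha> \<i>) $ i =
       (\<Sum>\<alpha>\<in>UNIV. if \<alpha> = i then a $ i else 0)"
      unfolding sum_component
      by (intro sum.cong refl) (auto simp: axis_def complex_eq_iff)
    then show "a $ i = (\<Sum>\<alpha>\<in>UNIV. Re (a $ \<alpha>) *\<^sub>R axis \<alpha> 1 + Im (a $ \<alpha>) *\<^sub>R axis \<alpha> \<i>) $ i"
      by simp
  qed
  then have "L a = L (\<Sum>\<alpha>\<in>UNIV. Re (a $ \<alpha>) *\<^sub>R axis \<alpha> 1 + Im (a $ \<alpha>) *\<^sub>R axis \<alpha> \<i>)" by simp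
  also have "\<dots> = (\<Sum>\<alpha>\<in>UNIV. Re (a $ \<alpha>) *\<^sub>R L (axis \<alpha> 1) + Im (a $ \<alpha>) *\<^sub>R L (axis \<alpha> \<i>))"
    using assms by (simp add: linear_sum linear_add linear_scale)
  also have "\<dots> = (\<Sum>\<alpha>\<in>UNIV. a $ \<alpha> * ((L (axis \<alpha> 1) - \<i> * L (axis \<alpha> \<i>)) / 2)
                        + cnj (a $ \<alpha>) * ((L (axis \<alpha> 1) + \<i> * L (axis \<alpha> \<i>)) / 2))"
    by (intro sum.cong refl) (simp add: complex_eq_iff field_simps)
  finally show ?thesis .
qed

lemma wirtinger_expansion:
  fixes f :: "complex^'n \<Rightarrow> complex"
  assumes "f differentiable (at x)"
  shows "frechet_derivative f (at x) a = (\<Sum>\<alpha>\<in>UNIV. a $ \<alpha> * wirtinger (axis \<alpha> 1) (axis \<alpha> \<i>) f x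
           + cnj (a $ \<alpha>) * wirtinger_bar (axis \<alpha> 1) (axis \<alpha> \<i>) f x)"
  unfolding wirtinger_def wirtinger_bar_def
  by (rule real_linear_expansion) (rule linear_frechet_derivative[OF assms])

lemma derivative_expansion:
  fixes f :: "(complex^'n) \<times> (complex^'n) \<Rightarrow> complex"
  assumes "f differentiable (at x)"
  shows "frechet_derivative f (at x) (a, b) =
     (\<Sum>\<alpha>\<in>UNIV. a $ \<alpha> * d_z \<alpha> f x + cnj (a $ \<alpha>) * d_zbar \<alpha> f x) +
     (\<Sum>\<alpha>\<in>UNIV. b $ \<alpha> * d_v \<alpha> f x + cnj (b $ \<alpha>) * d_vbar \<alpha> f x)"
proof -
  let ?D = "frechet_derivative f (at x)"
  have lin: "linear ?D" by (rule linear_frechet_derivative[OF assms])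
  have l1: "linear (\<lambda>a. ?D (a, 0))" and l2: "linear (\<lambda>b. ?D (0, b))"
    by (intro linear_compose[OF _ lin, unfolded o_def]; auto intro!: linearI)+
  have "?D (a, b) = ?D (a, 0) + ?D (0, b)"
    using linear_add[OF lin, of "(a,0)" "(0,b)"] by simp
  then show ?thesis
    unfolding d_z_def d_zbar_def d_v_def d_vbar_def wirtinger_def wirtinger_bar_def
    by (simp only: real_linear_expansion[OF l1, of a] real_linear_expansion[OF l2, of b])
qed

lemma derivative_vertical:
  fixes f :: "(complex^'n) \<times> (complex^'n) \<Rightarrow> complex"
  assumes "f differentiable (at x)"
  shows "frechet_derivative f (at x) (0, b) = (\<Sum>\<alpha>\<in>UNIV. b $ \<alpha> * d_v \<alpha> f x) + (\<Sum>\<alpha>\<in>UNIV. cnj (b $ \<alpha>) * d_vbar \<alpha> f x)"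
  by (simp add: derivative_expansion[OF assms] sum.distrib)

text \<open>Differentiating the homogeneity relation at \<open>\<zeta> = 1\<close> in the real and in the imaginary direction
  gives the sum and the difference of the two Euler identities.\<close>

lemma euler_relation:
  fixes f :: "(complex^'n) \<times> (complex^'n) \<Rightarrow> complex"
  assumes "f differentiable (at (z, v))"
    and hom: "\<And>\<zeta>. \<zeta> \<noteq> 0 \<Longrightarrow> f (z, \<zeta> *s v) = \<zeta> ^ p * cnj \<zeta> ^ q * f (z, v)"
  shows "(\<Sum>\<alpha>\<in>UNIV. v $ \<alpha> * d_v \<alpha> f (z, v)) = of_nat p * f (z, v)"
    and "(\<Sum>\<alpha>\<in>UNIV. cnj (v $ \<alpha>) * d_vbar \<alpha> f (z, v)) = of_nat q * f (z, v)"
proof -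
  let ?D = "frechet_derivative f (at (z, v))"
  have s: "((\<lambda>\<zeta>. (z, \<zeta> *s v)) has_derivative (\<lambda>h. (0, h *s v))) (at (1::complex))"
  proof (intro has_derivative_Pair has_derivative_const bounded_linear_imp_has_derivative)
    have "linear (\<lambda>h::complex. h *s v)"
      by (auto intro!: linearI simp: vec_eq_iff algebra_simps)
    then show "bounded_linear (\<lambda>h::complex. h *s v)" by (simp add: linear_conv_bounded_linear)
  qed
  have fD: "(f has_derivative ?D) (at (z, (1::complex) *s v))"
    using frechet_derivative_has[OF assms(1)] by simp
  have 1: "((\<lambda>\<zeta>. f (z, \<zeta> *s v)) has_derivative (\<lambda>h. ?D (0, h *s v))) (at (1::complex))"
    by (rule has_derivative_compose[OF s, of f, OF fD])
  have "((\<lambda>\<zeta>. \<zeta> ^ p * cnj \<zeta> ^ q * f (z, v)) has_derivative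
      (\<lambda>h. (of_nat p * h + of_nat q * cnj h) * f (z, v))) (at (1::complex))"
    by (auto intro!: derivative_eq_intros bounded_linear_imp_has_derivative bounded_linear_cnj simp: algebra_simps)
  then have 2: "((\<lambda>\<zeta>. f (z, \<zeta> *s v)) has_derivative
      (\<lambda>h. (of_nat p * h + of_nat q * cnj h) * f (z, v))) (at (1::complex))"
    by (rule has_derivative_transform_within_open[of _ _ _ _ "- {0}"]) (auto simp: hom)
  have D: "?D (0, h *s v) = (of_nat p * h + of_nat q * cnj h) * f (z, v)" for h
    using has_derivative_unique[OF 1 2] by metis
  define S1 where "S1 = (\<Sum>\<alpha>\<in>UNIV. v $ \<alpha> * d_v \<alpha> f (z, v))"
  define S2 where "S2 = (\<Sum>\<alpha>\<in>UNIV. cnj (v $ \<alpha>) * d_vbar \<alpha> f (z, v))"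
  have E: "?D (0, h *s v) = h * S1 + cnj h * S2" for h
    by (simp add: derivative_vertical[OF assms(1)] S1_def S2_def sum_distrib_left mult.assoc)
  have "S1 + S2 = (of_nat p + of_nat q) * f (z, v)"
    using D[of 1] E[of 1] by simp
  moreover have "S1 - S2 = (of_nat p - of_nat q) * f (z, v)"
  proof -
    have "\<i> * (S1 - S2) = \<i> * ((of_nat p - of_nat q) * f (z, v))"
      using D[of \<i>] E[of \<i>] by (simp add: algebra_simps)
    then show ?thesis by (metis complex_i_not_zero mult_left_cancel)
  qed
  moreover have "S1 = ((S1 + S2) + (S1 - S2)) / 2" "S2 = ((S1 + S2) - (S1 - S2)) / 2" by simp_all
  ultimately have "S1 = ((of_nat p + of_nat q) * f (z, v) + (of_nat p - of_nat q) * f (z, v)) / 2"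
    "S2 = ((of_nat p + of_nat q) * f (z, v) - (of_nat p - of_nat q) * f (z, v)) / 2" by simp_all
  then show "S1 = of_nat p * f (z, v)" "S2 = of_nat q * f (z, v)"
    by (simp_all only: distrib_right left_diff_distrib) simp_all
qed

definition fibre_scale :: "complex \<Rightarrow> (complex^'n) \<times> (complex^'n) \<Rightarrow> (complex^'n) \<times> (complex^'n)" where
  "fibre_scale \<zeta> x = (fst x, \<zeta> *s snd x)"

text \<open>For a fixed factor \<open>m\<close>, a relation \<open>f (z, \<zeta> v) = m f (z, v)\<close> passes to the derivatives by the chain
  rule, each \<open>v\<close>-derivative losing one factor \<open>\<zeta>\<close> or its conjugate. Iterating this yields the
  homogeneity of all coefficients built from \<open>G\<close>.\<close>

lemma derivatives_of_homogeneous: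
  fixes f :: "(complex^'n) \<times> (complex^'n) \<Rightarrow> complex"
  assumes S: "open S" "x \<in> S" "\<And>y. y \<in> S \<Longrightarrow> fibre_scale \<zeta> y \<in> S"
    and f: "\<And>y. y \<in> S \<Longrightarrow> f differentiable (at y)"
    and hom: "\<And>y. y \<in> S \<Longrightarrow> f (fibre_scale \<zeta> y) = m * f y"
  shows "d_z \<mu> f (fibre_scale \<zeta> x) = m * d_z \<mu> f x"
    and "d_zbar \<mu> f (fibre_scale \<zeta> x) = m * d_zbar \<mu> f x"
    and "\<zeta> * d_v \<mu> f (fibre_scale \<zeta> x) = m * d_v \<mu> f x"
    and "cnj \<zeta> * d_vbar \<mu> f (fibre_scale \<zeta> x) = m * d_vbar \<mu> f x"
proof -
  let ?D = "frechet_derivative f (at x)" and ?E = "frechet_derivative f (at (fibre_scale \<zeta> x))"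
  have "linear (\<lambda>h::complex^'n. \<zeta> *s h)"
    by (auto intro!: linearI simp: vec_eq_iff algebra_simps)
  then have bl: "bounded_linear (\<lambda>h::complex^'n. \<zeta> *s h)" by (simp add: linear_conv_bounded_linear)
  have s: "(fibre_scale \<zeta> has_derivative fibre_scale \<zeta>) (at x)"
    unfolding fibre_scale_def
    by (intro has_derivative_Pair bounded_linear_imp_has_derivative bounded_linear_fst
        bounded_linear_compose[OF bl bounded_linear_snd])
  have 1: "((\<lambda>y. f (fibre_scale \<zeta> y)) has_derivative (\<lambda>h. ?E (fibre_scale \<zeta> h))) (at x)"
    by (rule has_derivative_compose[OF s frechet_derivative_has[OF f[OF S(3)[OF S(2)]]]])
  have "((\<lambda>y. m * f y) has_derivative (\<lambda>h. m * ?D h)) (at x)"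
    using frechet_derivative_has[OF f[OF S(2)]] by (rule has_derivative_mult_right)
  then have 2: "((\<lambda>y. f (fibre_scale \<zeta> y)) has_derivative (\<lambda>h. m * ?D h)) (at x)"
    by (rule has_derivative_transform_within_open[OF _ S(1,2)]) (simp add: hom)
  have D: "?E (a, \<zeta> *s b) = m * ?D (a, b)" for a b
    using fun_cong[OF has_derivative_unique[OF 1 2], of "(a, b)"] by (simp add: fibre_scale_def)
  show "d_z \<mu> f (fibre_scale \<zeta> x) = m * d_z \<mu> f x" "d_zbar \<mu> f (fibre_scale \<zeta> x) = m * d_zbar \<mu> f x"
    using D[of "axis \<mu> 1" 0] D[of "axis \<mu> \<i>" 0]
    by (simp_all add: d_z_def d_zbar_def wirtinger_def wirtinger_bar_def algebra_simps)
  have ax: "(\<Sum>\<alpha>\<in>UNIV. axis \<mu> (c::complex) $ \<alpha> * g \<alpha>) = c * g \<mu>" for g c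
    by (simp add: axis_def if_distrib[of "\<lambda>t. t * _"] cong: if_cong)
  have ax': "(\<Sum>\<alpha>\<in>UNIV. cnj (axis \<mu> (c::complex) $ \<alpha>) * g \<alpha>) = cnj c * g \<mu>" for g c
    by (simp add: axis_def if_distrib[of "\<lambda>t. cnj t * _"] cong: if_cong)
  have sax: "\<zeta> *s axis \<mu> c = axis \<mu> (\<zeta> * c)" for c by (simp add: vec_eq_iff axis_def)
  define p q where "p = d_v \<mu> f (fibre_scale \<zeta> x)" and "q = d_vbar \<mu> f (fibre_scale \<zeta> x)"
  have "\<zeta> * c * p + cnj (\<zeta> * c) * q = m * (c * d_v \<mu> f x + cnj c * d_vbar \<mu> f x)" for c
    using D[of 0 "axis \<mu> c"]
    unfolding sax derivative_vertical[OF f[OF S(2)]] derivative_vertical[OF f[OF S(3)[OF S(2)]]] ax ax'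
    by (simp only: p_def q_def)
  from this[of 1] this[of \<i>]
  have a: "\<zeta> * p + cnj \<zeta> * q = m * d_v \<mu> f x + m * d_vbar \<mu> f x"
    and b: "\<i> * (\<zeta> * p - cnj \<zeta> * q) = \<i> * (m * d_v \<mu> f x - m * d_vbar \<mu> f x)"
    by (simp_all add: algebra_simps)
  from b have "\<zeta> * p - cnj \<zeta> * q = m * d_v \<mu> f x - m * d_vbar \<mu> f x"
    by (metis complex_i_not_zero mult_left_cancel)
  with a have "2 * (\<zeta> * p) = 2 * (m * d_v \<mu> f x)" "2 * (cnj \<zeta> * q) = 2 * (m * d_vbar \<mu> f x)"
    by algebra+
  then show "\<zeta> * p = m * d_v \<mu> f x" "cnj \<zeta> * q = m * d_vbar \<mu> f x" by simp_all
qed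

text \<open>The calculus rules for the four coordinate derivatives on the tangent bundle.\<close>

lemmas d_cong =
  wirtinger_cong(1)[where e = "(axis \<mu> 1, 0 :: complex^'n)" and e' = "(axis \<mu> \<i>, 0 :: complex^'n)", folded d_z_def]
  wirtinger_cong(2)[where e = "(axis \<mu> 1, 0 :: complex^'n)" and e' = "(axis \<mu> \<i>, 0 :: complex^'n)", folded d_zbar_def]
  wirtinger_cong(1)[where e = "(0 :: complex^'n, axis \<mu> 1)" and e' = "(0 :: complex^'n, axis \<mu> \<i>)", folded d_v_def]
  wirtinger_cong(2)[where e = "(0 :: complex^'n, axis \<mu> 1)" and e' = "(0 :: complex^'n, axis \<mu> \<i>)", folded d_vbar_def]
  for \<mu> :: "'n::finite"

lemmas d_add =
  wirtinger_add(1)[where e = "(axis \<mu> 1, 0 :: complex^'n)" and e' = "(axis \<mu> \<i>, 0 :: complex^'n)", folded d_z_def]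
  wirtinger_add(2)[where e = "(axis \<mu> 1, 0 :: complex^'n)" and e' = "(axis \<mu> \<i>, 0 :: complex^'n)", folded d_zbar_def]
  wirtinger_add(1)[where e = "(0 :: complex^'n, axis \<mu> 1)" and e' = "(0 :: complex^'n, axis \<mu> \<i>)", folded d_v_def]
  wirtinger_add(2)[where e = "(0 :: complex^'n, axis \<mu> 1)" and e' = "(0 :: complex^'n, axis \<mu> \<i>)", folded d_vbar_def]
  for \<mu> :: "'n::finite"

lemmas d_mult =
  wirtinger_mult(1)[where e = "(axis \<mu> 1, 0 :: complex^'n)" and e' = "(axis \<mu> \<i>, 0 :: complex^'n)", folded d_z_def]
  wirtinger_mult(2)[where e = "(axis \<mu> 1, 0 :: complex^'n)" and e' = "(axis \<mu> \<i>, 0 :: complex^'n)", folded d_zbar_def]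
  wirtinger_mult(1)[where e = "(0 :: complex^'n, axis \<mu> 1)" and e' = "(0 :: complex^'n, axis \<mu> \<i>)", folded d_v_def]
  wirtinger_mult(2)[where e = "(0 :: complex^'n, axis \<mu> 1)" and e' = "(0 :: complex^'n, axis \<mu> \<i>)", folded d_vbar_def]
  for \<mu> :: "'n::finite"

lemmas d_chain =
  wirtinger_chain(1)[where e = "(axis \<mu> 1, 0 :: complex^'n)" and e' = "(axis \<mu> \<i>, 0 :: complex^'n)", folded d_z_def]
  wirtinger_chain(2)[where e = "(axis \<mu> 1, 0 :: complex^'n)" and e' = "(axis \<mu> \<i>, 0 :: complex^'n)", folded d_zbar_def]
  wirtinger_chain(1)[where e = "(0 :: complex^'n, axis \<mu> 1)" and e' = "(0 :: complex^'n, axis \<mu> \<i>)", folded d_v_def]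
  wirtinger_chain(2)[where e = "(0 :: complex^'n, axis \<mu> 1)" and e' = "(0 :: complex^'n, axis \<mu> \<i>)", folded d_vbar_def]
  for \<mu> :: "'n::finite"

lemma d_smooth:
  assumes "open S" "smooth_on S f"
  shows "smooth_on S (d_z \<mu> f)" "smooth_on S (d_zbar \<mu> f)" "smooth_on S (d_v \<mu> f)" "smooth_on S (d_vbar \<mu> f)"
  unfolding d_z_def d_zbar_def d_v_def d_vbar_def by (intro wirtinger_smooth assms)+

lemma d_fst:
  assumes "f differentiable (at (fst x))"
  shows "d_z \<mu> (\<lambda>x. f (fst x)) x = wirtinger (axis \<mu> 1) (axis \<mu> \<i>) f (fst x)"
    "d_zbar \<mu> (\<lambda>x. f (fst x)) x = wirtinger_bar (axis \<mu> 1) (axis \<mu> \<i>) f (fst x)"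
    "d_v \<mu> (\<lambda>x. f (fst x)) x = 0"
    "d_vbar \<mu> (\<lambda>x. f (fst x)) x = 0"
proof -
  have "((\<lambda>x. f (fst x)) has_derivative (\<lambda>e. frechet_derivative f (at (fst x)) (fst e))) (at x)"
    by (rule has_derivative_compose[of fst fst x UNIV f, OF _ frechet_derivative_has[OF assms]])
      (auto intro: derivative_eq_intros)
  then have D: "frechet_derivative (\<lambda>x. f (fst x)) (at x) = (\<lambda>e. frechet_derivative f (at (fst x)) (fst e))"
    by (rule frechet_derivative_eqI)
  have z: "frechet_derivative f (at (fst x)) 0 = 0"
    using linear_frechet_derivative[OF assms] by (rule linear_0)
  show "d_z \<mu> (\<lambda>x. f (fst x)) x = wirtinger (axis \<mu> 1) (axis \<mu> \<i>) f (fst x)"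
    "d_zbar \<mu> (\<lambda>x. f (fst x)) x = wirtinger_bar (axis \<mu> 1) (axis \<mu> \<i>) f (fst x)"
    "d_v \<mu> (\<lambda>x. f (fst x)) x = 0"
    "d_vbar \<mu> (\<lambda>x. f (fst x)) x = 0"
    unfolding d_z_def d_zbar_def d_v_def d_vbar_def wirtinger_def wirtinger_bar_def D by (simp_all add: z)
qed

section \<open>Charts and tangent vectors\<close>

locale complex_manifold =
  fixes A :: "('a::topological_space, 'n::finite) chart set"
  assumes atlas: "complex_atlas A"
begin

lemma chart_cover: "\<exists>c\<in>A. p \<in> fst c"
  using atlas unfolding complex_atlas_def by auto

lemma chart_open: "c \<in> A \<Longrightarrow> open (fst c)" "c \<in> A \<Longrightarrow> open (chart_img c)"
  and chart_homeo: "c \<in> A \<Longrightarrow> homeomorphism (fst c) (chart_img c) (snd c) (chart_inv c)"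
  using atlas unfolding complex_atlas_def by auto

lemma chart_inv_left: "c \<in> A \<Longrightarrow> p \<in> fst c \<Longrightarrow> chart_inv c (snd c p) = p"
  and chart_inv_right: "c \<in> A \<Longrightarrow> z \<in> chart_img c \<Longrightarrow> snd c (chart_inv c z) = z"
  and chart_inv_in: "c \<in> A \<Longrightarrow> z \<in> chart_img c \<Longrightarrow> chart_inv c z \<in> fst c"
  and chart_continuous: "c \<in> A \<Longrightarrow> continuous_on (fst c) (snd c)"
  and chart_inv_continuous: "c \<in> A \<Longrightarrow> continuous_on (chart_img c) (chart_inv c)"
  using chart_homeo[of c] unfolding homeomorphism_def by blast+

lemma chart_in_img: "p \<in> fst c \<Longrightarrow> snd c p \<in> chart_img c"
  by (simp add: chart_img_def)

lemma TM0_coords_open: "c \<in> A \<Longrightarrow> open (TM0_coords c)"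
  unfolding TM0_coords_def using chart_open(2)[of c] by (auto intro!: open_Times)

lemma TM0_coords_subset: "TM0_coords c \<subseteq> TM_coords c"
  by (auto simp: TM_coords_def TM0_coords_def)

definition overlap :: "('a, 'n) chart \<Rightarrow> ('a, 'n) chart \<Rightarrow> (complex^'n) set" where
  "overlap c d = snd c ` (fst c \<inter> fst d)"

lemma overlap_iff: "c \<in> A \<Longrightarrow> z \<in> overlap c d \<longleftrightarrow> z \<in> chart_img c \<and> chart_inv c z \<in> fst d"
  unfolding overlap_def by (force simp: chart_img_def chart_inv_left intro: chart_inv_left)

lemma overlap_open:
  assumes "c \<in> A" "d \<in> A"
  shows "open (overlap c d)"
proof -
  have "overlap c d = chart_img c \<inter> chart_inv c -` fst d"
    using overlap_iff[OF assms(1), of _ d] by blast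
  also have "open \<dots>"
    using continuous_on_open_vimage[OF chart_open(2)[OF assms(1)]] chart_inv_continuous[OF assms(1)]
      chart_open(1)[OF assms(2)] by (metis inf_commute)
  finally show ?thesis .
qed

lemma transition_apply: "transition c d z = snd d (chart_inv c z)"
  by (simp add: transition_def)

lemma transition_holomorphic: "c \<in> A \<Longrightarrow> d \<in> A \<Longrightarrow> holomorphic_map_on (overlap c d) (transition c d)"
  using atlas unfolding complex_atlas_def overlap_def by auto

lemma
  assumes "c \<in> A" "d \<in> A" "z \<in> overlap c d"
  shows transition_has_derivative: "(transition c d has_derivative transition_deriv c d z) (at z)"
    and transition_deriv_scale: "transition_deriv c d z (\<zeta> *s v) = \<zeta> *s transition_deriv c d z v"
proof -
  obtain D where D: "(transition c d has_derivative D) (at z)" "\<And>\<zeta> v. D (\<zeta> *s v) = \<zeta> *s D v"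
    using transition_holomorphic[OF assms(1,2)] assms(3) unfolding holomorphic_map_on_def by metis
  then have "transition_deriv c d z = D"
    unfolding transition_deriv_def by (intro frechet_derivative_eqI)
  then show "(transition c d has_derivative transition_deriv c d z) (at z)"
    "transition_deriv c d z (\<zeta> *s v) = \<zeta> *s transition_deriv c d z v" using D by simp_all
qed

lemma transition_deriv_linear:
  "c \<in> A \<Longrightarrow> d \<in> A \<Longrightarrow> z \<in> overlap c d \<Longrightarrow> linear (transition_deriv c d z)"
  using transition_has_derivative has_derivative_linear by blast

lemma transition_in_overlap:
  "c \<in> A \<Longrightarrow> d \<in> A \<Longrightarrow> z \<in> overlap c d \<Longrightarrow> transition c d z \<in> overlap d c"
  "c \<in> A \<Longrightarrow> d \<in> A \<Longrightarrow> z \<in> overlap c d \<Longrightarrow> chart_inv d (transition c d z) = chart_inv c z"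
  "c \<in> A \<Longrightarrow> d \<in> A \<Longrightarrow> z \<in> overlap c d \<Longrightarrow> transition c d z \<in> chart_img d"
  by (auto simp: overlap_iff transition_apply chart_inv_left chart_inv_in chart_in_img)

lemma transition_deriv_self:
  assumes "c \<in> A" "z \<in> chart_img c"
  shows "transition_deriv c c z v = v"
proof -
  have "((\<lambda>z. z) has_derivative (\<lambda>z. z)) (at z)" by simp
  then have "(transition c c has_derivative (\<lambda>z. z)) (at z)"
    by (rule has_derivative_transform_within_open[OF _ chart_open(2)[OF assms(1)] assms(2)])
      (simp add: transition_apply chart_inv_right[OF assms(1)])
  then have "transition_deriv c c z = (\<lambda>z. z)"
    unfolding transition_deriv_def by (rule frechet_derivative_eqI)
  then show ?thesis by simp
qed

text \<open>The chain rule; it is what makes \<open>tvec_of\<close> produce tangent vectors.\<close>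

lemma transition_deriv_cocycle:
  assumes cde: "c \<in> A" "d \<in> A" "e \<in> A" and z: "z \<in> overlap c d" "z \<in> overlap c e"
  shows "transition_deriv d e (transition c d z) (transition_deriv c d z v) = transition_deriv c e z v"
proof -
  have *: "transition c d z \<in> overlap d e"
    using z cde transition_in_overlap[OF cde(1,2) z(1)] by (simp add: overlap_iff)
  have "((\<lambda>z. transition d e (transition c d z)) has_derivative
      (\<lambda>v. transition_deriv d e (transition c d z) (transition_deriv c d z v))) (at z)"
    by (rule has_derivative_compose[OF transition_has_derivative[OF cde(1,2) z(1)]
          transition_has_derivative[OF cde(2,3) *]])
  then have "(transition c e has_derivative
      (\<lambda>v. transition_deriv d e (transition c d z) (transition_deriv c d z v))) (at z)"
  proof (rule has_derivative_transform_within_open[OF _ overlap_open[OF cde(1,2)] z(1)])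
    fix w assume "w \<in> overlap c d"
    then show "transition d e (transition c d w) = transition c e w"
      using transition_in_overlap[OF cde(1,2)] by (simp add: transition_apply)
  qed
  then show ?thesis unfolding transition_deriv_def
    by (metis frechet_derivative_eqI)
qed

lemma transition_deriv_inverse:
  assumes "c \<in> A" "d \<in> A" "z \<in> overlap c d"
  shows "transition_deriv d c (transition c d z) (transition_deriv c d z v) = v"
  using transition_deriv_cocycle[OF assms(1,2,1,3)] assms transition_deriv_self
  by (simp add: overlap_iff chart_inv_in)

lemma transition_deriv_nonzero:
  assumes "c \<in> A" "d \<in> A" "z \<in> overlap c d" "v \<noteq> 0"
  shows "transition_deriv c d z v \<noteq> 0"
proof
  assume "transition_deriv c d z v = 0"
  moreover have "linear (transition_deriv d c (transition c d z))"
    using assms transition_in_overlap by (intro transition_deriv_linear) auto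
  ultimately show False
    using transition_deriv_inverse[OF assms(1-3), of v] assms(4) by (simp add: linear_0)
qed

lemma tvec_of_fst [simp]: "fst (tvec_of A c x) = chart_inv c (fst x)"
  by (simp add: tvec_of_def)

lemma tvec_of_comp:
  "c \<in> A \<Longrightarrow> d \<in> A \<Longrightarrow> fst x \<in> overlap c d \<Longrightarrow> snd (tvec_of A c x) d = transition_deriv c d (fst x) (snd x)"
  by (simp add: tvec_of_def overlap_iff)

lemma tvec_of_comp_self: "c \<in> A \<Longrightarrow> fst x \<in> chart_img c \<Longrightarrow> snd (tvec_of A c x) c = snd x"
  by (simp add: tvec_of_comp overlap_iff chart_inv_in transition_deriv_self)

lemma tvec_of_in_TM:
  assumes "c \<in> A" "x \<in> TM_coords c"
  shows "tvec_of A c x \<in> TM A"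
proof -
  obtain z v where x: "x = (z, v)" by (cases x)
  have z: "z \<in> chart_img c" using assms x by (auto simp: TM_coords_def)
  show ?thesis
    unfolding TM_def tvec_of_def x using assms(1) z transition_deriv_cocycle[of c]
    by (auto simp: overlap_iff transition_apply)
qed

lemma tvec_of_in_TM0:
  assumes "c \<in> A" "x \<in> TM0_coords c"
  shows "tvec_of A c x \<in> TM0 A"
proof -
  have "x \<in> TM_coords c" using assms TM0_coords_subset by blast
  moreover have "snd (tvec_of A c x) c \<noteq> 0"
    using assms by (subst tvec_of_comp_self) (auto simp: TM0_coords_def)
  ultimately show ?thesis
    using tvec_of_in_TM[OF assms(1)] by (auto simp: TM0_def)
qed

lemma TM_component:
  assumes "t \<in> TM A"
  shows "c \<in> A \<Longrightarrow> d \<in> A \<Longrightarrow> fst t \<in> fst c \<Longrightarrow> fst t \<in> fst d \<Longrightarrow>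
      snd t d = transition_deriv c d (snd c (fst t)) (snd t c)"
    and "d \<notin> A \<or> fst t \<notin> fst d \<Longrightarrow> snd t d = 0"
  using assms unfolding TM_def case_prod_beta mem_Collect_eq by blast+

lemma TM_tvec_of:
  assumes "t \<in> TM A" "c \<in> A" "fst t \<in> fst c"
  shows "t = tvec_of A c (snd c (fst t), snd t c)"
proof (rule prod_eqI)
  show "fst t = fst (tvec_of A c (snd c (fst t), snd t c))"
    using assms by (simp add: chart_inv_left)
  have p: "chart_inv c (snd c (fst t)) = fst t" using assms by (simp add: chart_inv_left)
  have "snd t d = snd (tvec_of A c (snd c (fst t), snd t c)) d" for d
  proof (cases "d \<in> A \<and> fst t \<in> fst d")
    case True
    then show ?thesis using TM_component(1)[OF assms(1,2) _ assms(3)] by (simp add: tvec_of_def p)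
  next
    case False
    then have "snd t d = 0" using TM_component(2)[OF assms(1)] by blast
    then show ?thesis using False by (auto simp: tvec_of_def p)
  qed
  then show "snd t = snd (tvec_of A c (snd c (fst t), snd t c))" by blast
qed

lemma TM0_comp_nonzero:
  assumes "t \<in> TM0 A" "c \<in> A" "fst t \<in> fst c"
  shows "snd t c \<noteq> 0"
proof
  assume 0: "snd t c = 0"
  have t: "t \<in> TM A" "snd t \<noteq> (\<lambda>_. 0)" using assms by (auto simp: TM0_def)
  have "snd t d = 0" for d
  proof (cases "d \<in> A \<and> fst t \<in> fst d")
    case True
    then have "snd t d = transition_deriv c d (snd c (fst t)) 0"
      using TM_component(1)[OF t(1) assms(2)] assms(3) 0 by simp
    moreover have "linear (transition_deriv c d (snd c (fst t)))"
      using True assms by (intro transition_deriv_linear) (auto simp: overlap_def)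
    ultimately show ?thesis by (simp add: linear_0)
  next
    case False
    then show ?thesis using TM_component(2)[OF t(1)] by blast
  qed
  with t(2) show False by auto
qed

lemma tscale_tvec_of:
  assumes "c \<in> A" "z \<in> chart_img c"
  shows "tscale \<zeta> (tvec_of A c (z, v)) = tvec_of A c (z, \<zeta> *s v)"
  unfolding tscale_def tvec_of_def using assms
  by (auto simp: fun_eq_iff overlap_iff transition_deriv_scale)

lemma smooth_fun_derivative:
  assumes "smooth_fun A u" "c \<in> A" "z \<in> chart_img c"
  shows "(\<lambda>z. u (chart_inv c z)) differentiable (at z)"
  using assms smooth_on_differentiable[of "chart_img c" "u \<circ> chart_inv c" z]
  by (auto simp: smooth_fun_def o_def)

text \<open>The chain rule, for two coordinate representations of one function on the manifold.\<close>

lemma derivative_change_of_chart: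
  assumes u: "(\<lambda>z. u (chart_inv d z)) differentiable (at (transition c d z))"
    and cd: "c \<in> A" "d \<in> A" and z: "z \<in> overlap c d"
  shows "frechet_derivative (\<lambda>z. u (chart_inv c z)) (at z) v =
     frechet_derivative (\<lambda>z. u (chart_inv d z)) (at (transition c d z)) (transition_deriv c d z v)"
proof -
  have "((\<lambda>z. u (chart_inv d (transition c d z))) has_derivative
     (\<lambda>v. frechet_derivative (\<lambda>z. u (chart_inv d z)) (at (transition c d z)) (transition_deriv c d z v))) (at z)"
    by (rule has_derivative_compose[OF transition_has_derivative[OF cd z] frechet_derivative_has[OF u]])
  then have "((\<lambda>z. u (chart_inv c z)) has_derivative
     (\<lambda>v. frechet_derivative (\<lambda>z. u (chart_inv d z)) (at (transition c d z)) (transition_deriv c d z v))) (at z)"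
    by (rule has_derivative_transform_within_open[OF _ overlap_open[OF cd] z])
      (simp add: transition_in_overlap(2)[OF cd])
  then show ?thesis by (metis frechet_derivative_eqI)
qed

end

section \<open>Positive definite Hermitian matrices\<close>

lemma matrix_inv_eqI:
  fixes B :: "complex^'n^'n"
  assumes "B ** C = mat 1"
  shows "matrix_inv B = C"
proof -
  have inv: "invertible B" using assms invertible_right_inverse by blast
  have "matrix_inv B ** (B ** C) = (matrix_inv B ** B) ** C" by (simp add: matrix_mul_assoc)
  then show ?thesis using assms matrix_inv_inverse[OF inv] by simp
qed

lemma hermitian_form_mult:
  "(\<Sum>\<alpha>\<in>UNIV. \<Sum>\<beta>\<in>UNIV. H $ \<alpha> $ \<beta> * w $ \<alpha> * cnj (w $ \<beta>)) =
   (\<Sum>\<alpha>\<in>UNIV. w $ \<alpha> * (H *v (\<chi> \<beta>. cnj (w $ \<beta>))) $ \<alpha>)" for H :: "complex^'n^'n"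
  by (simp add: matrix_vector_mult_def sum_distrib_left mult_ac)

lemma positive_definite_invertible:
  assumes "positive_definite H"
  shows "invertible H"
proof -
  have "w = 0" if "H *v w = 0" for w
  proof (rule ccontr)
    assume "w \<noteq> 0"
    define u where "u = (\<chi> \<beta>. cnj (w $ \<beta>))"
    have "u \<noteq> 0" using \<open>w \<noteq> 0\<close> by (auto simp: u_def vec_eq_iff)
    moreover have "(\<chi> \<beta>. cnj (u $ \<beta>)) = w" by (simp add: u_def vec_eq_iff)
    ultimately show False
      using assms that unfolding positive_definite_def hermitian_form_mult by fastforce
  qed
  then show ?thesis
    using matrix_left_invertible_ker[of H] invertible_left_inverse by blast
qed

text \<open>With \<open>w = matrix_inv H *v a\<close> the form of the inverse at \<open>a\<close> is the conjugate of the form of \<open>H\<close> at the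
  conjugate vector of \<open>w\<close>.\<close>

lemma positive_definite_inverse_pos:
  assumes "positive_definite H" "a \<noteq> 0"
  shows "Im (\<Sum>\<alpha>\<in>UNIV. \<Sum>\<beta>\<in>UNIV. matrix_inv H $ \<beta> $ \<alpha> * a $ \<alpha> * cnj (a $ \<beta>)) = 0"
    and "Re (\<Sum>\<alpha>\<in>UNIV. \<Sum>\<beta>\<in>UNIV. matrix_inv H $ \<beta> $ \<alpha> * a $ \<alpha> * cnj (a $ \<beta>)) > 0"
proof -
  define w where "w = matrix_inv H *v a"
  define u where "u = (\<chi> \<beta>. cnj (w $ \<beta>))"
  have herm: "H $ \<beta> $ \<alpha> = cnj (H $ \<alpha> $ \<beta>)" for \<alpha> \<beta>
    using assms(1) unfolding positive_definite_def by blast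
  have a: "a = H *v w"
    by (simp add: w_def matrix_vector_mul_assoc matrix_inv_inverse[OF positive_definite_invertible[OF assms(1)]])
  have "w \<noteq> 0" using assms(2) a by auto
  then have u: "u \<noteq> 0" by (auto simp: u_def vec_eq_iff)
  have cu: "(\<chi> \<beta>. cnj (u $ \<beta>)) = w" by (simp add: u_def vec_eq_iff)
  let ?f = "\<Sum>\<alpha>\<in>UNIV. \<Sum>\<beta>\<in>UNIV. H $ \<alpha> $ \<beta> * u $ \<alpha> * cnj (u $ \<beta>)"
  have "(\<Sum>\<alpha>\<in>UNIV. \<Sum>\<beta>\<in>UNIV. matrix_inv H $ \<beta> $ \<alpha> * a $ \<alpha> * cnj (a $ \<beta>)) =
     (\<Sum>\<beta>\<in>UNIV. cnj (a $ \<beta>) * w $ \<beta>)"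
    by (subst sum.swap) (simp add: w_def matrix_vector_mult_def sum_distrib_left mult_ac)
  also have "\<dots> = cnj (\<Sum>\<beta>\<in>UNIV. u $ \<beta> * (H *v w) $ \<beta>)"
    by (simp add: a[symmetric] u_def mult_ac)
  also have "\<dots> = cnj ?f" unfolding hermitian_form_mult cu ..
  finally have eq: "(\<Sum>\<alpha>\<in>UNIV. \<Sum>\<beta>\<in>UNIV. matrix_inv H $ \<beta> $ \<alpha> * a $ \<alpha> * cnj (a $ \<beta>)) = cnj ?f" .
  have "cnj ?f = (\<Sum>\<alpha>\<in>UNIV. \<Sum>\<beta>\<in>UNIV. H $ \<beta> $ \<alpha> * cnj (u $ \<alpha>) * u $ \<beta>)"
    unfolding cnj_sum complex_cnj_mult herm[symmetric] by simp
  also have "\<dots> = ?f"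
    by (subst sum.swap) (simp add: mult_ac)
  finally have "?f \<in> \<real>" by (simp only: Reals_cnj_iff)
  then have "Im ?f = 0" by (simp only: complex_is_Real_iff)
  moreover have "Re ?f > 0" using assms(1) u unfolding positive_definite_def by blast
  moreover have cnj_pos: "Im q = 0 \<Longrightarrow> Re q > 0 \<Longrightarrow> Im (cnj q) = 0 \<and> Re (cnj q) > 0" for q by simp
  ultimately show "Im (\<Sum>\<alpha>\<in>UNIV. \<Sum>\<beta>\<in>UNIV. matrix_inv H $ \<beta> $ \<alpha> * a $ \<alpha> * cnj (a $ \<beta>)) = 0"
    "Re (\<Sum>\<alpha>\<in>UNIV. \<Sum>\<beta>\<in>UNIV. matrix_inv H $ \<beta> $ \<alpha> * a $ \<alpha> * cnj (a $ \<beta>)) > 0"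
    unfolding eq using cnj_pos by blast+
qed

section \<open>A metric in a chart\<close>

text \<open>A metric seen in one chart: the domain of all local coefficients is the open set \<open>N\<close> of
  coordinates of nonzero tangent vectors.\<close>

locale finsler_chart = complex_manifold A
  for A :: "('a::topological_space, 'n::finite) chart set" +
  fixes F :: "('a, 'n) tvec \<Rightarrow> real" and c :: "('a, 'n) chart"
  assumes c: "c \<in> A" and spc: "strongly_pseudoconvex A F"
begin

abbreviation "N \<equiv> TM0_coords c"

lemma N_open: "open N" by (rule TM0_coords_open[OF c])

lemma N_fst: "x \<in> N \<Longrightarrow> fst x \<in> chart_img c"
  by (auto simp: TM0_coords_def)

lemma N_scale: "y \<in> N \<Longrightarrow> \<zeta> \<noteq> 0 \<Longrightarrow> fibre_scale \<zeta> y \<in> N"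
  by (auto simp: TM0_coords_def fibre_scale_def vec_eq_iff)

lemma finsler: "complex_finsler A F"
  using spc by (simp add: strongly_pseudoconvex_def)

lemma F_scale: "t \<in> TM A \<Longrightarrow> F (tscale \<zeta> t) = cmod \<zeta> * F t"
  using finsler unfolding complex_finsler_def by blast

lemma G_loc_smooth: "smooth_on N (G_loc A F c)"
  using finsler c by (simp add: complex_finsler_def)

lemma G_smooth: "smooth_on N (Gc A F c)"
  unfolding Gc_def by (rule smooth_on_linear[OF N_open bounded_linear_of_real G_loc_smooth])

lemma G_loc_pos: "x \<in> N \<Longrightarrow> G_loc A F c x > 0"
  using finsler tvec_of_in_TM0[OF c, of x] by (force simp: complex_finsler_def G_loc_def)

lemma G_nonzero: "x \<in> N \<Longrightarrow> Gc A F c x \<noteq> 0"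
  using G_loc_pos[of x] by (simp add: Gc_def)

lemma G_hom:
  assumes "y \<in> N"
  shows "Gc A F c (fibre_scale \<zeta> y) = (\<zeta> * cnj \<zeta>) * Gc A F c y"
proof -
  obtain z v where y: "y = (z, v)" "z \<in> chart_img c" using assms by (auto simp: TM0_coords_def)
  have "tvec_of A c y \<in> TM A" using assms TM0_coords_subset tvec_of_in_TM[OF c] by blast
  then have "F (tvec_of A c (fibre_scale \<zeta> y)) = cmod \<zeta> * F (tvec_of A c y)"
    using F_scale[of "tvec_of A c y" \<zeta>] tscale_tvec_of[OF c y(2), of \<zeta> v] by (simp add: y(1) fibre_scale_def)
  then show ?thesis
    by (simp add: Gc_def G_loc_def power_mult_distrib complex_norm_square[unfolded of_real_power])
qed

lemma N_cong:
  assumes "\<forall>y\<in>N. f y = g y" "x \<in> N"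
  shows "d_z \<mu> f x = d_z \<mu> g x" "d_zbar \<mu> f x = d_zbar \<mu> g x"
    "d_v \<mu> f x = d_v \<mu> g x" "d_vbar \<mu> f x = d_vbar \<mu> g x"
  by (intro d_cong[OF N_open assms(2)] bspec[OF assms(1)]; assumption)+

lemmas N_smooth = d_smooth[OF N_open]
lemmas N_diff = smooth_on_differentiable[where S = N]
lemmas hom_derivatives = derivatives_of_homogeneous[OF N_open _ N_scale N_diff]

lemma Gvbar_hom: "y \<in> N \<Longrightarrow> \<zeta> \<noteq> 0 \<Longrightarrow> d_vbar \<beta> (Gc A F c) (fibre_scale \<zeta> y) = \<zeta> * d_vbar \<beta> (Gc A F c) y"
  using hom_derivatives(4)[OF _ _ _ G_smooth _ G_hom, of y \<zeta> \<beta>] by simp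

lemma Gmat_smooth: "smooth_on N (\<lambda>x. Gmat A F c x $ \<alpha> $ \<beta>)"
  unfolding Gmat_def vec_lambda_beta by (intro N_smooth G_smooth)

lemma Gmat_hom: "y \<in> N \<Longrightarrow> \<zeta> \<noteq> 0 \<Longrightarrow> Gmat A F c (fibre_scale \<zeta> y) = Gmat A F c y"
  unfolding Gmat_def vec_eq_iff vec_lambda_beta
  using hom_derivatives(3)[OF _ _ _ N_smooth(4)[OF G_smooth] _ Gvbar_hom, of y \<zeta>] by simp

lemma Gmat_pos: "x \<in> N \<Longrightarrow> positive_definite (Gmat A F c x)"
  using spc c by (simp add: strongly_pseudoconvex_def)

lemma Gmat_herm: "x \<in> N \<Longrightarrow> Gmat A F c x $ \<beta> $ \<alpha> = cnj (Gmat A F c x $ \<alpha> $ \<beta>)"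
  using Gmat_pos unfolding positive_definite_def by blast

lemma Gmat_invertible: "x \<in> N \<Longrightarrow> invertible (Gmat A F c x)"
  using Gmat_pos positive_definite_invertible by blast

lemma Ginv_smooth: "smooth_on N (\<lambda>x. Ginv A F c x $ \<alpha> $ \<beta>)"
  unfolding Ginv_def by (rule smooth_on_matrix_inv[OF N_open Gmat_smooth Gmat_invertible])

lemma Ginv_hom: "y \<in> N \<Longrightarrow> \<zeta> \<noteq> 0 \<Longrightarrow> Ginv A F c (fibre_scale \<zeta> y) = Ginv A F c y"
  unfolding Ginv_def by (simp add: Gmat_hom)

lemma Ginv_left:
  assumes "x \<in> N"
  shows "(\<Sum>\<kappa>\<in>UNIV. Ginv A F c x $ \<alpha> $ \<kappa> * Gmat A F c x $ \<kappa> $ \<beta>) = (if \<alpha> = \<beta> then 1 else 0)"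
  using matrix_inv_inverse(2)[OF Gmat_invertible[OF assms]]
  by (simp add: Ginv_def[symmetric] matrix_matrix_mult_def mat_def vec_eq_iff)

lemma Ginv_right:
  assumes "x \<in> N"
  shows "(\<Sum>\<kappa>\<in>UNIV. Ginv A F c x $ \<kappa> $ \<alpha> * Gmat A F c x $ \<beta> $ \<kappa>) = (if \<beta> = \<alpha> then 1 else 0)"
  using matrix_inv_inverse(1)[OF Gmat_invertible[OF assms]]
  by (simp add: Ginv_def[symmetric] matrix_matrix_mult_def mat_def vec_eq_iff mult.commute)

lemma Gamma_smooth: "smooth_on N (Gamma A F c \<alpha> \<mu>)"
  unfolding Gamma_def[abs_def]
  by (intro smooth_on_sum smooth_on_mult Ginv_smooth N_open N_smooth G_smooth)

text \<open>The mixed derivative in \<open>Gamma\<close> has the factor \<open>\<zeta> cnj \<zeta>\<close> of \<open>G\<close> divided by \<open>cnj \<zeta>\<close>.\<close>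

lemma Gamma_hom: "y \<in> N \<Longrightarrow> \<zeta> \<noteq> 0 \<Longrightarrow> Gamma A F c \<alpha> \<mu> (fibre_scale \<zeta> y) = \<zeta> * Gamma A F c \<alpha> \<mu> y"
proof -
  assume y: "y \<in> N" "\<zeta> \<noteq> 0"
  have "d_z \<mu> (Gc A F c) (fibre_scale \<zeta> w) = (\<zeta> * cnj \<zeta>) * d_z \<mu> (Gc A F c) w" if "w \<in> N" for w
    using hom_derivatives(1)[OF that _ y(2) G_smooth _ G_hom, of \<mu>] by simp
  then have "d_vbar \<kappa> (d_z \<mu> (Gc A F c)) (fibre_scale \<zeta> y) = \<zeta> * d_vbar \<kappa> (d_z \<mu> (Gc A F c)) y" for \<kappa>
    using hom_derivatives(4)[OF y(1) _ y(2) N_smooth(1)[OF G_smooth, of \<mu>], of "\<zeta> * cnj \<zeta>" \<kappa>] y(2) by simp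
  then show ?thesis
    unfolding Gamma_def by (simp add: Ginv_hom[OF y] sum_distrib_left mult_ac)
qed

lemma delta_smooth: "smooth_on N f \<Longrightarrow> smooth_on N (delta A F c \<mu> f)"
  unfolding delta_def[abs_def]
  by (intro smooth_on_diff smooth_on_sum smooth_on_mult Gamma_smooth N_open N_smooth)

text \<open>The factor \<open>\<zeta>\<close> of \<open>Gamma\<close> cancels the one that the \<open>v\<close>-derivative loses.\<close>

lemma delta_hom:
  assumes y: "y \<in> N" "\<zeta> \<noteq> 0" and f: "smooth_on N f" "\<And>y. y \<in> N \<Longrightarrow> f (fibre_scale \<zeta> y) = f y"
  shows "delta A F c \<mu> f (fibre_scale \<zeta> y) = delta A F c \<mu> f y"
proof -
  have "d_z \<mu> f (fibre_scale \<zeta> y) = d_z \<mu> f y" "\<zeta> * d_v \<alpha> f (fibre_scale \<zeta> y) = d_v \<alpha> f y" for \<alpha>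
    using hom_derivatives(1)[OF y(1) _ y(2) f(1), of 1 \<mu>] hom_derivatives(3)[OF y(1) _ y(2) f(1), of 1 \<alpha>] f(2)
    by simp_all
  moreover have "\<zeta> * Gamma A F c \<alpha> \<mu> y * d_v \<alpha> f (fibre_scale \<zeta> y) =
      Gamma A F c \<alpha> \<mu> y * (\<zeta> * d_v \<alpha> f (fibre_scale \<zeta> y))" for \<alpha> by (simp only: mult_ac)
  ultimately show ?thesis unfolding delta_def by (simp only: Gamma_hom[OF y])
qed

lemma Gamma2_smooth: "smooth_on N (Gamma2 A F c \<alpha> \<beta> \<mu>)"
  unfolding Gamma2_def[abs_def]
  by (intro smooth_on_sum smooth_on_mult Ginv_smooth N_open delta_smooth Gmat_smooth)

lemma Gamma2_hom: "y \<in> N \<Longrightarrow> \<zeta> \<noteq> 0 \<Longrightarrow> Gamma2 A F c \<alpha> \<beta> \<mu> (fibre_scale \<zeta> y) = Gamma2 A F c \<alpha> \<beta> \<mu> y"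
  unfolding Gamma2_def by (simp add: Ginv_hom delta_hom[OF _ _ Gmat_smooth] Gmat_hom)

lemma euler:
  assumes "x \<in> N" "smooth_on N f" "\<And>\<zeta>. \<zeta> \<noteq> 0 \<Longrightarrow> f (fibre_scale \<zeta> x) = \<zeta> ^ p * cnj \<zeta> ^ q * f x"
  shows "(\<Sum>\<alpha>\<in>UNIV. snd x $ \<alpha> * d_v \<alpha> f x) = of_nat p * f x"
    and "(\<Sum>\<alpha>\<in>UNIV. cnj (snd x $ \<alpha>) * d_vbar \<alpha> f x) = of_nat q * f x"
  using euler_relation[of f "fst x" "snd x" p q] N_diff[OF assms(2,1)] assms(3)
  by (simp_all add: fibre_scale_def)

lemma euler_G: "x \<in> N \<Longrightarrow> (\<Sum>\<alpha>\<in>UNIV. snd x $ \<alpha> * d_v \<alpha> (Gc A F c) x) = Gc A F c x"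
  using euler(1)[OF _ G_smooth, of x 1 1] by (simp add: G_hom)

text \<open>The derivative of \<open>G\<close> by a conjugate fibre coordinate is homogeneous of degree one in \<open>v\<close>.\<close>

lemma euler_Gvbar: "x \<in> N \<Longrightarrow> (\<Sum>\<alpha>\<in>UNIV. snd x $ \<alpha> * Gmat A F c x $ \<alpha> $ \<beta>) = d_vbar \<beta> (Gc A F c) x"
  using euler(1)[OF _ N_smooth(4)[OF G_smooth], of x \<beta> 1 0] by (simp add: Gvbar_hom Gmat_def)

lemma euler_invariant:
  assumes "x \<in> N" "smooth_on N f" "\<And>\<zeta>. \<zeta> \<noteq> 0 \<Longrightarrow> f (fibre_scale \<zeta> x) = f x"
  shows "(\<Sum>\<alpha>\<in>UNIV. snd x $ \<alpha> * d_v \<alpha> f x) = 0"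
    and "(\<Sum>\<alpha>\<in>UNIV. cnj (snd x $ \<alpha>) * d_vbar \<alpha> f x) = 0"
  using euler[OF assms(1,2), of 0 0] assms(3) by simp_all

end

section \<open>Conformal changes in a chart\<close>

text \<open>Equality with the conformal change is required on tangent vectors only, as elsewhere in the type
  the values of a metric are arbitrary. The formulas for \<open>F'\<close> also serve to derive its pseudoconvexity
  from that of \<open>F\<close>.\<close>

locale conformal_chart = finsler_chart A F c
  for A :: "('a::topological_space, 'n::finite) chart set" and F c +
  fixes F' :: "('a, 'n) tvec \<Rightarrow> real" and \<rho> :: "'a \<Rightarrow> real"
  assumes rho: "smooth_fun A \<rho>" and conf: "t \<in> TM A \<Longrightarrow> F' t = conformal_change \<rho> F t"
begin

definition "rho_loc z = complex_of_real (\<rho> (chart_inv c z))"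
definition "rho_lift x = rho_loc (fst x)"
definition "del_rho \<mu> z = wirtinger (axis \<mu> 1) (axis \<mu> \<i>) rho_loc z"

lemma rho_loc_smooth: "smooth_on (chart_img c) rho_loc"
  unfolding rho_loc_def
  using smooth_on_linear[OF chart_open(2)[OF c] bounded_linear_of_real] rho c by (auto simp: smooth_fun_def o_def)

lemma del_rho_smooth: "smooth_on (chart_img c) (del_rho \<mu>)"
  unfolding del_rho_def[abs_def] using wirtinger_smooth(1)[OF chart_open(2)[OF c] rho_loc_smooth] .

lemma smooth_fst: "smooth_on (chart_img c) f \<Longrightarrow> smooth_on N (\<lambda>x. f (fst x))"
  unfolding TM0_coords_def by (intro smooth_on_compose_fst chart_open[OF c]) auto

lemma rho_lift_smooth: "smooth_on N rho_lift"
  unfolding rho_lift_def[abs_def] by (rule smooth_fst[OF rho_loc_smooth])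

lemma d_rho_lift:
  assumes "x \<in> N"
  shows "d_z \<mu> rho_lift x = del_rho \<mu> (fst x)" "d_v \<mu> rho_lift x = 0" "d_vbar \<mu> rho_lift x = 0"
  unfolding rho_lift_def[abs_def] del_rho_def
  using d_fst[OF smooth_on_differentiable[OF rho_loc_smooth N_fst[OF assms]]] by simp_all

lemma d_exp_rho_lift:
  assumes "x \<in> N"
  shows "d_z \<mu> (\<lambda>x. exp (rho_lift x)) x = exp (rho_lift x) * del_rho \<mu> (fst x)"
    "d_v \<mu> (\<lambda>x. exp (rho_lift x)) x = 0" "d_vbar \<mu> (\<lambda>x. exp (rho_lift x)) x = 0"
  using d_chain[OF N_diff[OF rho_lift_smooth assms] DERIV_exp] d_rho_lift[OF assms] by simp_all

lemma exp_rho_lift_smooth: "smooth_on N (\<lambda>x. exp (rho_lift x))"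
  by (intro smooth_on_exp N_open rho_lift_smooth)

lemma exp_rho_lift_cancel: "exp (- rho_lift x) * p * (exp (rho_lift x) * q) = p * q"
  by (simp add: exp_minus)

lemma G_loc_conformal: "x \<in> TM_coords c \<Longrightarrow> G_loc A F' c x = exp (\<rho> (chart_inv c (fst x))) * G_loc A F c x"
  using conf[OF tvec_of_in_TM[OF c]]
  by (simp add: G_loc_def conformal_change_def power_mult_distrib exp_double[symmetric])

lemma Gc_conformal: "x \<in> N \<Longrightarrow> Gc A F' c x = exp (rho_lift x) * Gc A F c x"
  using G_loc_conformal[of x] TM0_coords_subset[of c] by (auto simp: Gc_def rho_lift_def rho_loc_def exp_of_real)

lemma Gc_conformal_ball: "\<forall>x\<in>N. Gc A F' c x = exp (rho_lift x) * Gc A F c x"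
  using Gc_conformal by blast

lemma Gvbar_conformal: "x \<in> N \<Longrightarrow> d_vbar \<beta> (Gc A F' c) x = exp (rho_lift x) * d_vbar \<beta> (Gc A F c) x"
  using d_mult(4)[OF N_diff[OF exp_rho_lift_smooth] N_diff[OF G_smooth], of x \<beta>] d_exp_rho_lift
    N_cong(4)[OF Gc_conformal_ball, of x \<beta>] by simp

lemma Gv_conformal: "x \<in> N \<Longrightarrow> d_v \<beta> (Gc A F' c) x = exp (rho_lift x) * d_v \<beta> (Gc A F c) x"
  using d_mult(3)[OF N_diff[OF exp_rho_lift_smooth] N_diff[OF G_smooth], of x \<beta>] d_exp_rho_lift
    N_cong(3)[OF Gc_conformal_ball, of x \<beta>] by simp

lemma Gmat_conformal: "x \<in> N \<Longrightarrow> Gmat A F' c x $ \<alpha> $ \<beta> = exp (rho_lift x) * Gmat A F c x $ \<alpha> $ \<beta>"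
  using d_mult(3)[OF N_diff[OF exp_rho_lift_smooth] N_diff[OF N_smooth(4)[OF G_smooth]], of x \<alpha> \<beta>] d_exp_rho_lift
    N_cong(3)[of "d_vbar \<beta> (Gc A F' c)" "\<lambda>x. exp (rho_lift x) * d_vbar \<beta> (Gc A F c) x" x \<alpha>] Gvbar_conformal
  by (simp add: Gmat_def)

lemma Ginv_conformal:
  assumes "x \<in> N"
  shows "Ginv A F' c x $ \<alpha> $ \<beta> = exp (- rho_lift x) * Ginv A F c x $ \<alpha> $ \<beta>"
proof -
  let ?B = "\<chi> \<alpha> \<beta>. exp (- rho_lift x) * Ginv A F c x $ \<alpha> $ \<beta>"
  have "Gmat A F' c x ** ?B = mat 1"
    using Ginv_right[OF assms]
    by (simp add: matrix_matrix_mult_def vec_eq_iff mat_def Gmat_conformal[OF assms] exp_minus field_simps)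
  then show ?thesis unfolding Ginv_def[of A F'] by (simp add: matrix_inv_eqI)
qed

text \<open>The product rule produces the extra term \<open>del_rho \<mu>\<close> times the derivative of \<open>G\<close> by a conjugate
  fibre coordinate; raising its index by the inverse metric returns \<open>v\<close> by Euler's identity.\<close>

lemma Gamma_conformal:
  assumes x: "x \<in> N"
  shows "Gamma A F' c \<alpha> \<mu> x = Gamma A F c \<alpha> \<mu> x + snd x $ \<alpha> * del_rho \<mu> (fst x)"
proof -
  have 1: "d_z \<mu> (Gc A F' c) y = exp (rho_lift y) * (del_rho \<mu> (fst y) * Gc A F c y + d_z \<mu> (Gc A F c) y)" if "y \<in> N" for y
    using d_mult(1)[OF N_diff[OF exp_rho_lift_smooth that] N_diff[OF G_smooth that], of \<mu>] d_exp_rho_lift[OF that]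
      N_cong(1)[OF Gc_conformal_ball that, of \<mu>] by (simp add: algebra_simps)
  have 2: "d_vbar \<kappa> (d_z \<mu> (Gc A F' c)) x =
     exp (rho_lift x) * (del_rho \<mu> (fst x) * d_vbar \<kappa> (Gc A F c) x + d_vbar \<kappa> (d_z \<mu> (Gc A F c)) x)" for \<kappa>
  proof -
    have rs: "smooth_on N (\<lambda>y. del_rho \<mu> (fst y))" by (rule smooth_fst[OF del_rho_smooth])
    have s: "smooth_on N (\<lambda>y. del_rho \<mu> (fst y) * Gc A F c y)" by (intro smooth_on_mult rs G_smooth N_open)
    have s2: "smooth_on N (d_z \<mu> (Gc A F c))" by (rule N_smooth(1)[OF G_smooth])
    have s3: "smooth_on N (\<lambda>y. del_rho \<mu> (fst y) * Gc A F c y + d_z \<mu> (Gc A F c) y)"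
      by (intro smooth_on_add s s2 N_open)
    have "d_vbar \<kappa> (d_z \<mu> (Gc A F' c)) x = exp (rho_lift x) * d_vbar \<kappa> (\<lambda>y. del_rho \<mu> (fst y) * Gc A F c y + d_z \<mu> (Gc A F c) y) x"
      using N_cong(4)[OF ballI[where P = "\<lambda>y. d_z \<mu> (Gc A F' c) y = exp (rho_lift y) * (del_rho \<mu> (fst y) * Gc A F c y + d_z \<mu> (Gc A F c) y)"] x]
        1 d_mult(4)[OF N_diff[OF exp_rho_lift_smooth x] N_diff[OF s3 x]] d_exp_rho_lift[OF x]
      by simp
    also have "\<dots> = exp (rho_lift x) * (del_rho \<mu> (fst x) * d_vbar \<kappa> (Gc A F c) x + d_vbar \<kappa> (d_z \<mu> (Gc A F c)) x)"
      using d_add(4)[OF N_diff[OF s x] N_diff[OF s2 x]] d_mult(4)[OF N_diff[OF rs x] N_diff[OF G_smooth x]]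
        d_fst(4)[OF smooth_on_differentiable[OF del_rho_smooth N_fst[OF x]]] by simp
    finally show ?thesis .
  qed
  have 3: "(\<Sum>\<kappa>\<in>UNIV. Ginv A F c x $ \<kappa> $ \<alpha> * d_vbar \<kappa> (Gc A F c) x) = snd x $ \<alpha>"
  proof -
    have "(\<Sum>\<kappa>\<in>UNIV. Ginv A F c x $ \<kappa> $ \<alpha> * d_vbar \<kappa> (Gc A F c) x) =
      (\<Sum>\<kappa>\<in>UNIV. \<Sum>\<gamma>\<in>UNIV. snd x $ \<gamma> * (Ginv A F c x $ \<kappa> $ \<alpha> * Gmat A F c x $ \<gamma> $ \<kappa>))"
      unfolding euler_Gvbar[OF x, symmetric] by (simp add: sum_distrib_left mult_ac)
    also have "\<dots> = (\<Sum>\<gamma>\<in>UNIV. snd x $ \<gamma> * (if \<gamma> = \<alpha> then 1 else 0))"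
      by (subst sum.swap) (simp only: sum_distrib_left[symmetric] Ginv_right[OF x])
    finally show ?thesis by (simp add: if_distrib[of "\<lambda>t. _ * t"] cong: if_cong)
  qed
  have "Gamma A F' c \<alpha> \<mu> x = (\<Sum>\<kappa>\<in>UNIV. Ginv A F c x $ \<kappa> $ \<alpha> *
      (del_rho \<mu> (fst x) * d_vbar \<kappa> (Gc A F c) x + d_vbar \<kappa> (d_z \<mu> (Gc A F c)) x))"
    unfolding Gamma_def 2 Ginv_conformal[OF x] exp_rho_lift_cancel ..
  also have "\<dots> = del_rho \<mu> (fst x) * (\<Sum>\<kappa>\<in>UNIV. Ginv A F c x $ \<kappa> $ \<alpha> * d_vbar \<kappa> (Gc A F c) x) + Gamma A F c \<alpha> \<mu> x"
    by (simp add: Gamma_def sum.distrib sum_distrib_left distrib_left mult_ac)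
  finally show ?thesis using 3 by simp
qed

text \<open>The two operators differ by a multiple of the Euler field, which kills functions that are
  invariant under scaling.\<close>

lemma delta_conformal_invariant:
  assumes x: "x \<in> N" and f: "smooth_on N f" "\<And>\<zeta>. \<zeta> \<noteq> 0 \<Longrightarrow> f (fibre_scale \<zeta> x) = f x"
  shows "delta A F' c \<mu> f x = delta A F c \<mu> f x"
    and "delta_bar A F' c \<mu> f x = delta_bar A F c \<mu> f x"
  unfolding delta_def delta_bar_def Gamma_conformal[OF x]
  using euler_invariant[OF x f]
  by (simp_all add: distrib_right sum.distrib mult.assoc[symmetric] sum_distrib_left[symmetric])
    (simp_all add: mult.commute[of _ "del_rho _ _"] mult.commute[of _ "cnj (del_rho _ _)"] mult.assoc sum_distrib_left[symmetric])

lemma Gamma2_conformal: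
  assumes x: "x \<in> N"
  shows "Gamma2 A F' c \<alpha> \<beta> \<mu> x = Gamma2 A F c \<alpha> \<beta> \<mu> x + (if \<beta> = \<alpha> then del_rho \<mu> (fst x) else 0)"
proof -
  have 1: "delta A F' c \<mu> (\<lambda>y. Gmat A F' c y $ \<beta> $ \<kappa>) x =
      exp (rho_lift x) * (del_rho \<mu> (fst x) * Gmat A F c x $ \<beta> $ \<kappa> + delta A F c \<mu> (\<lambda>y. Gmat A F c y $ \<beta> $ \<kappa>) x)" for \<kappa>
  proof -
    have "delta A F' c \<mu> (\<lambda>y. Gmat A F' c y $ \<beta> $ \<kappa>) x = delta A F' c \<mu> (\<lambda>y. exp (rho_lift y) * Gmat A F c y $ \<beta> $ \<kappa>) x"
      using N_cong(1,3)[of "\<lambda>y. Gmat A F' c y $ \<beta> $ \<kappa>" "\<lambda>y. exp (rho_lift y) * Gmat A F c y $ \<beta> $ \<kappa>", OF _ x] Gmat_conformal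
      by (simp add: delta_def)
    also have "\<dots> = delta A F c \<mu> (\<lambda>y. exp (rho_lift y) * Gmat A F c y $ \<beta> $ \<kappa>) x"
    proof (rule delta_conformal_invariant(1)[OF x])
      show "smooth_on N (\<lambda>y. exp (rho_lift y) * Gmat A F c y $ \<beta> $ \<kappa>)"
        by (intro smooth_on_mult exp_rho_lift_smooth Gmat_smooth N_open)
    qed (use x in \<open>simp add: Gmat_hom\<close>, simp add: rho_lift_def fibre_scale_def)
    also have "\<dots> = exp (rho_lift x) * (del_rho \<mu> (fst x) * Gmat A F c x $ \<beta> $ \<kappa> + delta A F c \<mu> (\<lambda>y. Gmat A F c y $ \<beta> $ \<kappa>) x)"
      using d_mult(1,3)[OF N_diff[OF exp_rho_lift_smooth x] N_diff[OF Gmat_smooth x]] d_exp_rho_lift[OF x]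
      by (simp add: delta_def algebra_simps sum_distrib_left)
    finally show ?thesis .
  qed
  have "Gamma2 A F' c \<alpha> \<beta> \<mu> x = (\<Sum>\<kappa>\<in>UNIV. Ginv A F c x $ \<kappa> $ \<alpha> *
      (del_rho \<mu> (fst x) * Gmat A F c x $ \<beta> $ \<kappa> + delta A F c \<mu> (\<lambda>y. Gmat A F c y $ \<beta> $ \<kappa>) x))"
    unfolding Gamma2_def 1 Ginv_conformal[OF x] exp_rho_lift_cancel ..
  also have "\<dots> = del_rho \<mu> (fst x) * (\<Sum>\<kappa>\<in>UNIV. Ginv A F c x $ \<kappa> $ \<alpha> * Gmat A F c x $ \<beta> $ \<kappa>) + Gamma2 A F c \<alpha> \<beta> \<mu> x"
    by (simp add: Gamma2_def sum.distrib sum_distrib_left distrib_left mult_ac)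
  finally show ?thesis using Ginv_right[OF x] by simp
qed

text \<open>Since \<open>\<rho>\<close> is real, conjugation turns the order of derivatives occurring in the curvature into the
  one used by \<open>ddbar\<close>.\<close>

lemma delbar_del_rho:
  assumes "z \<in> chart_img c"
  shows "wirtinger_bar (axis \<nu> 1) (axis \<nu> \<i>) (del_rho \<mu>) z = cnj (ddbar c \<rho> \<nu> \<mu> z)"
proof -
  let ?g = "wirtinger_bar (axis \<mu> 1) (axis \<mu> \<i>) rho_loc"
  have "del_rho \<mu> w = cnj (?g w)" if "w \<in> chart_img c" for w
    unfolding del_rho_def rho_loc_def by (rule wirtinger_of_real[OF smooth_fun_derivative[OF rho c that]])
  then have "wirtinger_bar (axis \<nu> 1) (axis \<nu> \<i>) (del_rho \<mu>) z = wirtinger_bar (axis \<nu> 1) (axis \<nu> \<i>) (\<lambda>w. cnj (?g w)) z"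
    by (rule wirtinger_cong(2)[OF chart_open(2)[OF c] assms])
  also have "\<dots> = cnj (wirtinger (axis \<nu> 1) (axis \<nu> \<i>) ?g z)"
    by (intro wirtinger_cnj smooth_on_differentiable[OF _ assms] wirtinger_smooth chart_open c rho_loc_smooth)
  finally show ?thesis by (simp add: ddbar_def rho_loc_def[abs_def])
qed

lemma rund_curvature_conformal:
  assumes x: "x \<in> N"
  shows "rund_curvature A F' c \<alpha> \<beta> \<mu> \<nu> x =
    rund_curvature A F c \<alpha> \<beta> \<mu> \<nu> x - (if \<beta> = \<alpha> then cnj (ddbar c \<rho> \<nu> \<mu> (fst x)) else 0)"
proof -
  define h where "h = (\<lambda>z. if \<beta> = \<alpha> then del_rho \<mu> z else 0)"
  have hs: "smooth_on (chart_img c) h"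
    unfolding h_def by (cases "\<beta> = \<alpha>") (simp_all add: del_rho_smooth smooth_on_const chart_open c)
  have hs': "smooth_on N (\<lambda>x. h (fst x))" by (rule smooth_fst[OF hs])
  have "delta_bar A F' c \<nu> (Gamma2 A F' c \<alpha> \<beta> \<mu>) x = delta_bar A F' c \<nu> (\<lambda>y. Gamma2 A F c \<alpha> \<beta> \<mu> y + h (fst y)) x"
    using N_cong(2,4)[of "Gamma2 A F' c \<alpha> \<beta> \<mu>" "\<lambda>y. Gamma2 A F c \<alpha> \<beta> \<mu> y + h (fst y)", OF _ x] Gamma2_conformal
    by (simp add: delta_bar_def h_def)
  also have "\<dots> = delta_bar A F c \<nu> (\<lambda>y. Gamma2 A F c \<alpha> \<beta> \<mu> y + h (fst y)) x"
  proof (rule delta_conformal_invariant(2)[OF x])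
    show "smooth_on N (\<lambda>y. Gamma2 A F c \<alpha> \<beta> \<mu> y + h (fst y))"
      by (intro smooth_on_add hs' Gamma2_smooth N_open)
  qed (use x in \<open>simp add: Gamma2_hom\<close>, simp add: fibre_scale_def)
  also have "\<dots> = delta_bar A F c \<nu> (Gamma2 A F c \<alpha> \<beta> \<mu>) x + wirtinger_bar (axis \<nu> 1) (axis \<nu> \<i>) h (fst x)"
    using d_add(2,4)[OF N_diff[OF Gamma2_smooth x] N_diff[OF hs' x]]
      d_fst(2,4)[OF smooth_on_differentiable[OF hs N_fst[OF x]]]
    by (simp add: delta_bar_def)
  also have "wirtinger_bar (axis \<nu> 1) (axis \<nu> \<i>) h (fst x) = (if \<beta> = \<alpha> then cnj (ddbar c \<rho> \<nu> \<mu> (fst x)) else 0)"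
    using delbar_del_rho[OF N_fst[OF x]] by (simp add: h_def wirtinger_const)
  finally show ?thesis by (simp add: rund_curvature_def)
qed

end

section \<open>Positivity of wedge products of Hermitian forms\<close>

text \<open>The wedge product of the two-forms of positive Hermitian forms is positive on complex frames. As an
  alternating multilinear expression it does not change when a frame vector is sheared by others,
  and complex Gram-Schmidt orthogonalization consists of such shears. On an orthogonal frame the
  defining sum over permutations has only nonnegative terms.\<close>

definition lift_perm :: "('s \<Rightarrow> 's) \<Rightarrow> 's \<times> bool \<Rightarrow> 's \<times> bool" where
  "lift_perm \<pi> = (\<lambda>(s, r). (\<pi> s, r))"

text \<open>Permuting pairs means permuting the first and the second members in the same way, so the signs
  cancel in pairs.\<close>

lemma sign_lift_perm:
  assumes "finite S" "\<pi> permutes S"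
  shows "permutation (lift_perm \<pi>) \<and> sign (lift_perm \<pi>) = 1"
  using assms(2,1)
proof (induction rule: permutes_induct)
  case id
  have "lift_perm id = (id :: 'a \<times> bool \<Rightarrow> _)" by (auto simp: lift_perm_def)
  then show ?case by (simp add: id_def)
next
  case (swap a b p)
  show ?case
  proof (cases "a = b")
    case True
    then show ?thesis using swap by simp
  next
    case False
    have t: "lift_perm (Transposition.transpose a b) = Transposition.transpose (a, False) (b, False) \<circ> Transposition.transpose (a, True) (b, True)"
      by (auto simp: lift_perm_def fun_eq_iff Transposition.transpose_def)
    have p: "permutation (lift_perm (Transposition.transpose a b))" "sign (lift_perm (Transposition.transpose a b)) = 1"
      unfolding t using False
      by (auto simp: sign_compose permutation_compose permutation_swap_id sign_swap_id)
    have "lift_perm (Transposition.transpose a b \<circ> p) = lift_perm (Transposition.transpose a b) \<circ> lift_perm p"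
      by (auto simp: lift_perm_def fun_eq_iff)
    then show ?thesis using p swap.IH by (simp only: sign_compose permutation_compose) simp
  qed
qed

text \<open>The complex structure \<open>J\<close> is explicit because the frames are real vectors in a real vector space.\<close>

definition hermitian :: "('e::real_vector \<Rightarrow> 'e) \<Rightarrow> ('e \<Rightarrow> 'e \<Rightarrow> complex) \<Rightarrow> bool" where
  "hermitian J h \<longleftrightarrow> (\<forall>y. linear (\<lambda>x. h x y)) \<and> (\<forall>x y. h (J x) y = \<i> * h x y) \<and> (\<forall>x y. h y x = cnj (h x y))"

text \<open>Each slot \<open>s\<close> has its own form, as horizontal and vertical slots carry different ones; the slots
  also index the complex frame \<open>f\<close>, whose underlying real frame consists of all \<open>f k\<close> and \<open>J (f k)\<close>.\<close>

locale hermitian_wedge =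
  fixes S :: "'s set" and J :: "'e::real_vector \<Rightarrow> 'e" and h :: "'s \<Rightarrow> 'e \<Rightarrow> 'e \<Rightarrow> complex"
  assumes fin: "finite S" and J_linear: "linear J" and JJ: "J (J x) = - x"
    and herm: "s \<in> S \<Longrightarrow> hermitian J (h s)"
begin

definition "\<omega> s x y = \<i> * (h s x y - h s y x)"
definition "I = S \<times> (UNIV :: bool set)"
definition "W e = wedge_two_forms S \<omega> e"
definition "real_frame f = (\<lambda>(k, r). if r then J (f k) else f k)"

lemma finI: "finite I" by (simp add: I_def fin)

lemma omega_anti: "\<omega> s y x = - \<omega> s x y"
  by (simp add: \<omega>_def algebra_simps)

lemma h_linear_left: "s \<in> S \<Longrightarrow> linear (\<lambda>x. h s x y)"
  and h_J: "s \<in> S \<Longrightarrow> h s (J x) y = \<i> * h s x y"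
  and h_sym: "s \<in> S \<Longrightarrow> h s y x = cnj (h s x y)"
  by (drule herm, unfold hermitian_def, elim conjE allE, assumption)+

lemma h_linear_right:
  assumes "s \<in> S"
  shows "linear (\<lambda>y. h s x y)"
proof -
  have "h s x y = cnj (h s y x)" for y using assms by (rule h_sym)
  then have eq: "(\<lambda>y. h s x y) = cnj \<circ> (\<lambda>y. h s y x)" unfolding o_def by blast
  show ?thesis
    unfolding eq by (rule linear_compose[OF h_linear_left[OF assms] bounded_linear.linear[OF bounded_linear_cnj]])
qed

lemma linear_mult_left: "linear f \<Longrightarrow> linear (\<lambda>x. f x * (b::complex))"
  and linear_mult_right: "linear f \<Longrightarrow> linear (\<lambda>x. (b::complex) * f x)"
  by (auto intro!: linearI simp: linear_add linear_scale algebra_simps)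

lemma omega_linear:
  assumes "s \<in> S"
  shows "linear (\<lambda>x. \<omega> s x y)" "linear (\<lambda>y. \<omega> s x y)"
  unfolding \<omega>_def
  by (intro linear_mult_right linear_compose_sub h_linear_left h_linear_right assms)+

lemma wedge_linear_slot:
  assumes i: "i \<in> I"
  shows "linear (\<lambda>x. W (e(i := x)))"
proof -
  have term_lin: "linear (\<lambda>x. \<Prod>s\<in>S. \<omega> s ((e(i := x)) (\<sigma> (s, False))) ((e(i := x)) (\<sigma> (s, True))))"
    if \<sigma>: "\<sigma> permutes I" for \<sigma>
  proof -
    obtain s0 b0 where s0: "s0 \<in> S" "\<sigma> (s0, b0) = i"
      using \<sigma> i permutes_image[OF \<sigma>] unfolding I_def by (metis (no_types, lifting) imageE mem_Sigma_iff surj_pair)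
    have other: "\<sigma> (s, b) \<noteq> i" if "(s, b) \<noteq> (s0, b0)" for s b
      using s0(2) permutes_inj[OF \<sigma>] that by (metis injD)
    have eq: "(\<lambda>x. \<Prod>s\<in>S. \<omega> s ((e(i := x)) (\<sigma> (s, False))) ((e(i := x)) (\<sigma> (s, True)))) =
       (\<lambda>x. \<omega> s0 ((e(i := x)) (\<sigma> (s0, False))) ((e(i := x)) (\<sigma> (s0, True))) *
          (\<Prod>s\<in>S - {s0}. \<omega> s (e (\<sigma> (s, False))) (e (\<sigma> (s, True)))))"
      using other by (subst prod.remove[OF fin s0(1)]) (auto intro!: ext arg_cong2[of _ _ _ _ "(*)"] prod.cong)
    have "linear (\<lambda>x. \<omega> s0 ((e(i := x)) (\<sigma> (s0, False))) ((e(i := x)) (\<sigma> (s0, True))))"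
    proof (cases b0)
      case True
      then show ?thesis using s0(2) other[of s0 False] omega_linear(2)[OF s0(1)] by simp
    next
      case False
      then show ?thesis using s0(2) other[of s0 True] omega_linear(1)[OF s0(1)] by simp
    qed
    then show ?thesis unfolding eq by (rule linear_mult_left)
  qed
  show ?thesis
    unfolding W_def wedge_two_forms_def divide_inverse
    by (intro linear_mult_left linear_compose_sum linear_mult_right ballI term_lin) (simp add: I_def)
qed

text \<open>Composing all permutations with the transposition of the two equal entries changes every sign but
  no product.\<close>

lemma wedge_alternating:
  assumes ij: "i \<in> I" "j \<in> I" "i \<noteq> j" and e: "e i = e j"
  shows "W e = 0"
proof -
  let ?t = "\<lambda>\<sigma>. of_int (sign \<sigma>) * (\<Prod>s\<in>S. \<omega> s (e (\<sigma> (s, False))) (e (\<sigma> (s, True))))"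
  have eT: "e (Transposition.transpose i j x) = e x" for x using e by (simp add: Transposition.transpose_def)
  have "(\<Sum>\<sigma> | \<sigma> permutes I. ?t \<sigma>) = (\<Sum>\<sigma> | \<sigma> permutes I. ?t (Transposition.transpose i j \<circ> \<sigma>))"
    by (rule setum_permutations_compose_left) (rule permutes_swap_id[OF ij(1,2)])
  also have "\<dots> = (\<Sum>\<sigma> | \<sigma> permutes I. - ?t \<sigma>)"
  proof (intro sum.cong refl)
    fix \<sigma> assume "\<sigma> \<in> {\<sigma>. \<sigma> permutes I}"
    then have "permutation \<sigma>" using finI permutes_imp_permutation by blast
    then show "?t (Transposition.transpose i j \<circ> \<sigma>) = - ?t \<sigma>"
      using ij(3) by (simp add: sign_compose permutation_swap_id sign_swap_id eT)
  qed
  finally have "(\<Sum>\<sigma> | \<sigma> permutes I. ?t \<sigma>) = 0" by (simp add: sum_negf eq_neg_iff_add_eq_0)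
  then show ?thesis unfolding W_def wedge_two_forms_def I_def by simp
qed

text \<open>By linearity in one slot and alternation, the added vector contributes nothing.\<close>

lemma wedge_shear:
  assumes i: "i \<in> I" and y: "y \<in> span (e ` (I - {i}))"
  shows "W (e(i := e i + y)) = W e"
proof -
  have lin: "linear (\<lambda>x. W (e(i := x)))" by (rule wedge_linear_slot[OF i])
  have "W (e(i := y)) = 0"
  proof (rule linear_eq_0_on_span[OF lin _ y])
    fix x assume "x \<in> e ` (I - {i})"
    then obtain j where j: "j \<in> I" "j \<noteq> i" "x = e j" by auto
    then show "W (e(i := x)) = 0" using wedge_alternating[OF i j(1), of "e(i := x)"] by auto
  qed
  then show ?thesis using linear_add[OF lin, of "e i" y] by simp
qed

lemma wedge_shear_block:
  assumes "finite K" "K \<subseteq> I" "\<And>k. k \<in> K \<Longrightarrow> e' k - e k \<in> span (e ` (I - K))"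
    and "\<And>k. k \<notin> K \<Longrightarrow> e' k = e k"
  shows "W e' = W e"
  using assms
proof (induction K arbitrary: e')
  case empty
  then have "e' = e" by auto
  then show ?case by simp
next
  case (insert i K)
  define e1 where "e1 = e'(i := e i)"
  have "e ` (I - insert i K) \<subseteq> e ` (I - K)" by auto
  then have "W e1 = W e"
    using insert.prems insert.hyps(2) span_mono[of "e ` (I - insert i K)" "e ` (I - K)"]
    by (intro insert.IH) (auto simp: e1_def)
  moreover have "W (e1(i := e1 i + (e' i - e i))) = W e1"
  proof (rule wedge_shear)
    show "i \<in> I" using insert.prems by auto
    have "e ` (I - insert i K) \<subseteq> e1 ` (I - {i})"
      using insert.prems(3) by (force simp: e1_def image_iff)
    then show "e' i - e i \<in> span (e1 ` (I - {i}))"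
      using insert.prems(2)[of i] span_mono by blast
  qed
  moreover have "e1(i := e1 i + (e' i - e i)) = e'" by (auto simp: e1_def)
  ultimately show ?case by simp
qed

text \<open>Let the permutation map pairs to pairs. Each pair that it maps with reversed order contributes one
  minus sign to the sign of the permutation and one, by antisymmetry, to the product.\<close>

lemma wedge_diagonal_term:
  assumes "\<sigma> permutes I" "\<And>s. s \<in> S \<Longrightarrow> fst (\<sigma> (s, False)) = fst (\<sigma> (s, True))"
  shows "of_int (sign \<sigma>) * (\<Prod>s\<in>S. \<omega> s (e (\<sigma> (s, False))) (e (\<sigma> (s, True)))) =
      (\<Prod>s\<in>S. \<omega> s (e (fst (\<sigma> (s, False)), False)) (e (fst (\<sigma> (s, False)), True)))"
  using assms
proof (induction "card {s\<in>S. snd (\<sigma> (s, False))}" arbitrary: \<sigma>)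
  case 0
  then have F: "\<sigma> (s, False) = (fst (\<sigma> (s, False)), False)" if "s \<in> S" for s
    using fin that by (auto simp: prod_eq_iff)
  have T: "\<sigma> (s, True) = (fst (\<sigma> (s, False)), True)" if "s \<in> S" for s
  proof -
    have "\<sigma> (s, True) \<noteq> \<sigma> (s, False)" using permutes_inj[OF 0(2)] by (auto dest: injD)
    then show ?thesis using F[OF that] 0(3)[OF that] by (metis (full_types) prod.collapse)
  qed
  define \<pi> where "\<pi> s = fst (\<sigma> (s, False))" for s
  have out: "\<sigma> (s, r) = (s, r)" if "s \<notin> S" for s r
    using permutes_not_in[OF 0(2), of "(s, r)"] that by (simp add: I_def)
  have lift: "\<sigma> = lift_perm \<pi>"
  proof (rule ext, clarify)
    fix s r show "\<sigma> (s, r) = lift_perm \<pi> (s, r)"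
      using F[of s] T[of s] out[of s] by (cases "s \<in> S"; cases r) (auto simp: lift_perm_def \<pi>_def)
  qed
  have "\<pi> permutes S"
  proof (rule bij_imp_permutes)
    have "\<pi> ` S \<subseteq> S"
    proof (rule image_subsetI)
      fix s assume "s \<in> S"
      then show "\<pi> s \<in> S"
        using permutes_in_image[OF 0(2), of "(s, False)"] by (auto simp: I_def \<pi>_def mem_Times_iff)
    qed
    moreover have "inj_on \<pi> S"
      using permutes_inj[OF 0(2)] unfolding lift by (auto simp: inj_on_def lift_perm_def)
    ultimately show "bij_betw \<pi> S S" using endo_inj_surj[OF fin] by (auto simp: bij_betw_def)
  qed (simp add: \<pi>_def out)
  then have "sign \<sigma> = 1" unfolding lift using sign_lift_perm[OF fin] by blast
  then show ?case using F T by simp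
next
  case (Suc m)
  then obtain s0 where s0: "s0 \<in> S" "snd (\<sigma> (s0, False))"
    by (metis (no_types, lifting) card_eq_0_iff empty_Collect_eq nat.distinct(1))
  \<comment> \<open>Undo the reversal of one pair; the number of reversed pairs is the induction measure.\<close>
  define \<tau> where "\<tau> = \<sigma> \<circ> Transposition.transpose (s0, False) (s0, True)"
  have \<tau>s0: "\<tau> (s0, False) = \<sigma> (s0, True)" "\<tau> (s0, True) = \<sigma> (s0, False)" by (simp_all add: \<tau>_def)
  have \<tau>s: "\<tau> (s, r) = \<sigma> (s, r)" if "s \<noteq> s0" for s r using that by (simp add: \<tau>_def Transposition.transpose_def)
  have perm: "\<tau> permutes I"
    unfolding \<tau>_def using s0 by (intro permutes_compose Suc.prems permutes_swap_id) (auto simp: I_def)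
  have fst_eq: "fst (\<tau> (s, False)) = fst (\<sigma> (s, False))" if "s \<in> S" for s
    using \<tau>s0 \<tau>s Suc.prems(2)[OF that] by (cases "s = s0") auto
  have ne: "\<sigma> (s0, True) \<noteq> \<sigma> (s0, False)" using permutes_inj[OF Suc.prems(1)] by (auto dest: injD)
  then have "\<not> snd (\<sigma> (s0, True))"
    using s0(2) Suc.prems(2)[OF s0(1)] by (metis (full_types) prod.collapse)
  then have "{s\<in>S. snd (\<tau> (s, False))} = {s\<in>S. snd (\<sigma> (s, False))} - {s0}"
    using \<tau>s0 \<tau>s by (auto) metis+
  then have "m = card {s\<in>S. snd (\<tau> (s, False))}"
    using Suc.hyps(2) s0 fin by (simp add: card_Diff_singleton)
  moreover have "fst (\<tau> (s, False)) = fst (\<tau> (s, True))" if "s \<in> S" for s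
    using \<tau>s0 \<tau>s Suc.prems(2)[OF that] by (cases "s = s0") auto
  ultimately have IH: "of_int (sign \<tau>) * (\<Prod>s\<in>S. \<omega> s (e (\<tau> (s, False))) (e (\<tau> (s, True)))) =
      (\<Prod>s\<in>S. \<omega> s (e (fst (\<tau> (s, False)), False)) (e (fst (\<tau> (s, False)), True)))"
    using Suc.hyps(1)[of \<tau>] perm by blast
  have "sign \<tau> = - sign \<sigma>"
    unfolding \<tau>_def using permutes_imp_permutation[OF finI Suc.prems(1)]
    by (simp add: sign_compose permutation_swap_id sign_swap_id)
  moreover have "(\<Prod>s\<in>S. \<omega> s (e (\<tau> (s, False))) (e (\<tau> (s, True)))) =
      - (\<Prod>s\<in>S. \<omega> s (e (\<sigma> (s, False))) (e (\<sigma> (s, True))))"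
    unfolding prod.remove[OF fin s0(1)] \<tau>s0 using \<tau>s
    by (subst omega_anti) (auto intro!: arg_cong2[of _ _ _ _ "(*)"] prod.cong)
  moreover have "(\<Prod>s\<in>S. \<omega> s (e (fst (\<tau> (s, False)), False)) (e (fst (\<tau> (s, False)), True))) =
     (\<Prod>s\<in>S. \<omega> s (e (fst (\<sigma> (s, False)), False)) (e (fst (\<sigma> (s, False)), True)))"
    by (intro prod.cong refl) (simp add: fst_eq)
  ultimately show ?case using IH by simp
qed

text \<open>On an orthogonal frame only permutations mapping pairs to pairs give nonzero terms, all terms are
  nonnegative, and the identity gives a positive one. The values \<open>h s (f k) (f k)\<close> with \<open>s \<noteq> k\<close> may be
  zero: a vertical form vanishes on horizontal frame vectors and conversely.\<close>

lemma wedge_diagonal_pos: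
  assumes orth: "\<And>s k l. s \<in> S \<Longrightarrow> k \<in> S \<Longrightarrow> l \<in> S \<Longrightarrow> k \<noteq> l \<Longrightarrow> h s (f k) (f l) = 0"
    and nonneg: "\<And>s k. s \<in> S \<Longrightarrow> k \<in> S \<Longrightarrow> Re (h s (f k) (f k)) \<ge> 0"
    and pos: "\<And>s. s \<in> S \<Longrightarrow> Re (h s (f s) (f s)) > 0"
  shows "\<exists>x>0. W (real_frame f) = complex_of_real x"
proof -
  let ?e = "real_frame f"
  let ?t = "\<lambda>\<sigma>. of_int (sign \<sigma>) * (\<Prod>s\<in>S. \<omega> s (?e (\<sigma> (s, False))) (?e (\<sigma> (s, True))))"
  have h_J2: "h s x (J y) = - \<i> * h s x y" if "s \<in> S" for s x y
  proof -
    have "h s x (J y) = cnj (h s (J y) x)" using that by (rule h_sym)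
    also have "\<dots> = - \<i> * cnj (h s y x)" using that by (simp add: h_J)
    also have "cnj (h s y x) = h s x y" using that by (rule h_sym[symmetric])
    finally show ?thesis .
  qed
  have \<omega>_diag: "\<omega> s (?e (k, False)) (?e (k, True)) = complex_of_real (2 * Re (h s (f k) (f k)))" if "s \<in> S" for s k
  proof -
    have "Im (h s (f k) (f k)) = 0" using h_sym[OF that, of "f k" "f k"] by (simp add: complex_eq_iff)
    then show ?thesis by (simp add: \<omega>_def real_frame_def h_J[OF that] h_J2[OF that] complex_eq_iff)
  qed
  have \<omega>_off: "\<omega> s (?e (k, r)) (?e (l, r')) = 0" if "s \<in> S" "k \<in> S" "l \<in> S" "k \<noteq> l" for s k l r r'
    using orth[OF that] orth[OF that(1,3,2)] that(4) by (auto simp: \<omega>_def real_frame_def h_J[OF that(1)] h_J2[OF that(1)])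
  have t: "\<exists>x\<ge>0. ?t \<sigma> = complex_of_real x" if \<sigma>: "\<sigma> permutes I" for \<sigma>
  proof (cases "\<forall>s\<in>S. fst (\<sigma> (s, False)) = fst (\<sigma> (s, True))")
    case True
    have in_S: "fst (\<sigma> (s, r)) \<in> S" if "s \<in> S" for s r
      using permutes_in_image[OF \<sigma>, of "(s, r)"] that by (auto simp: I_def mem_Times_iff)
    have "?t \<sigma> = (\<Prod>s\<in>S. complex_of_real (2 * Re (h s (f (fst (\<sigma> (s, False)))) (f (fst (\<sigma> (s, False)))))))"
      using wedge_diagonal_term[OF \<sigma>, of ?e] True \<omega>_diag by simp
    then have "?t \<sigma> = complex_of_real (\<Prod>s\<in>S. 2 * Re (h s (f (fst (\<sigma> (s, False)))) (f (fst (\<sigma> (s, False))))))"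
      by (simp only: of_real_prod)
    moreover have "(\<Prod>s\<in>S. 2 * Re (h s (f (fst (\<sigma> (s, False)))) (f (fst (\<sigma> (s, False)))))) \<ge> 0"
      using nonneg in_S by (intro prod_nonneg) auto
    ultimately show ?thesis by blast
  next
    case False
    then obtain s where s: "s \<in> S" "fst (\<sigma> (s, False)) \<noteq> fst (\<sigma> (s, True))" by blast
    have "fst (\<sigma> (s, r)) \<in> S" for r
      using permutes_in_image[OF \<sigma>, of "(s, r)"] s(1) by (auto simp: I_def mem_Times_iff)
    from \<omega>_off[OF s(1) this this s(2), of "snd (\<sigma> (s, False))" "snd (\<sigma> (s, True))"]
    have "\<omega> s (?e (\<sigma> (s, False))) (?e (\<sigma> (s, True))) = 0" by simp
    then have "(\<Prod>s\<in>S. \<omega> s (?e (\<sigma> (s, False))) (?e (\<sigma> (s, True)))) = 0" using s(1) fin by (auto intro: prod_zero)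
    then show ?thesis by auto
  qed
  then have "\<forall>\<sigma>. \<exists>x. \<sigma> permutes I \<longrightarrow> x \<ge> 0 \<and> ?t \<sigma> = complex_of_real x" by blast
  from choice[OF this] obtain X where X: "\<And>\<sigma>. \<sigma> permutes I \<Longrightarrow> X \<sigma> \<ge> 0 \<and> ?t \<sigma> = complex_of_real (X \<sigma>)"
    by blast
  have id: "id permutes I" by (rule permutes_id)
  have "?t id = complex_of_real (\<Prod>s\<in>S. 2 * Re (h s (f s) (f s)))"
    using \<omega>_diag by (simp add: of_real_prod)
  then have "X id = (\<Prod>s\<in>S. 2 * Re (h s (f s) (f s)))" using X[OF id] by (metis of_real_eq_iff)
  then have Xid: "X id > 0" using pos by (auto intro!: prod_pos)
  have "W ?e = complex_of_real ((\<Sum>\<sigma> | \<sigma> permutes I. X \<sigma>) / 2 ^ card S)"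
    unfolding W_def wedge_two_forms_def I_def[symmetric] using X by simp
  moreover have "(\<Sum>\<sigma> | \<sigma> permutes I. X \<sigma>) > 0"
    using X Xid id finite_permutations[OF finI] by (intro sum_pos2[of _ id]) auto
  ultimately show ?thesis by (intro exI[of _ "(\<Sum>\<sigma> | \<sigma> permutes I. X \<sigma>) / 2 ^ card S"]) simp
qed

text \<open>The complex span of part of the frame, as a real subspace.\<close>

definition real_span :: "'s set \<Rightarrow> ('s \<Rightarrow> 'e) \<Rightarrow> 'e set" where
  "real_span T f = span (real_frame f ` (T \<times> UNIV))"

lemma real_span_mono: "T \<subseteq> T' \<Longrightarrow> real_span T f \<subseteq> real_span T' f"
  unfolding real_span_def by (intro span_mono image_mono) auto

lemma real_frame_J: "J (real_frame f (k, r)) = (if r then - f k else J (f k))"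
  by (simp add: real_frame_def JJ)

lemma real_span_J: "x \<in> real_span T f \<Longrightarrow> J x \<in> real_span T f"
  unfolding real_span_def
proof (induction rule: span_induct)
  case base
  show ?case using J_linear by (auto simp: subspace_def linear_0 linear_add linear_scale span_zero span_add span_scale)
next
  case (step x)
  then obtain k r where k: "k \<in> T" "x = real_frame f (k, r)" by auto
  have "f k \<in> span (real_frame f ` (T \<times> UNIV))"
    by (rule span_base, rule image_eqI[of _ _ "(k, False)"]) (simp_all add: real_frame_def k(1))
  moreover have "J (f k) \<in> span (real_frame f ` (T \<times> UNIV))"
    by (rule span_base, rule image_eqI[of _ _ "(k, True)"]) (simp_all add: real_frame_def k(1))
  ultimately show ?case unfolding k real_frame_J by (auto simp: span_neg)
qed

lemma real_span_base: "k \<in> T \<Longrightarrow> f k \<in> real_span T f"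
  unfolding real_span_def by (auto intro!: span_base image_eqI[of _ _ "(k, False)"] simp: real_frame_def)

lemma real_span_add: "x \<in> real_span T f \<Longrightarrow> y \<in> real_span T f \<Longrightarrow> x + y \<in> real_span T f"
  and real_span_scale: "x \<in> real_span T f \<Longrightarrow> c *\<^sub>R x \<in> real_span T f"
  and real_span_sum: "(\<And>k. k \<in> B \<Longrightarrow> g k \<in> real_span T f) \<Longrightarrow> sum g B \<in> real_span T f"
  and real_span_neg: "x \<in> real_span T f \<Longrightarrow> - x \<in> real_span T f"
  unfolding real_span_def by (auto intro: span_add span_scale span_sum span_neg)

definition "cscale \<zeta> x = Re \<zeta> *\<^sub>R x + Im \<zeta> *\<^sub>R J x"

lemma h_cscale:
  assumes "s \<in> S"
  shows "h s (cscale \<zeta> x) y = \<zeta> * h s x y"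
  unfolding cscale_def using linear_add[OF h_linear_left[OF assms]] linear_scale[OF h_linear_left[OF assms]] h_J[OF assms]
  by (simp add: complex_eq_iff)

lemma real_span_cscale: "x \<in> real_span T f \<Longrightarrow> cscale \<zeta> x \<in> real_span T f"
  unfolding cscale_def by (intro real_span_add real_span_scale real_span_J)

lemma wedge_shear_frame:
  assumes "K \<subseteq> S" "\<And>k. k \<in> K \<Longrightarrow> f' k - f k \<in> real_span (S - K) f" "\<And>k. k \<notin> K \<Longrightarrow> f' k = f k"
  shows "W (real_frame f') = W (real_frame f)"
proof (rule wedge_shear_block[of "K \<times> UNIV"])
  show "finite (K \<times> (UNIV :: bool set))" by (intro finite_cartesian_product finite_subset[OF assms(1) fin]) simp
  show "K \<times> UNIV \<subseteq> I" using assms(1) by (auto simp: I_def)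
  have "I - K \<times> UNIV = (S - K) \<times> UNIV" by (auto simp: I_def)
  moreover have "real_frame f' (k, r) - real_frame f (k, r) \<in> real_span (S - K) f" if "k \<in> K" for k r
    using assms(2)[OF that] real_span_J[OF assms(2)[OF that]] by (auto simp: real_frame_def linear_diff[OF J_linear])
  ultimately show "real_frame f' k - real_frame f k \<in> span (real_frame f ` (I - K \<times> UNIV))" if "k \<in> K \<times> UNIV" for k
    using that by (auto simp: real_span_def)
  show "real_frame f' k = real_frame f k" if "k \<notin> K \<times> UNIV" for k
    using that assms(3)[of "fst k"] by (cases k) (auto simp: real_frame_def)
qed

text \<open>Orthogonalization of one block \<open>T\<close> of the frame with respect to one of the forms. The
  positivity assumption combines definiteness of the form with linear independence of the block, so
  that none of the vectors divided by has norm zero.\<close>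

lemma gram_schmidt:
  assumes s: "s \<in> S" and T: "T \<subseteq> S"
    and pos: "\<forall>k\<in>T. \<forall>y\<in>real_span (T - {k}) f. Re (h s (f k + y) (f k + y)) > 0"
    and D: "finite D" "D \<subseteq> T"
  shows "\<exists>f'. (\<forall>k. k \<notin> D \<longrightarrow> f' k = f k) \<and> (\<forall>k\<in>D. f' k - f k \<in> real_span (D - {k}) f) \<and>
     (\<forall>k\<in>D. \<forall>l\<in>D. k \<noteq> l \<longrightarrow> h s (f' k) (f' l) = 0) \<and> W (real_frame f') = W (real_frame f)"
  using D
proof (induction D rule: finite_induct)
  case empty
  then show ?case by auto
next
  case (insert k0 D)
  then obtain f' where f': "\<And>k. k \<notin> D \<Longrightarrow> f' k = f k" "\<And>k. k \<in> D \<Longrightarrow> f' k - f k \<in> real_span (D - {k}) f"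
    "\<And>k l. k \<in> D \<Longrightarrow> l \<in> D \<Longrightarrow> k \<noteq> l \<Longrightarrow> h s (f' k) (f' l) = 0" "W (real_frame f') = W (real_frame f)"
    by (metis insert_subset)
  have norm: "h s (f' j) (f' j) \<noteq> 0" if "j \<in> D" for j
  proof -
    have "f' j - f j \<in> real_span (T - {j}) f"
      using f'(2)[OF that] real_span_mono[of "D - {j}" "T - {j}" f] insert.prems by blast
    moreover have "j \<in> T" using that insert.prems by auto
    ultimately have "Re (h s (f' j) (f' j)) > 0" using pos[rule_format, of j "f' j - f j"] by simp
    then show ?thesis by auto
  qed
  define y where "y = - (\<Sum>j\<in>D. cscale (h s (f k0) (f' j) / h s (f' j) (f' j)) (f' j))"
  define f2 where "f2 = f'(k0 := f k0 + y)"
  have f'_span: "f' j \<in> real_span D f" if "j \<in> D" for j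
  proof -
    have "f' j - f j \<in> real_span D f" using f'(2)[OF that] real_span_mono[of "D - {j}" D f] by blast
    from real_span_add[OF this real_span_base[OF that]] show ?thesis by simp
  qed
  have y_span: "y \<in> real_span D f"
    unfolding y_def by (intro real_span_neg real_span_sum real_span_cscale f'_span)
  have y_span': "y \<in> real_span (S - {k0}) f'"
  proof -
    have "y \<in> real_span D f'"
      unfolding y_def by (intro real_span_neg real_span_sum real_span_cscale real_span_base)
    moreover have "D \<subseteq> S - {k0}" using insert T by auto
    ultimately show ?thesis using real_span_mono by blast
  qed
  have orth0: "h s (f k0 + y) (f' l) = 0" if "l \<in> D" for l
  proof -
    have "h s y (f' l) = - (\<Sum>j\<in>D. h s (cscale (h s (f k0) (f' j) / h s (f' j) (f' j)) (f' j)) (f' l))"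
      unfolding y_def using linear_neg[OF h_linear_left[OF s]] linear_sum[OF h_linear_left[OF s]] by simp
    also have "\<dots> = - (\<Sum>j\<in>D. if j = l then h s (f k0) (f' l) else 0)"
      using f'(3) that norm by (intro arg_cong[of _ _ uminus] sum.cong refl) (auto simp: h_cscale[OF s])
    also have "\<dots> = - h s (f k0) (f' l)" using that insert.hyps by simp
    finally show ?thesis using linear_add[OF h_linear_left[OF s]] by simp
  qed
  have "W (real_frame f2) = W (real_frame f')"
    by (rule wedge_shear_frame[of "{k0}"]) (use insert T y_span' f'(1)[of k0] in \<open>auto simp: f2_def\<close>)
  moreover have "f2 k - f k \<in> real_span (insert k0 D - {k}) f" if "k \<in> insert k0 D" for k
  proof (cases "k = k0")
    case True
    then show ?thesis using y_span insert.hyps by (simp add: f2_def)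
  next
    case False
    then have "k \<in> D" using that by simp
    moreover have "D - {k} \<subseteq> insert k0 D - {k}" by auto
    ultimately show ?thesis using f'(2)[of k] False real_span_mono[of "D - {k}" "insert k0 D - {k}" f]
      by (auto simp: f2_def)
  qed
  moreover have "h s (f2 k) (f2 l) = 0" if kl: "k \<in> insert k0 D" "l \<in> insert k0 D" "k \<noteq> l" for k l
  proof -
    have "h s (f' k) (f k0 + y) = 0" if "k \<in> D" for k
      using orth0[OF that] h_sym[OF s, of "f' k" "f k0 + y"] by (simp only: complex_cnj_zero)
    then show ?thesis using kl orth0 f'(3) insert.hyps by (auto simp: f2_def)
  qed
  moreover have "f2 k = f k" if "k \<notin> insert k0 D" for k using that f'(1) by (auto simp: f2_def)
  ultimately show ?case using f'(4) by (intro exI[of _ f2]) auto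
qed

end

section \<open>The volume density\<close>

definition herm_form :: "complex^'n^'n \<Rightarrow> ('e \<Rightarrow> complex^'n) \<Rightarrow> 'e \<Rightarrow> 'e \<Rightarrow> complex" where
  "herm_form H \<theta> X Y = (\<Sum>\<alpha>\<in>UNIV. \<Sum>\<beta>\<in>UNIV. H $ \<alpha> $ \<beta> * \<theta> X $ \<alpha> * cnj (\<theta> Y $ \<beta>))"

lemma two_form_herm_form: "two_form H \<theta> X Y = \<i> * (herm_form H \<theta> X Y - herm_form H \<theta> Y X)"
  unfolding two_form_def herm_form_def
  by (simp add: sum_subtractf[symmetric] right_diff_distrib mult.assoc)

definition mult_i :: "(complex^'n) \<times> (complex^'n) \<Rightarrow> (complex^'n) \<times> (complex^'n)" where
  "mult_i X = (\<i> *s fst X, \<i> *s snd X)"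

lemma mult_i_linear: "linear mult_i" and mult_i_twice: "mult_i (mult_i X) = - X"
  by (auto intro!: linearI simp: mult_i_def vec_eq_iff prod_eq_iff algebra_simps)

lemma hermitian_herm_form:
  assumes H: "\<And>\<alpha> \<beta>. H $ \<beta> $ \<alpha> = cnj (H $ \<alpha> $ \<beta>)" and \<theta>: "linear \<theta>" "\<And>X. \<theta> (mult_i X) = \<i> *s \<theta> X"
  shows "hermitian mult_i (herm_form H \<theta>)"
  unfolding hermitian_def
proof (intro conjI allI)
  fix X Y
  show "linear (\<lambda>X. herm_form H \<theta> X Y)"
    by (rule linearI) (simp_all add: herm_form_def linear_add[OF \<theta>(1)] linear_scale[OF \<theta>(1)]
        algebra_simps sum.distrib scaleR_sum_right)
  show "herm_form H \<theta> (mult_i X) Y = \<i> * herm_form H \<theta> X Y"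
    by (simp add: herm_form_def \<theta>(2) sum_distrib_left mult_ac)
  have "cnj (herm_form H \<theta> X Y) = (\<Sum>\<alpha>\<in>UNIV. \<Sum>\<beta>\<in>UNIV. H $ \<beta> $ \<alpha> * cnj (\<theta> X $ \<alpha>) * \<theta> Y $ \<beta>)"
    unfolding herm_form_def cnj_sum complex_cnj_mult H[symmetric] complex_cnj_cnj ..
  also have "\<dots> = herm_form H \<theta> Y X"
    unfolding herm_form_def by (subst sum.swap) (simp add: mult_ac)
  finally show "herm_form H \<theta> Y X = cnj (herm_form H \<theta> X Y)" ..
qed

lemma herm_form_kernel:
  assumes k1: "\<And>\<beta>. (\<Sum>\<alpha>\<in>UNIV. v $ \<alpha> * L $ \<alpha> $ \<beta>) = 0"
    and k2: "\<And>\<alpha>. (\<Sum>\<beta>\<in>UNIV. L $ \<alpha> $ \<beta> * cnj (v $ \<beta>)) = 0"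
  shows "(\<Sum>\<alpha>\<in>UNIV. \<Sum>\<beta>\<in>UNIV. L $ \<alpha> $ \<beta> * (p $ \<alpha> + s * v $ \<alpha>) * cnj (q $ \<beta> + t * v $ \<beta>)) =
     (\<Sum>\<alpha>\<in>UNIV. \<Sum>\<beta>\<in>UNIV. L $ \<alpha> $ \<beta> * p $ \<alpha> * cnj (q $ \<beta>))"
proof -
  have "(\<Sum>\<alpha>\<in>UNIV. \<Sum>\<beta>\<in>UNIV. L $ \<alpha> $ \<beta> * (p $ \<alpha> + s * v $ \<alpha>) * cnj (q $ \<beta> + t * v $ \<beta>)) =
     (\<Sum>\<alpha>\<in>UNIV. \<Sum>\<beta>\<in>UNIV. L $ \<alpha> $ \<beta> * p $ \<alpha> * cnj (q $ \<beta>)) +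
     (\<Sum>\<alpha>\<in>UNIV. (p $ \<alpha> + s * v $ \<alpha>) * cnj t * (\<Sum>\<beta>\<in>UNIV. L $ \<alpha> $ \<beta> * cnj (v $ \<beta>))) +
     (\<Sum>\<beta>\<in>UNIV. s * cnj (q $ \<beta>) * (\<Sum>\<alpha>\<in>UNIV. v $ \<alpha> * L $ \<alpha> $ \<beta>))"
  proof -
    have "(\<Sum>\<beta>\<in>UNIV. s * cnj (q $ \<beta>) * (\<Sum>\<alpha>\<in>UNIV. v $ \<alpha> * L $ \<alpha> $ \<beta>)) =
       (\<Sum>\<alpha>\<in>UNIV. \<Sum>\<beta>\<in>UNIV. s * cnj (q $ \<beta>) * (v $ \<alpha> * L $ \<alpha> $ \<beta>))"
      unfolding sum_distrib_left by (rule sum.swap)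
    moreover have "(\<Sum>\<alpha>\<in>UNIV. (p $ \<alpha> + s * v $ \<alpha>) * cnj t * (\<Sum>\<beta>\<in>UNIV. L $ \<alpha> $ \<beta> * cnj (v $ \<beta>))) =
       (\<Sum>\<alpha>\<in>UNIV. \<Sum>\<beta>\<in>UNIV. (p $ \<alpha> + s * v $ \<alpha>) * cnj t * (L $ \<alpha> $ \<beta> * cnj (v $ \<beta>)))"
      by (simp only: sum_distrib_left)
    moreover have "L $ \<alpha> $ \<beta> * (p $ \<alpha> + s * v $ \<alpha>) * cnj (q $ \<beta> + t * v $ \<beta>) =
        L $ \<alpha> $ \<beta> * p $ \<alpha> * cnj (q $ \<beta>) + (p $ \<alpha> + s * v $ \<alpha>) * cnj t * (L $ \<alpha> $ \<beta> * cnj (v $ \<beta>))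
        + s * cnj (q $ \<beta>) * (v $ \<alpha> * L $ \<alpha> $ \<beta>)" for \<alpha> \<beta>
      by (simp add: algebra_simps)
    ultimately show ?thesis by (simp only: sum.distrib)
  qed
  then show ?thesis by (simp add: k1 k2)
qed

lemma wedge_scale:
  "wedge_two_forms S (\<lambda>s x y. k s * \<omega> s x y) e = (\<Prod>s\<in>S. k s) * wedge_two_forms S \<omega> e"
  unfolding wedge_two_forms_def by (simp add: prod.distrib sum_distrib_left mult_ac)

context finsler_chart
begin

text \<open>The real logarithm agrees with the complex one at positive numbers, to which the holomorphic chain
  rule applies.\<close>

lemma logG_mat_eq:
  assumes x: "x \<in> N"
  shows "logG_mat A F c x $ \<alpha> $ \<beta> = Gmat A F c x $ \<alpha> $ \<beta> / Gc A F c x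
      - d_v \<alpha> (Gc A F c) x * d_vbar \<beta> (Gc A F c) x / (Gc A F c x)\<^sup>2"
proof -
  have 1: "\<forall>y\<in>N. complex_of_real (ln (G_loc A F c y)) = Ln (Gc A F c y)"
    using G_loc_pos by (simp add: Gc_def Ln_of_real)
  have 2: "\<forall>y\<in>N. d_vbar \<beta> (\<lambda>y. complex_of_real (ln (G_loc A F c y))) y = inverse (Gc A F c y) * d_vbar \<beta> (Gc A F c) y"
  proof
    fix y assume y: "y \<in> N"
    have "Gc A F c y \<notin> \<real>\<^sub>\<le>\<^sub>0" using G_loc_pos[OF y] by (simp add: Gc_def)
    then show "d_vbar \<beta> (\<lambda>y. complex_of_real (ln (G_loc A F c y))) y = inverse (Gc A F c y) * d_vbar \<beta> (Gc A F c) y"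
      using N_cong(4)[OF 1 y] d_chain(4)[OF N_diff[OF G_smooth y] has_field_derivative_Ln] by simp
  qed
  have s1: "smooth_on N (\<lambda>y. inverse (Gc A F c y))" by (intro smooth_on_inverse N_open G_smooth G_nonzero)
  have "logG_mat A F c x $ \<alpha> $ \<beta> = d_v \<alpha> (\<lambda>y. inverse (Gc A F c y) * d_vbar \<beta> (Gc A F c) y) x"
    unfolding logG_mat_def using N_cong(3)[OF 2 x] by simp
  also have "\<dots> = d_v \<alpha> (\<lambda>y. inverse (Gc A F c y)) x * d_vbar \<beta> (Gc A F c) x + inverse (Gc A F c x) * Gmat A F c x $ \<alpha> $ \<beta>"
    using d_mult(3)[OF N_diff[OF s1 x] N_diff[OF N_smooth(4)[OF G_smooth] x]] by (simp add: Gmat_def)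
  also have "d_v \<alpha> (\<lambda>y. inverse (Gc A F c y)) x = - (inverse (Gc A F c x) ^ 2) * d_v \<alpha> (Gc A F c) x"
    using d_chain(3)[OF N_diff[OF G_smooth x] DERIV_inverse[OF G_nonzero[OF x]]] by (simp add: numeral_2_eq_2)
  finally show ?thesis by (simp add: field_simps)
qed

lemma Gv_cnj:
  assumes x: "x \<in> N"
  shows "d_v \<alpha> (Gc A F c) x = cnj (d_vbar \<alpha> (Gc A F c) x)"
  unfolding d_v_def d_vbar_def Gc_def[abs_def]
  by (rule wirtinger_of_real[OF smooth_on_differentiable[OF G_loc_smooth x]])

lemma logG_mat_herm:
  assumes x: "x \<in> N"
  shows "logG_mat A F c x $ \<beta> $ \<alpha> = cnj (logG_mat A F c x $ \<alpha> $ \<beta>)"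
  unfolding logG_mat_eq[OF x] Gv_cnj[OF x] by (simp add: Gmat_herm[OF x, of \<beta> \<alpha>] Gc_def mult.commute)

text \<open>The function \<open>ln G\<close> is, up to an additive constant, invariant under scaling, so the form degenerates
  in the direction \<open>v\<close>. This is why its wedge power lives on the projectivized bundle.\<close>

lemma logG_mat_kernel:
  assumes x: "x \<in> N"
  shows "(\<Sum>\<alpha>\<in>UNIV. snd x $ \<alpha> * logG_mat A F c x $ \<alpha> $ \<beta>) = 0"
    and "(\<Sum>\<beta>\<in>UNIV. logG_mat A F c x $ \<alpha> $ \<beta> * cnj (snd x $ \<beta>)) = 0"
proof -
  show k: "(\<Sum>\<alpha>\<in>UNIV. snd x $ \<alpha> * logG_mat A F c x $ \<alpha> $ \<beta>) = 0" for \<beta>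
  proof -
    have "(\<Sum>\<alpha>\<in>UNIV. snd x $ \<alpha> * logG_mat A F c x $ \<alpha> $ \<beta>) =
       (\<Sum>\<alpha>\<in>UNIV. snd x $ \<alpha> * Gmat A F c x $ \<alpha> $ \<beta>) / Gc A F c x -
       (\<Sum>\<alpha>\<in>UNIV. snd x $ \<alpha> * d_v \<alpha> (Gc A F c) x) * d_vbar \<beta> (Gc A F c) x / (Gc A F c x)\<^sup>2"
      unfolding logG_mat_eq[OF x]
      by (simp add: right_diff_distrib sum_subtractf sum_divide_distrib sum_distrib_right mult.assoc)
    also have "\<dots> = 0"
      unfolding euler_Gvbar[OF x] euler_G[OF x] using G_nonzero[OF x] by (simp add: power2_eq_square)
    finally show ?thesis .
  qed
  have "(\<Sum>\<beta>\<in>UNIV. logG_mat A F c x $ \<alpha> $ \<beta> * cnj (snd x $ \<beta>)) =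
      cnj (\<Sum>\<beta>\<in>UNIV. snd x $ \<beta> * logG_mat A F c x $ \<beta> $ \<alpha>)"
    unfolding cnj_sum complex_cnj_mult logG_mat_herm[OF x, symmetric] by (simp add: mult.commute)
  then show "(\<Sum>\<beta>\<in>UNIV. logG_mat A F c x $ \<alpha> $ \<beta> * cnj (snd x $ \<beta>)) = 0" by (simp add: k)
qed

text \<open>Strict Cauchy-Schwarz inequality: modulo the kernel direction \<open>v\<close> one may replace \<open>u\<close> by its
  component \<open>w\<close> orthogonal to \<open>v\<close>, on which the form is \<open>Gmat\<close> divided by \<open>G\<close>. The condition
  \<open>u $ a = 0\<close> ensures that \<open>u\<close> is not a multiple of \<open>v\<close>.\<close>

lemma logG_mat_pos:
  assumes x: "x \<in> N" and u: "u \<noteq> 0" "u $ a = 0" and a: "snd x $ a = 1"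
  shows "Re (\<Sum>\<alpha>\<in>UNIV. \<Sum>\<beta>\<in>UNIV. logG_mat A F c x $ \<alpha> $ \<beta> * u $ \<alpha> * cnj (u $ \<beta>)) > 0"
proof -
  define s where "s = (\<Sum>\<alpha>\<in>UNIV. u $ \<alpha> * d_v \<alpha> (Gc A F c) x) / Gc A F c x"
  define w where "w = (\<chi> \<alpha>. u $ \<alpha> + (- s) * snd x $ \<alpha>)"
  have w: "w \<noteq> 0"
  proof (cases "s = 0")
    case True
    then have "w = u" by (simp add: w_def vec_eq_iff)
    then show ?thesis using u by simp
  next
    case False
    then have "w $ a \<noteq> 0" using u(2) a by (simp add: w_def)
    then show ?thesis by auto
  qed
  have w0: "(\<Sum>\<alpha>\<in>UNIV. w $ \<alpha> * d_v \<alpha> (Gc A F c) x) = 0"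
  proof -
    have "(\<Sum>\<alpha>\<in>UNIV. w $ \<alpha> * d_v \<alpha> (Gc A F c) x) = (\<Sum>\<alpha>\<in>UNIV. u $ \<alpha> * d_v \<alpha> (Gc A F c) x)
       - s * (\<Sum>\<alpha>\<in>UNIV. snd x $ \<alpha> * d_v \<alpha> (Gc A F c) x)"
      by (simp add: w_def left_diff_distrib sum_subtractf sum_distrib_left mult.assoc)
    also have "\<dots> = 0" unfolding euler_G[OF x] s_def using G_nonzero[OF x] by simp
    finally show ?thesis .
  qed
  have "(\<Sum>\<alpha>\<in>UNIV. \<Sum>\<beta>\<in>UNIV. logG_mat A F c x $ \<alpha> $ \<beta> * u $ \<alpha> * cnj (u $ \<beta>)) =
      (\<Sum>\<alpha>\<in>UNIV. \<Sum>\<beta>\<in>UNIV. logG_mat A F c x $ \<alpha> $ \<beta> * w $ \<alpha> * cnj (w $ \<beta>))"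
    unfolding w_def vec_lambda_beta
    by (rule herm_form_kernel[symmetric]) (rule logG_mat_kernel[OF x])+
  also have "\<dots> = (\<Sum>\<alpha>\<in>UNIV. \<Sum>\<beta>\<in>UNIV. Gmat A F c x $ \<alpha> $ \<beta> * w $ \<alpha> * cnj (w $ \<beta>)) / Gc A F c x -
      (\<Sum>\<alpha>\<in>UNIV. w $ \<alpha> * d_v \<alpha> (Gc A F c) x) * (\<Sum>\<beta>\<in>UNIV. d_vbar \<beta> (Gc A F c) x * cnj (w $ \<beta>)) / (Gc A F c x)\<^sup>2"
  proof -
    have "logG_mat A F c x $ \<alpha> $ \<beta> * w $ \<alpha> * cnj (w $ \<beta>) = Gmat A F c x $ \<alpha> $ \<beta> * w $ \<alpha> * cnj (w $ \<beta>) / Gc A F c x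
       - (w $ \<alpha> * d_v \<alpha> (Gc A F c) x) * (d_vbar \<beta> (Gc A F c) x * cnj (w $ \<beta>)) / (Gc A F c x)\<^sup>2" for \<alpha> \<beta>
      unfolding logG_mat_eq[OF x] by (simp add: algebra_simps divide_inverse)
    then show ?thesis by (simp only: sum_subtractf sum_divide_distrib sum_product)
  qed
  also have "\<dots> = (\<Sum>\<alpha>\<in>UNIV. \<Sum>\<beta>\<in>UNIV. Gmat A F c x $ \<alpha> $ \<beta> * w $ \<alpha> * cnj (w $ \<beta>)) / complex_of_real (G_loc A F c x)"
    unfolding w0 by (simp add: Gc_def)
  finally have eq: "(\<Sum>\<alpha>\<in>UNIV. \<Sum>\<beta>\<in>UNIV. logG_mat A F c x $ \<alpha> $ \<beta> * u $ \<alpha> * cnj (u $ \<beta>)) =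
    (\<Sum>\<alpha>\<in>UNIV. \<Sum>\<beta>\<in>UNIV. Gmat A F c x $ \<alpha> $ \<beta> * w $ \<alpha> * cnj (w $ \<beta>)) / complex_of_real (G_loc A F c x)" .
  have "Re (\<Sum>\<alpha>\<in>UNIV. \<Sum>\<beta>\<in>UNIV. Gmat A F c x $ \<alpha> $ \<beta> * w $ \<alpha> * cnj (w $ \<beta>)) > 0"
    using Gmat_pos[OF x] w unfolding positive_definite_def by blast
  then show ?thesis unfolding eq Re_divide_of_real using G_loc_pos[OF x] by (rule divide_pos_pos)
qed

lemma logG_mat_smooth: "smooth_on N (\<lambda>x. logG_mat A F c x $ \<alpha> $ \<beta>)"
proof (subst smooth_on_cong[OF N_open logG_mat_eq])
  show "smooth_on N (\<lambda>x. Gmat A F c x $ \<alpha> $ \<beta> / Gc A F c x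
      - d_v \<alpha> (Gc A F c) x * d_vbar \<beta> (Gc A F c) x / (Gc A F c x)\<^sup>2)"
    unfolding power2_eq_square
    by (intro smooth_on_diff smooth_on_divide smooth_on_mult N_smooth G_smooth Gmat_smooth N_open)
      (simp_all add: G_nonzero)
qed

lemma delta_v_linear: "linear (delta_v A F c x)"
  by (rule linearI) (simp_all add: delta_v_def vec_eq_iff algebra_simps sum.distrib scaleR_sum_right)

lemma delta_v_mult_i: "delta_v A F c x (mult_i X) = \<i> *s delta_v A F c x X"
  by (simp add: delta_v_def vec_eq_iff mult_i_def algebra_simps sum_distrib_left)

lemma vol_density_continuous: "continuous_on N (vol_density A F c a)"
proof -
  have H: "continuous_on N (\<lambda>x. omega_H_form A F c x X Y)" for X Y
    unfolding omega_H_form_def two_form_def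
    by (intro continuous_intros smooth_on_continuous[OF Gmat_smooth])
  have V: "continuous_on N (\<lambda>x. omega_V_form A F c x X Y)" for X Y
    unfolding omega_V_form_def two_form_def delta_v_def vec_lambda_beta
    by (intro continuous_intros smooth_on_continuous[OF logG_mat_smooth] smooth_on_continuous[OF Gamma_smooth])
  have "continuous_on N (\<lambda>x. (case s of Inl _ \<Rightarrow> omega_H_form A F c x | Inr _ \<Rightarrow> omega_V_form A F c x) X Y)"
    for s :: "'n + 'n" and X Y by (cases s) (simp_all add: H V)
  then show ?thesis
    unfolding vol_density_def[abs_def] wedge_two_forms_def by (intro continuous_intros) auto
qed

text \<open>The coordinate frame is brought into orthogonal position in three steps of shears. First the
  horizontal vectors are sheared by vertical ones until their image under \<open>delta_v\<close> is a multiple of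
  \<open>v\<close>, on which the vertical form vanishes; the multiple has to be allowed because the \<open>a\<close>-th
  fibre direction does not belong to the affine chart. Then the horizontal block is
  orthogonalized for the horizontal form and the vertical block for the vertical form.\<close>

lemma vol_density_pos:
  assumes x: "x \<in> N" and a: "snd x $ a = 1" and card: "CARD('n) \<ge> 2"
  shows "\<exists>r>0. vol_density A F c a x = complex_of_real r"
proof -
  define S where "S = (UNIV :: 'n set) <+> (UNIV - {a})"
  define h where "h = (case_sum (\<lambda>_. herm_form (Gmat A F c x) fst)
     (\<lambda>_. herm_form (logG_mat A F c x) (delta_v A F c x)) :: 'n + 'n \<Rightarrow> _)"
  interpret hermitian_wedge S mult_i h
  proof (rule hermitian_wedge.intro)
    show "finite S" by (simp add: S_def)
    show "linear (mult_i :: (complex^'n) \<times> (complex^'n) \<Rightarrow> _)" by (rule mult_i_linear)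
    show "mult_i (mult_i X) = - X" for X :: "(complex^'n) \<times> (complex^'n)" by (rule mult_i_twice)
    have 1: "hermitian mult_i (herm_form (Gmat A F c x) fst)"
      by (rule hermitian_herm_form[OF Gmat_herm[OF x]]) (auto intro: linearI simp: mult_i_def)
    have 2: "hermitian mult_i (herm_form (logG_mat A F c x) (delta_v A F c x))"
      by (rule hermitian_herm_form[OF logG_mat_herm[OF x] delta_v_linear delta_v_mult_i])
    show "hermitian mult_i (h s)" for s using 1 2 by (cases s) (simp_all add: h_def)
  qed
  define f where "f = (case_sum (\<lambda>\<alpha>. (axis \<alpha> 1, 0)) (\<lambda>b. (0, axis b 1)) :: 'n + 'n \<Rightarrow> (complex^'n) \<times> (complex^'n))"
  have ax: "\<i> *s axis k (1::complex) = axis k \<i>" for k :: 'n by (simp add: vec_eq_iff axis_def)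
  have z: "\<i> *s (0 :: complex^'n) = 0" by (simp add: vec_eq_iff)
  have frame: "frame = real_frame f"
  proof (rule ext)
    fix i :: "('n + 'n) \<times> bool"
    show "frame i = real_frame f i"
      by (cases i rule: frame.cases) (auto simp: real_frame_def f_def mult_i_def ax z)
  qed
  have om: "case_sum (\<lambda>_. omega_H_form A F c x) (\<lambda>_. omega_V_form A F c x) = \<omega>"
    by (intro ext, unfold \<omega>_def) (auto simp: h_def omega_H_form_def omega_V_form_def two_form_herm_form split: sum.split)
  \<comment> \<open>The horizontal lift, corrected by a multiple of \<open>v\<close> to have no \<open>a\<close>-th component.\<close>
  define y where "y \<alpha> = (\<chi> \<gamma>. Gamma A F c a \<alpha> x * snd x $ \<gamma> - Gamma A F c \<gamma> \<alpha> x)" for \<alpha>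
  define f1 where "f1 = (case_sum (\<lambda>\<alpha>. (axis \<alpha> 1, y \<alpha>)) (\<lambda>b. (0, axis b 1)) :: 'n + 'n \<Rightarrow> (complex^'n) \<times> (complex^'n))"
  let ?L = "range (Inl :: 'n \<Rightarrow> 'n + 'n)" and ?R = "(Inr :: 'n \<Rightarrow> 'n + 'n) ` (UNIV - {a})"
  have LR: "?L \<subseteq> S" "?R \<subseteq> S" "S - ?L = ?R" by (auto simp: S_def)
  have y_span: "(0, w) \<in> real_span ?R f" if w: "w $ a = 0" for w
  proof -
    have eq: "(0, w) = (\<Sum>b\<in>UNIV - {a}. cscale (w $ b) (f (Inr b)))"
    proof (rule prod_eqI)
      show "fst (0, w) = fst (\<Sum>b\<in>UNIV - {a}. cscale (w $ b) (f (Inr b)))"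
        by (simp add: fst_sum cscale_def f_def mult_i_def z)
      have "snd (cscale (w $ b) (f (Inr b))) = axis b (w $ b)" for b
        by (simp add: cscale_def f_def mult_i_def ax vec_eq_iff axis_def complex_eq_iff)
      then have "snd (\<Sum>b\<in>UNIV - {a}. cscale (w $ b) (f (Inr b))) $ k = (\<Sum>b\<in>UNIV - {a}. if b = k then w $ k else 0)" for k
        by (auto simp: snd_sum axis_def intro!: sum.cong)
      then show "snd (0, w) = snd (\<Sum>b\<in>UNIV - {a}. cscale (w $ b) (f (Inr b)))"
        using w by (auto simp: vec_eq_iff)
    qed
    show ?thesis
      unfolding eq by (intro real_span_sum real_span_cscale real_span_base) auto
  qed
  have W1: "W (real_frame f1) = W (real_frame f)"
  proof (rule wedge_shear_frame[OF LR(1)])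
    fix k assume "k \<in> ?L"
    then obtain \<alpha> where k: "k = Inl \<alpha>" by auto
    have "y \<alpha> $ a = 0" using a by (simp add: y_def)
    moreover have "f1 k - f k = (0, y \<alpha>)" by (simp add: k f1_def f_def)
    ultimately show "f1 k - f k \<in> real_span (S - ?L) f" unfolding LR(3) by (simp only: y_span)
  next
    fix k assume "k \<notin> ?L"
    then show "f1 k = f k" by (cases k) (auto simp: f1_def f_def)
  qed
  \<comment> \<open>The vertical block is not empty as the dimension is at least two.\<close>
  obtain b0 where b0: "b0 \<noteq> a"
  proof -
    have "\<not> (UNIV :: 'n set) \<subseteq> {a}" using card_mono[of "{a}" "UNIV :: 'n set"] card by auto
    then show ?thesis using that by auto
  qed
  have inS: "Inl a \<in> S" "Inr b0 \<in> S" using b0 by (auto simp: S_def)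
  have sub: "X \<in> {X. P X}" if "X \<in> real_span T g" "subspace {X. P X}" "\<And>k. k \<in> T \<Longrightarrow> P (g k) \<and> P (mult_i (g k))" for X T g and P
  proof -
    have "real_frame g ` (T \<times> UNIV) \<subseteq> {X. P X}" using that(3) by (auto simp: real_frame_def)
    then show ?thesis using span_minimal[OF _ that(2)] that(1) unfolding real_span_def by blast
  qed
  have posL: "Re (h (Inl a) (f1 k + w) (f1 k + w)) > 0" if k: "k \<in> ?L" and w: "w \<in> real_span (?L - {k}) f1" for k w
  proof -
    obtain \<alpha> where \<alpha>: "k = Inl \<alpha>" using k by auto
    have "w \<in> {X. fst X $ \<alpha> = 0}"
      by (rule sub[OF w]) (auto simp: subspace_def f1_def \<alpha> mult_i_def axis_def split: if_splits)
    then have "fst (f1 k + w) $ \<alpha> = 1" by (simp add: \<alpha> f1_def)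
    then have "fst (f1 k + w) \<noteq> 0" by (metis zero_index zero_neq_one)
    from Gmat_pos[OF x, unfolded positive_definite_def, THEN conjunct2, rule_format, OF this]
    show ?thesis by (simp only: h_def sum.case herm_form_def)
  qed
  then have posL': "\<forall>k\<in>?L. \<forall>w\<in>real_span (?L - {k}) f1. Re (h (Inl a) (f1 k + w) (f1 k + w)) > 0" by blast
  obtain f2 where f2': "\<forall>k. k \<notin> ?L \<longrightarrow> f2 k = f1 k" "\<forall>k\<in>?L. f2 k - f1 k \<in> real_span (?L - {k}) f1"
    "\<forall>k\<in>?L. \<forall>l\<in>?L. k \<noteq> l \<longrightarrow> h (Inl a) (f2 k) (f2 l) = 0" "W (real_frame f2) = W (real_frame f1)"
    using gram_schmidt[OF inS(1) LR(1) posL' finite_subset[OF LR(1) fin] order.refl]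
    by (elim exE conjE) (rule that)
  note f2 = f2'(1)[rule_format] f2'(2)[rule_format] f2'(3)[rule_format] f2'(4)
  have f2R: "f2 (Inr b) = (0, axis b 1)" for b using f2(1)[of "Inr b"] by (auto simp: f1_def)
  have posR: "Re (h (Inr b0) (f2 k + w) (f2 k + w)) > 0" if k: "k \<in> ?R" and w: "w \<in> real_span (?R - {k}) f2" for k w
  proof -
    obtain b where b: "k = Inr b" "b \<noteq> a" using k by auto
    have "w \<in> {X. fst X = 0 \<and> snd X $ b = 0 \<and> snd X $ a = 0}"
      by (rule sub[OF w]) (auto simp: subspace_def f2R b mult_i_def axis_def vec_eq_iff split: if_splits)
    then have w': "fst (f2 k + w) = 0" "snd (f2 k + w) $ b = 1" "snd (f2 k + w) $ a = 0"
      using b by (auto simp: f2R axis_def)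
    have dv: "delta_v A F c x (f2 k + w) = snd (f2 k + w)" unfolding delta_v_def vec_eq_iff using w'(1) by simp
    have "snd (f2 k + w) \<noteq> 0" using w'(2) by (metis zero_index zero_neq_one)
    from logG_mat_pos[OF x this w'(3) a] show ?thesis by (simp only: h_def sum.case herm_form_def dv)
  qed
  then have posR': "\<forall>k\<in>?R. \<forall>w\<in>real_span (?R - {k}) f2. Re (h (Inr b0) (f2 k + w) (f2 k + w)) > 0" by blast
  obtain f3 where f3': "\<forall>k. k \<notin> ?R \<longrightarrow> f3 k = f2 k" "\<forall>k\<in>?R. f3 k - f2 k \<in> real_span (?R - {k}) f2"
    "\<forall>k\<in>?R. \<forall>l\<in>?R. k \<noteq> l \<longrightarrow> h (Inr b0) (f3 k) (f3 l) = 0" "W (real_frame f3) = W (real_frame f2)"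
    using gram_schmidt[OF inS(2) LR(2) posR' finite_subset[OF LR(2) fin] order.refl]
    by (elim exE conjE) (rule that)
  note f3 = f3'(1)[rule_format] f3'(2)[rule_format] f3'(3)[rule_format] f3'(4)
  have f3L: "f3 (Inl \<alpha>) = f2 (Inl \<alpha>)" for \<alpha> using f3(1)[of "Inl \<alpha>"] by auto
  have dvL: "\<exists>\<zeta>. delta_v A F c x (f3 (Inl \<alpha>)) = \<zeta> *s snd x" for \<alpha>
  proof -
    have sp: "subspace {X. \<exists>\<zeta>. delta_v A F c x X = \<zeta> *s snd x}"
      unfolding subspace_def
    proof (safe)
      show "\<exists>\<zeta>. delta_v A F c x 0 = \<zeta> *s snd x"
        by (rule exI[of _ 0]) (simp add: linear_0[OF delta_v_linear])
    next
      fix X Y \<zeta> \<xi> assume "delta_v A F c x X = \<zeta> *s snd x" "delta_v A F c x Y = \<xi> *s snd x"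
      then show "\<exists>\<zeta>. delta_v A F c x (X + Y) = \<zeta> *s snd x"
        by (intro exI[of _ "\<zeta> + \<xi>"]) (simp add: linear_add[OF delta_v_linear] vec_eq_iff distrib_right)
    next
      fix X \<zeta> and q :: real assume "delta_v A F c x X = \<zeta> *s snd x"
      then show "\<exists>\<zeta>. delta_v A F c x (q *\<^sub>R X) = \<zeta> *s snd x"
        by (intro exI[of _ "complex_of_real q * \<zeta>"])
          (simp add: linear_scale[OF delta_v_linear] vec_eq_iff, simp add: scaleR_conv_of_real)
    qed
    have base: "delta_v A F c x (f1 (Inl \<beta>)) = Gamma A F c a \<beta> x *s snd x" for \<beta>
      by (simp add: delta_v_def f1_def y_def vec_eq_iff axis_def if_distrib[of "\<lambda>t. _ * t"] cong: if_cong)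
    have "f2 (Inl \<alpha>) - f1 (Inl \<alpha>) \<in> real_span ?L f1"
      using f2(2)[of "Inl \<alpha>"] real_span_mono[of "?L - {Inl \<alpha>}" ?L f1] by blast
    then have "(f2 (Inl \<alpha>) - f1 (Inl \<alpha>)) + f1 (Inl \<alpha>) \<in> real_span ?L f1"
      by (intro real_span_add real_span_base) auto
    then have "f2 (Inl \<alpha>) \<in> real_span ?L f1" by simp
    then have "f2 (Inl \<alpha>) \<in> {X. \<exists>\<zeta>. delta_v A F c x X = \<zeta> *s snd x}"
    proof (rule sub[OF _ sp])
      fix k assume "k \<in> ?L"
      then obtain \<beta> where "k = Inl \<beta>" by auto
      then show "(\<exists>\<zeta>. delta_v A F c x (f1 k) = \<zeta> *s snd x) \<and> (\<exists>\<zeta>. delta_v A F c x (mult_i (f1 k)) = \<zeta> *s snd x)"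
        unfolding delta_v_mult_i using base[of \<beta>] vector_smult_assoc by metis
    qed
    then show ?thesis by (simp add: f3L)
  qed
  have fstR: "fst (f3 (Inr b)) = 0" if "b \<noteq> a" for b
  proof -
    have "f3 (Inr b) - f2 (Inr b) \<in> {X. fst X = 0}"
      by (rule sub[OF f3(2)]) (use that in \<open>auto simp: subspace_def f2R mult_i_def vec_eq_iff\<close>)
    then show ?thesis by (simp add: f2R)
  qed
  have hL: "h (Inl \<alpha>) = h (Inl a)" "h (Inr b) = h (Inr b0)" for \<alpha> b by (simp_all add: h_def)
  have hLR: "h (Inl \<alpha>) X Y = 0" if "fst X = 0 \<or> fst Y = 0" for \<alpha> X Y
    using that by (auto simp: h_def herm_form_def)
  have hRL: "h (Inr b) X Y = 0" if ker: "\<exists>\<zeta>. delta_v A F c x X = \<zeta> *s snd x \<or> delta_v A F c x Y = \<zeta> *s snd x" for b X Y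
  proof -
    obtain \<zeta> where "delta_v A F c x X = \<zeta> *s snd x \<or> delta_v A F c x Y = \<zeta> *s snd x" using ker by blast
    then show ?thesis
    proof
      assume e: "delta_v A F c x X = \<zeta> *s snd x"
      show ?thesis
        using herm_form_kernel[OF logG_mat_kernel[OF x], of 0 \<zeta> "delta_v A F c x Y" 0]
        by (simp add: h_def herm_form_def e)
    next
      assume e: "delta_v A F c x Y = \<zeta> *s snd x"
      show ?thesis
        using herm_form_kernel[OF logG_mat_kernel[OF x], of "delta_v A F c x X" 0 0 \<zeta>]
        by (simp add: h_def herm_form_def e)
    qed
  qed
  have diagL: "Re (h (Inl \<alpha>) (f3 (Inl \<beta>)) (f3 (Inl \<beta>))) > 0" for \<alpha> \<beta>
    using posL[of "Inl \<beta>" "f2 (Inl \<beta>) - f1 (Inl \<beta>)"] f2(2)[of "Inl \<beta>"] by (simp add: f3L hL(1)[of \<alpha>])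
  have diagR: "Re (h (Inr b) (f3 (Inr b')) (f3 (Inr b'))) > 0" if "b' \<noteq> a" for b b'
    using posR[of "Inr b'" "f3 (Inr b') - f2 (Inr b')"] f3(2)[of "Inr b'"] that by (simp add: hL(2)[of b])
  have "\<exists>r>0. W (real_frame f3) = complex_of_real r"
  proof (rule wedge_diagonal_pos)
    fix s k l assume skl: "s \<in> S" "k \<in> S" "l \<in> S" "k \<noteq> l"
    show "h s (f3 k) (f3 l) = 0"
    proof (cases s)
      case s: (Inl \<alpha>)
      show ?thesis
      proof (cases "k \<in> ?L \<and> l \<in> ?L")
        case True
        then have "f3 k = f2 k" "f3 l = f2 l" using f3(1) by auto
        then show ?thesis using True f2(3) skl(4) by (simp add: s hL(1)[of \<alpha>])
      next
        case False
        then have "fst (f3 k) = 0 \<or> fst (f3 l) = 0" using skl fstR unfolding S_def by auto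
        then show ?thesis unfolding s by (rule hLR)
      qed
    next
      case s: (Inr b)
      show ?thesis
      proof (cases "k \<in> ?R \<and> l \<in> ?R")
        case True
        then show ?thesis using f3(3) skl(4) by (simp add: s hL(2)[of b])
      next
        case False
        then have "\<exists>\<zeta>. delta_v A F c x (f3 k) = \<zeta> *s snd x \<or> delta_v A F c x (f3 l) = \<zeta> *s snd x"
          using skl dvL unfolding S_def by auto
        then show ?thesis unfolding s by (rule hRL)
      qed
    qed
  next
    fix s k assume sk: "s \<in> S" "k \<in> S"
    show "0 \<le> Re (h s (f3 k) (f3 k))"
    proof (cases s; cases k)
      fix \<alpha> \<beta> assume "s = Inl \<alpha>" "k = Inl \<beta>"
      then show ?thesis using diagL[of \<alpha> \<beta>] by simp
    next
      fix \<alpha> b assume k: "s = Inl \<alpha>" "k = Inr b"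
      then have "b \<noteq> a" using sk by (auto simp: S_def)
      then show ?thesis using hLR[of "f3 k" "f3 k" \<alpha>] fstR[of b] k by simp
    next
      fix b \<alpha> assume "s = Inr b" "k = Inl \<alpha>"
      then show ?thesis using hRL[of "f3 k" "f3 k" b] dvL[of \<alpha>] by auto
    next
      fix b b' assume k: "s = Inr b" "k = Inr b'"
      then have "b' \<noteq> a" using sk by (auto simp: S_def)
      then show ?thesis using diagR[of b' b] k by simp
    qed
  next
    fix s assume "s \<in> S"
    then show "0 < Re (h s (f3 s) (f3 s))" using diagL diagR by (cases s) (auto simp: S_def)
  qed
  then obtain r where r: "r > 0" "W (real_frame f) = complex_of_real r"
    using W1 f2(4) f3(4) by auto
  have "vol_density A F c a x = complex_of_real (r / (fact (CARD('n) - 1) * fact CARD('n)))"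
    unfolding vol_density_def om frame S_def[symmetric] W_def[symmetric] r(2) by simp
  then show ?thesis using r(1) by (intro exI[of _ "r / (fact (CARD('n) - 1) * fact CARD('n))"]) simp
qed

end

context conformal_chart
begin

lemma logG_mat_conformal:
  assumes x: "x \<in> N" and F': "finsler_chart A F' c"
  shows "logG_mat A F' c x = logG_mat A F c x"
  unfolding vec_eq_iff finsler_chart.logG_mat_eq[OF F' x] logG_mat_eq[OF x] Gmat_conformal[OF x] Gc_conformal[OF x] Gv_conformal[OF x] Gvbar_conformal[OF x]
  by (simp add: field_simps power2_eq_square)

lemma delta_v_conformal:
  assumes x: "x \<in> N"
  shows "delta_v A F' c x X $ \<alpha> = delta_v A F c x X $ \<alpha> + (\<Sum>\<beta>\<in>UNIV. del_rho \<beta> (fst x) * fst X $ \<beta>) * snd x $ \<alpha>"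
  unfolding delta_v_def Gamma_conformal[OF x] by (simp add: algebra_simps sum.distrib sum_distrib_left)

text \<open>The change of \<open>delta_v\<close> is in the kernel direction \<open>v\<close> of the vertical form.\<close>

lemma omega_V_form_conformal:
  assumes x: "x \<in> N" and F': "finsler_chart A F' c"
  shows "omega_V_form A F' c x = omega_V_form A F c x"
proof -
  have "herm_form (logG_mat A F c x) (delta_v A F' c x) X Y = herm_form (logG_mat A F c x) (delta_v A F c x) X Y" for X Y
    unfolding herm_form_def delta_v_conformal[OF x] by (rule herm_form_kernel) (rule logG_mat_kernel[OF x])+
  then show ?thesis by (intro ext) (simp add: omega_V_form_def two_form_herm_form logG_mat_conformal[OF x F'])
qed

lemma omega_H_form_conformal:
  assumes x: "x \<in> N"
  shows "omega_H_form A F' c x X Y = exp (rho_lift x) * omega_H_form A F c x X Y"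
  unfolding omega_H_form_def two_form_def by (simp add: Gmat_conformal[OF x] sum_distrib_left mult_ac)

text \<open>There are \<open>n\<close> horizontal slots, and each contributes one conformal factor.\<close>

lemma vol_density_conformal:
  assumes x: "x \<in> N" and F': "finsler_chart A F' c"
  shows "vol_density A F' c a x = exp (rho_lift x) ^ CARD('n) * vol_density A F c a x"
proof -
  let ?S = "(UNIV :: 'n set) <+> (UNIV - {a})"
  have eq: "case_sum (\<lambda>_. omega_H_form A F' c x) (\<lambda>_. omega_V_form A F' c x) =
     (\<lambda>s X Y. case_sum (\<lambda>_. exp (rho_lift x)) (\<lambda>_. 1) s * case_sum (\<lambda>_. omega_H_form A F c x) (\<lambda>_. omega_V_form A F c x) s X Y)"
    by (intro ext) (auto simp: omega_H_form_conformal[OF x] omega_V_form_conformal[OF x F'] split: sum.split)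
  have prod: "(\<Prod>s\<in>?S. case_sum (\<lambda>_. exp (rho_lift x)) (\<lambda>_. 1) s) = exp (rho_lift x) ^ CARD('n)"
    by (subst prod.Plus) (simp_all add: o_def)
  show ?thesis unfolding vol_density_def eq wedge_scale prod by simp
qed

end

section \<open>Partitions of unity on the projectivized tangent bundle\<close>

lemma norm_axis: "norm (axis i (x::complex) :: complex^'n) = norm x"
  by (simp add: norm_vec_def L2_set_def axis_def if_distrib[of norm] if_distrib[of "\<lambda>t. t\<^sup>2"] cong: if_cong)

text \<open>Cauchy's inequality on complex lines bounds differences of partial derivatives by differences of
  values; this is why complex differentiable maps are continuously differentiable.\<close>

lemma holomorphic_map_continuous_derivative:
  fixes f :: "complex^'n::finite \<Rightarrow> complex^'m::finite"
  assumes U: "open U" and f: "holomorphic_map_on U f"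
  shows "continuous_on U (\<lambda>z. frechet_derivative f (at z) (axis i 1) $ k)"
proof -
  have D: "(f has_derivative frechet_derivative f (at z)) (at z)"
    "frechet_derivative f (at z) (\<zeta> *s v) = \<zeta> *s frechet_derivative f (at z) v" if z: "z \<in> U" for z \<zeta> v
  proof -
    obtain D where "(f has_derivative D) (at z)" "\<And>\<zeta> v. D (\<zeta> *s v) = \<zeta> *s D v"
      using f z unfolding holomorphic_map_on_def by blast
    moreover from this(1) have "frechet_derivative f (at z) = D" by (rule frechet_derivative_eqI)
    ultimately show "(f has_derivative frechet_derivative f (at z)) (at z)"
      "frechet_derivative f (at z) (\<zeta> *s v) = \<zeta> *s frechet_derivative f (at z) v" by simp_all
  qed
  have fcont: "continuous_on U f"
    using D(1) by (meson continuous_at_imp_continuous_on has_derivative_continuous)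
  have line: "((\<lambda>\<zeta>. f (z + axis i \<zeta>) $ k) has_field_derivative frechet_derivative f (at (z + axis i \<zeta>)) (axis i 1) $ k) (at \<zeta>)"
    if z: "z + axis i \<zeta> \<in> U" for z \<zeta>
  proof -
    have "linear (axis i :: complex \<Rightarrow> complex^'n)" by (auto intro!: linearI simp: axis_def vec_eq_iff)
    then have "bounded_linear (axis i :: complex \<Rightarrow> complex^'n)" by (simp add: linear_conv_bounded_linear)
    then have "((\<lambda>\<zeta>. z + axis i \<zeta>) has_derivative axis i) (at \<zeta>)"
      using has_derivative_add[OF has_derivative_const bounded_linear_imp_has_derivative] by fastforce
    from has_derivative_compose[OF this D(1)[OF z]]
    have "((\<lambda>\<zeta>. f (z + axis i \<zeta>)) has_derivative (\<lambda>h. frechet_derivative f (at (z + axis i \<zeta>)) (axis i h))) (at \<zeta>)" .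
    then have 1: "((\<lambda>\<zeta>. f (z + axis i \<zeta>) $ k) has_derivative (\<lambda>h. frechet_derivative f (at (z + axis i \<zeta>)) (axis i h) $ k)) (at \<zeta>)"
      by (rule bounded_linear.has_derivative[OF bounded_linear_vec_nth])
    have ax: "axis i h = h *s axis i 1" for h :: complex by (simp add: axis_def vec_eq_iff)
    have "frechet_derivative f (at (z + axis i \<zeta>)) (axis i h) $ k = frechet_derivative f (at (z + axis i \<zeta>)) (axis i 1) $ k * h" for h
      unfolding ax[of h] D(2)[OF z] by (simp add: mult.commute)
    then have "(\<lambda>h. frechet_derivative f (at (z + axis i \<zeta>)) (axis i h) $ k) =
        (*) (frechet_derivative f (at (z + axis i \<zeta>)) (axis i 1) $ k)" by (rule ext)
    with 1 show ?thesis unfolding has_field_derivative_def by (simp only:)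
  qed
  show ?thesis
    unfolding continuous_on_iff
  proof (intro ballI allI impI)
    fix z0 \<epsilon> assume z0: "z0 \<in> U" and \<epsilon>: "(0::real) < \<epsilon>"
    obtain R where R: "R > 0" "cball z0 R \<subseteq> U" using U z0 open_contains_cball by blast
    \<comment> \<open>Half the radius, so that discs of radius \<open>r\<close> around points within \<open>r\<close> of \<open>z0\<close> stay in the ball.\<close>
    define r where "r = R / 2"
    have r: "r > 0" using R by (simp add: r_def)
    have "uniformly_continuous_on (cball z0 R) f"
      using R(2) fcont by (intro compact_uniformly_continuous compact_cball) (rule continuous_on_subset)
    moreover have er: "\<epsilon> / 2 * r > 0" using \<epsilon> r by simp
    ultimately obtain \<delta> where \<delta>: "\<delta> > 0"
      "\<And>x y. x \<in> cball z0 R \<Longrightarrow> y \<in> cball z0 R \<Longrightarrow> dist y x < \<delta> \<Longrightarrow> dist (f y) (f x) < \<epsilon> / 2 * r"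
      unfolding uniformly_continuous_on_def by metis
    have in_ball: "z + axis i \<zeta> \<in> cball z0 R" if "dist z z0 < r" "norm \<zeta> \<le> r" for z \<zeta>
    proof -
      have "dist z0 (z + axis i \<zeta>) \<le> dist z0 z + norm (axis i \<zeta> :: complex^'n)"
        using dist_triangle[of z0 "z + axis i \<zeta>" z] by (simp add: dist_norm)
      then show ?thesis using that by (simp add: norm_axis dist_commute r_def)
    qed
    show "\<exists>d>0. \<forall>z\<in>U. dist z z0 < d \<longrightarrow>
       dist (frechet_derivative f (at z) (axis i 1) $ k) (frechet_derivative f (at z0) (axis i 1) $ k) < \<epsilon>"
    proof (intro exI conjI ballI impI)
      show "min \<delta> r > 0" using \<delta> r by simp
      fix z assume z: "z \<in> U" "dist z z0 < min \<delta> r"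
      \<comment> \<open>Cauchy's inequality is applied to the difference of \<open>f\<close> on two parallel complex lines.\<close>
      define g where "g \<zeta> = f (z + axis i \<zeta>) $ k - f (z0 + axis i \<zeta>) $ k" for \<zeta>
      have inb: "z + axis i \<zeta> \<in> cball z0 R" "z0 + axis i \<zeta> \<in> cball z0 R" if "norm \<zeta> \<le> r" for \<zeta>
        using in_ball[of z \<zeta>] in_ball[of z0 \<zeta>] z that r by auto
      have g': "(g has_field_derivative frechet_derivative f (at (z + axis i \<zeta>)) (axis i 1) $ k -
          frechet_derivative f (at (z0 + axis i \<zeta>)) (axis i 1) $ k) (at \<zeta>)" if "norm \<zeta> \<le> r" for \<zeta>
        unfolding g_def using inb[OF that] R(2) by (intro DERIV_diff line) auto
      have "g holomorphic_on ball 0 r"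
        unfolding holomorphic_on_def
      proof
        fix \<zeta> :: complex assume "\<zeta> \<in> ball 0 r"
        then have "norm \<zeta> \<le> r" by simp
        from g'[OF this] show "g field_differentiable at \<zeta> within ball 0 r"
          using field_differentiable_at_within unfolding field_differentiable_def by blast
      qed
      moreover have "continuous_on (cball 0 r) g"
        using g' by (meson DERIV_isCont continuous_at_imp_continuous_on mem_cball_0)
      moreover have "norm (g \<zeta>) \<le> \<epsilon> / 2 * r" if "norm (0 - \<zeta>) = r" for \<zeta>
      proof -
        have "dist (f (z + axis i \<zeta>)) (f (z0 + axis i \<zeta>)) < \<epsilon> / 2 * r"
          using inb[of \<zeta>] that z by (intro \<delta>(2)) auto
        then show ?thesis
          unfolding g_def using Finite_Cartesian_Product.norm_nth_le[of "f (z + axis i \<zeta>) - f (z0 + axis i \<zeta>)" k]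
          by (simp add: dist_norm)
      qed
      ultimately have "norm ((deriv ^^ 1) g 0) \<le> fact 1 * (\<epsilon> / 2 * r) / r ^ 1"
        using r by (intro Cauchy_inequality)
      moreover have "deriv g 0 = frechet_derivative f (at z) (axis i 1) $ k - frechet_derivative f (at z0) (axis i 1) $ k"
        using g'[of 0] r by (intro DERIV_imp_deriv) (simp add: axis_def zero_vec_def[symmetric])
      ultimately show "dist (frechet_derivative f (at z) (axis i 1) $ k) (frechet_derivative f (at z0) (axis i 1) $ k) < \<epsilon>"
        using r \<epsilon> by (simp add: dist_norm)
    qed
  qed
qed

context complex_manifold
begin

lemma transition_deriv_continuous:
  assumes cd: "c \<in> A" "d \<in> A"
  shows "continuous_on (overlap c d \<times> UNIV) (\<lambda>x. transition_deriv c d (fst x) (snd x))"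
proof -
  have comp: "transition_deriv c d z v $ k = (\<Sum>i\<in>UNIV. v $ i * transition_deriv c d z (axis i 1) $ k)"
    if z: "z \<in> overlap c d" for z v k
  proof -
    have "transition_deriv c d z v = transition_deriv c d z (\<Sum>i\<in>UNIV. v $ i *s axis i 1)"
      by (simp only: basis_expansion)
    also have "\<dots> = (\<Sum>i\<in>UNIV. v $ i *s transition_deriv c d z (axis i 1))"
      by (simp add: linear_sum[OF transition_deriv_linear[OF cd z]] transition_deriv_scale[OF cd z])
    finally show ?thesis by simp
  qed
  have base: "continuous_on (overlap c d) (\<lambda>z. transition_deriv c d z (axis i 1) $ k)" for i k
    unfolding transition_deriv_def
    by (rule holomorphic_map_continuous_derivative[OF overlap_open[OF cd] transition_holomorphic[OF cd]])
  have "continuous_on (overlap c d \<times> UNIV) (\<lambda>x. \<Sum>i\<in>UNIV. snd x $ i * transition_deriv c d (fst x) (axis i 1) $ k)" for k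
    by (intro continuous_intros continuous_on_compose2[OF base]) auto
  then have "continuous_on (overlap c d \<times> UNIV) (\<lambda>x. transition_deriv c d (fst x) (snd x) $ k)" for k
    by (rule continuous_on_eq) (auto simp: comp)
  then have "continuous_on (overlap c d \<times> UNIV) (\<lambda>x. \<chi> k. transition_deriv c d (fst x) (snd x) $ k)"
    by (intro continuous_on_vec_lambda)
  then show ?thesis by simp
qed

end

text \<open>Cut-off functions on the base and on the fibre. The threshold \<open>1 / (2 n)\<close> is so small that at every
  nonzero vector some component, divided by the norm, exceeds it.\<close>

definition bump :: "('a, 'n::finite) chart \<Rightarrow> 'a \<Rightarrow> real \<Rightarrow> 'a \<Rightarrow> real" where
  "bump c p r q = (if q \<in> fst c then max 0 (r - dist (snd c q) (snd c p)) else 0)"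

definition fibre_bump :: "'n::finite \<Rightarrow> complex^'n \<Rightarrow> real" where
  "fibre_bump a w = max 0 (cmod (w $ a) / norm w - 1 / (2 * real CARD('n)))"

lemma bump_nonneg: "bump c p r q \<ge> 0" and fibre_bump_nonneg: "fibre_bump a w \<ge> 0"
  by (simp_all add: bump_def fibre_bump_def)

lemma norm_scale_vec: "norm (\<zeta> *s w) = cmod \<zeta> * norm (w :: complex^'n)"
  by (simp add: norm_vec_def L2_set_def norm_mult power_mult_distrib sum_distrib_left[symmetric] real_sqrt_mult)

lemma fibre_bump_scale: "\<zeta> \<noteq> 0 \<Longrightarrow> fibre_bump a (\<zeta> *s w) = fibre_bump a w"
  by (simp add: fibre_bump_def norm_scale_vec norm_mult)

lemma fibre_bump_support:
  fixes w :: "complex^'n"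
  assumes "fibre_bump a w \<noteq> 0"
  shows "w $ a \<noteq> 0" "norm ((1 / w $ a) *s w) \<le> 2 * real CARD('n)"
proof -
  have 1: "cmod (w $ a) / norm w > 1 / (2 * real CARD('n))"
    using assms by (auto simp: fibre_bump_def max_def split: if_splits)
  then show wa: "w $ a \<noteq> 0" by auto
  have w: "norm w > 0" using wa by auto
  have "norm w < 2 * real CARD('n) * cmod (w $ a)" using 1 w by (simp add: field_simps)
  then show "norm ((1 / w $ a) *s w) \<le> 2 * real CARD('n)"
    using wa by (simp add: norm_scale_vec norm_divide field_simps)
qed

lemma fibre_bump_pos:
  fixes w :: "complex^'n"
  assumes "w \<noteq> 0"
  shows "\<exists>a. fibre_bump a w > 0"
proof (rule ccontr)
  assume "\<nexists>a. fibre_bump a w > 0"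
  then have le: "cmod (w $ a) / norm w \<le> 1 / (2 * real CARD('n))" for a
    by (metis diff_gt_0_iff_gt fibre_bump_def less_max_iff_disj linorder_not_less)
  have w: "norm w > 0" using assms by simp
  have "cmod (w $ a) \<le> norm w / (2 * real CARD('n))" for a
    using le[of a] w by (simp add: field_simps)
  then have "(\<Sum>a\<in>UNIV. cmod (w $ a)) \<le> (\<Sum>a\<in>(UNIV::'n set). norm w / (2 * real CARD('n)))"
    by (intro sum_mono)
  also have "\<dots> = norm w / 2" by simp
  finally have "norm w \<le> norm w / 2"
    using L2_set_le_sum[of UNIV "\<lambda>a. norm (w $ a)"] unfolding norm_vec_def by simp
  then show False using w by simp
qed

text \<open>Over the chart \<open>c\<close> this is a composition of continuous functions, by the continuity of
  transition derivatives. Outside the preimage of the coordinate ball it vanishes, and that set is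
  closed because it is compact and the manifold is Hausdorff.\<close>

lemma bump_continuous:
  fixes A :: "('a::t2_space, 'n::finite) chart set"
  assumes A: "complex_atlas A" and c: "c \<in> A" and p: "p \<in> fst c" "cball (snd c p) r \<subseteq> chart_img c" and d: "d \<in> A"
  shows "continuous_on (TM0_coords d) (\<lambda>x. bump c p r (chart_inv d (fst x)) * fibre_bump a (snd (tvec_of A d x) c))"
proof -
  interpret complex_manifold A using A by unfold_locales
  define K where "K = chart_inv c ` cball (snd c p) r"
  have "compact K" unfolding K_def
    using continuous_on_subset[OF chart_inv_continuous[OF c] p(2)] by (rule compact_continuous_image) simp
  then have K: "closed K" by (rule compact_imp_closed)
  let ?f = "\<lambda>x. bump c p r (chart_inv d (fst x)) * fibre_bump a (snd (tvec_of A d x) c)"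
  define V1 where "V1 = overlap d c \<times> (- {0 :: complex^'n})"
  define V2 where "V2 = (chart_img d \<inter> chart_inv d -` (- K)) \<times> (- {0 :: complex^'n})"
  have "continuous_on V1 ?f"
  proof -
    have tr: "continuous_on V1 (\<lambda>x. transition_deriv d c (fst x) (snd x))"
      by (rule continuous_on_subset[OF transition_deriv_continuous[OF d c]]) (auto simp: V1_def)
    have "continuous_on (overlap d c) (transition d c)"
      using transition_has_derivative[OF d c] by (meson continuous_at_imp_continuous_on has_derivative_continuous)
    then have tt: "continuous_on V1 (\<lambda>x. transition d c (fst x))"
      by (rule continuous_on_compose2) (auto simp: V1_def intro: continuous_intros)
    have "continuous_on V1 (\<lambda>x. max 0 (r - dist (transition d c (fst x)) (snd c p)) *
      max 0 (cmod (transition_deriv d c (fst x) (snd x) $ a) / norm (transition_deriv d c (fst x) (snd x)) - 1 / (2 * real CARD('n))))"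
      by (intro continuous_intros tr tt) (auto simp: V1_def transition_deriv_nonzero[OF d c])
    then show ?thesis
      by (rule continuous_on_eq)
        (auto simp: V1_def bump_def fibre_bump_def tvec_of_comp[OF d c] overlap_iff[OF d] transition_apply)
  qed
  moreover have "continuous_on V2 ?f"
  proof (rule continuous_on_eq[OF continuous_on_const[of V2 0]])
    fix x assume "x \<in> V2"
    then have q: "chart_inv d (fst x) \<notin> K" by (auto simp: V2_def)
    have "bump c p r (chart_inv d (fst x)) = 0"
    proof (cases "chart_inv d (fst x) \<in> fst c")
      case True
      then have "snd c (chart_inv d (fst x)) \<notin> cball (snd c p) r"
        using q chart_inv_left[OF c True] unfolding K_def by (metis image_eqI)
      then show ?thesis by (simp add: bump_def dist_commute)
    qed (simp add: bump_def)
    then show "0 = ?f x" by simp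
  qed
  moreover have "open V1" unfolding V1_def by (intro open_Times overlap_open d c) auto
  moreover have "open V2"
  proof -
    have "open (chart_inv d -` (- K) \<inter> chart_img d)"
      using continuous_on_open_vimage[OF chart_open(2)[OF d]] chart_inv_continuous[OF d] K by blast
    then show ?thesis unfolding V2_def by (intro open_Times) (auto simp: Int_commute)
  qed
  moreover have "TM0_coords d = V1 \<union> V2"
  proof -
    have "q \<in> fst c" if "q \<in> K" for q
      using that p(2) chart_inv_in[OF c] unfolding K_def by auto
    then show ?thesis by (auto simp: TM0_coords_def V1_def V2_def overlap_iff[OF d])
  qed
  ultimately show ?thesis using continuous_on_open_Un[of V1 V2 ?f] by simp
qed

text \<open>Finitely many coordinate balls cover the manifold, and in each of them the fibre cut-offs cover the
  fibres. Normalizing the products of the cut-offs gives the partition.\<close>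

lemma PTM_partition_exists:
  fixes A :: "('a::t2_space, 'n::finite) chart set"
  assumes A: "complex_atlas A" and comp: "compact (UNIV :: 'a set)"
  shows "\<exists>I \<theta>. PTM_partition A I \<theta>"
proof -
  interpret complex_manifold A using A by unfold_locales
  have "\<exists>c r. c \<in> A \<and> p \<in> fst c \<and> r > 0 \<and> cball (snd c p) r \<subseteq> chart_img c" for p
  proof -
    obtain c where c: "c \<in> A" "p \<in> fst c" using chart_cover by blast
    then show ?thesis using chart_open(2)[OF c(1)] chart_in_img[OF c(2)] open_contains_cball by blast
  qed
  then obtain C r where C: "\<And>p. C p \<in> A" "\<And>p. p \<in> fst (C p)" "\<And>p. r p > 0" "\<And>p. cball (snd (C p) p) (r p) \<subseteq> chart_img (C p)"
    by metis
  define B where "B p = fst (C p) \<inter> snd (C p) -` ball (snd (C p) p) (r p)" for p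
  have B_open: "open (B p)" for p
    using continuous_on_open_vimage[OF chart_open(1)[OF C(1)]] chart_continuous[OF C(1)] unfolding B_def
    by (metis inf_commute open_ball)
  have "UNIV \<subseteq> (\<Union>p\<in>UNIV. B p)" using C(2,3) by (auto simp: B_def)
  then obtain P where P: "P \<subseteq> UNIV" "finite P" "UNIV \<subseteq> (\<Union>p\<in>P. B p)"
    by (rule compactE_image[OF comp B_open])
  note P = P(2,3)
  \<comment> \<open>Partitions are indexed by charts, so balls of the same chart are taken together.\<close>
  define f where "f k t = (\<Sum>p\<in>{p\<in>P. C p = fst k}. bump (C p) p (r p) (fst t) * fibre_bump (snd k) (snd t (C p)))"
    for k :: "('a, 'n) chart \<times> 'n" and t :: "('a, 'n) tvec"
  define I where "I = C ` P \<times> (UNIV :: 'n set)"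
  define \<Phi> where "\<Phi> t = (\<Sum>k\<in>I. f k t)" for t
  define \<theta> where "\<theta> k t = f k t / \<Phi> t" for k t
  have finI: "finite I" using P by (simp add: I_def)
  have f_nonneg: "f k t \<ge> 0" for k t
    unfolding f_def by (intro sum_nonneg mult_nonneg_nonneg bump_nonneg fibre_bump_nonneg)
  have pos: "\<Phi> t > 0" if t: "t \<in> TM0 A" for t
  proof -
    obtain p where p: "p \<in> P" "fst t \<in> B p" using P by auto
    then have b: "bump (C p) p (r p) (fst t) > 0" by (auto simp: B_def bump_def dist_commute)
    have "snd t (C p) \<noteq> 0" using TM0_comp_nonzero[OF t C(1)] p by (auto simp: B_def)
    then obtain a where a: "fibre_bump a (snd t (C p)) > 0" using fibre_bump_pos by blast
    have "f (C p, a) t > 0"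
      unfolding f_def using P(1) p(1) a b
      by (intro sum_pos2[of _ p]) (auto intro: mult_nonneg_nonneg bump_nonneg fibre_bump_nonneg)
    then show ?thesis
      unfolding \<Phi>_def using finI p(1) f_nonneg by (intro sum_pos2[of _ "(C p, a)"]) (auto simp: I_def)
  qed
  have f_cont: "continuous_on (TM0_coords d) (\<lambda>x. f k (tvec_of A d x))" if "d \<in> A" for d k
    unfolding f_def tvec_of_fst
    by (intro continuous_on_sum bump_continuous[OF A C(1,2,4) that])
  have "PTM_partition A I \<theta>"
    unfolding PTM_partition_def
  proof (intro conjI ballI allI impI)
    show "finite I" by (rule finI)
    show "I \<subseteq> A \<times> UNIV" using C(1) by (auto simp: I_def)
  next
    fix k d assume "k \<in> I" "d \<in> A"
    show "continuous_on (TM0_coords d) (\<lambda>x. \<theta> k (tvec_of A d x))"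
      unfolding \<theta>_def \<Phi>_def
    proof (intro continuous_on_divide continuous_on_sum f_cont \<open>d \<in> A\<close> ballI)
      fix x assume "x \<in> TM0_coords d"
      then show "(\<Sum>k\<in>I. f k (tvec_of A d x)) \<noteq> 0"
        using pos[OF tvec_of_in_TM0[OF \<open>d \<in> A\<close>]] unfolding \<Phi>_def by fastforce
    qed
  next
    fix k t assume "k \<in> I" "t \<in> TM0 A"
    then show "\<theta> k t \<ge> 0" unfolding \<theta>_def using f_nonneg pos by (intro divide_nonneg_pos) auto
  next
    fix k t and \<zeta> :: complex assume "\<zeta> \<noteq> 0"
    then have "f k (tscale \<zeta> t) = f k t" for k
      unfolding f_def by (intro sum.cong refl) (simp add: tscale_def fibre_bump_scale)
    then show "\<theta> k (tscale \<zeta> t) = \<theta> k t" by (simp add: \<theta>_def \<Phi>_def)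
  next
    fix k assume "k \<in> I"
    obtain c a where k: "k = (c, a)" by (cases k)
    define K where "K = (\<Union>p\<in>{p\<in>P. C p = c}. cball (snd c p) (r p)) \<times> ({v :: complex^'n. v $ a = 1} \<inter> cball 0 (2 * real CARD('n)))"
    have "closed {v :: complex^'n. v $ a = 1}" by (intro closed_Collect_eq continuous_intros)
    then have "compact K" unfolding K_def using P(1)
      by (intro compact_Times compact_UN closed_Int_compact) auto
    moreover have "K \<subseteq> chart_img c \<times> {v. v $ a = 1}" unfolding K_def using C(4) by auto
    moreover have "fst t \<in> fst c \<and> snd t c $ a \<noteq> 0 \<and> (snd c (fst t), (1 / (snd t c $ a)) *s snd t c) \<in> K"
      if t: "\<theta> (c, a) t \<noteq> 0" for t
    proof -
      have "f (c, a) t \<noteq> 0" using t by (auto simp: \<theta>_def)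
      then obtain p where p: "p \<in> P" "C p = c" "bump c p (r p) (fst t) \<noteq> 0" "fibre_bump a (snd t c) \<noteq> 0"
        unfolding f_def by (auto elim!: sum.not_neutral_contains_not_neutral)
      then have 1: "fst t \<in> fst c" "snd c (fst t) \<in> cball (snd c p) (r p)"
        by (auto simp: bump_def dist_commute split: if_splits)
      note 2 = fibre_bump_support[OF p(4)]
      show ?thesis unfolding K_def using 1 2 p(1,2) by auto
    qed
    ultimately show "case k of (c, a) \<Rightarrow> \<exists>K. compact K \<and> K \<subseteq> chart_img c \<times> {v. v $ a = 1} \<and>
        (\<forall>t\<in>TM0 A. \<theta> (c, a) t \<noteq> 0 \<longrightarrow> fst t \<in> fst c \<and> snd t c $ a \<noteq> 0 \<and>
           (snd c (fst t), (1 / (snd t c $ a)) *s snd t c) \<in> K)"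
      unfolding k prod.case by blast
  next
    fix t assume "t \<in> TM0 A"
    then show "(\<Sum>k\<in>I. \<theta> k t) = 1"
      using pos[of t] unfolding \<theta>_def sum_divide_distrib[symmetric] \<Phi>_def[symmetric] by simp
  qed
  then show ?thesis by blast
qed

section \<open>Integration in affine charts of the projectivized tangent bundle\<close>

text \<open>The measure and the map through which \<open>PTM_integral_wrt\<close> integrates over the part of the
  projectivized bundle where the \<open>a\<close>-th fibre coordinate is nonzero, normalized to one.\<close>

definition affine_measure :: "'n::finite \<Rightarrow> ((complex^'n) \<times> ('n \<Rightarrow> complex)) measure" where
  "affine_measure a = lborel \<Otimes>\<^sub>M Pi\<^sub>M (UNIV - {a}) (\<lambda>_. lborel)"

definition affine_point :: "'n::finite \<Rightarrow> (complex^'n) \<times> ('n \<Rightarrow> complex) \<Rightarrow> (complex^'n) \<times> (complex^'n)" where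
  "affine_point a y = (fst y, affine_vec a (snd y))"

lemma affine_vec_measurable:
  fixes a :: "'n::finite"
  shows "affine_vec a \<in> borel_measurable (Pi\<^sub>M (UNIV - {a}) (\<lambda>_. lborel :: complex measure))"
proof -
  have eq: "affine_vec a = (\<lambda>w. axis a 1 + (\<Sum>b\<in>UNIV - {a}. axis b (w b)))"
  proof (intro ext, subst vec_eq_iff, intro allI)
    fix w :: "'n \<Rightarrow> complex" and k
    have "(\<Sum>b\<in>UNIV - {a}. axis b (w b) $ k) = (\<Sum>b\<in>UNIV - {a}. if b = k then w k else 0)"
      by (intro sum.cong refl) (auto simp: axis_def)
    then show "affine_vec a w $ k = (axis a 1 + (\<Sum>b\<in>UNIV - {a}. axis b (w b))) $ k"
      by (simp add: affine_vec_def axis_def)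
  qed
  have ax: "(axis b :: complex \<Rightarrow> complex^'n) \<in> borel_measurable borel" for b :: 'n
  proof -
    have "linear (axis b :: complex \<Rightarrow> complex^'n)" by (auto intro!: linearI simp: axis_def vec_eq_iff)
    then have "bounded_linear (axis b :: complex \<Rightarrow> complex^'n)" by (simp add: linear_conv_bounded_linear)
    from bounded_linear.continuous_on[OF this continuous_on_id]
    show ?thesis by (intro borel_measurable_continuous_onI)
  qed
  have "(\<lambda>w. axis b (w b) :: complex^'n) \<in> borel_measurable (Pi\<^sub>M (UNIV - {a}) (\<lambda>_. lborel :: complex measure))"
    if "b \<in> UNIV - {a}" for b :: 'n
  proof -
    have "(\<lambda>w. w b) \<in> measurable (Pi\<^sub>M (UNIV - {a}) (\<lambda>_. lborel :: complex measure)) borel"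
      using measurable_component_singleton[OF that, of "\<lambda>_. lborel :: complex measure"] by simp
    from measurable_compose[OF this ax] show ?thesis .
  qed
  then show ?thesis unfolding eq by (intro borel_measurable_add borel_measurable_const borel_measurable_sum)
qed

lemma affine_point_measurable: "affine_point a \<in> borel_measurable (affine_measure a)"
proof -
  have "fst \<in> measurable (affine_measure a) borel"
    unfolding affine_measure_def by simp
  moreover have "(\<lambda>y. affine_vec a (snd y)) \<in> borel_measurable (affine_measure a)"
    unfolding affine_measure_def by (rule measurable_compose[OF measurable_snd affine_vec_measurable])
  ultimately show ?thesis
    unfolding affine_point_def[abs_def] by (rule borel_measurable_Pair)
qed

definition affine_box :: "'n::finite \<Rightarrow> (complex^'n) set \<Rightarrow> ('n \<Rightarrow> complex set) \<Rightarrow> ((complex^'n) \<times> ('n \<Rightarrow> complex)) set" where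
  "affine_box a U V = U \<times> Pi\<^sub>E (UNIV - {a}) V"

lemma affine_box_measurable:
  assumes "U \<in> sets borel" "\<And>b. V b \<in> sets borel"
  shows "affine_box a U V \<in> sets (affine_measure a)"
  unfolding affine_box_def affine_measure_def using assms by (intro pair_measureI sets_PiM_I_finite) auto

lemma emeasure_affine_box:
  assumes "U \<in> sets borel" "\<And>b. V b \<in> sets borel"
  shows "emeasure (affine_measure a) (affine_box a U V) = emeasure lborel U * (\<Prod>b\<in>UNIV - {a}. emeasure lborel (V b))"
proof -
  interpret P: finite_product_sigma_finite "\<lambda>_. lborel :: complex measure" "UNIV - {a}"
    by standard auto
  have Q: "sigma_finite_measure (Pi\<^sub>M (UNIV - {a}) (\<lambda>_. lborel :: complex measure))"
    by (rule product_sigma_finite.sigma_finite[OF P.product_sigma_finite_axioms]) simp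
  have "emeasure (affine_measure a) (affine_box a U V) =
      emeasure lborel U * emeasure (Pi\<^sub>M (UNIV - {a}) (\<lambda>_. lborel)) (Pi\<^sub>E (UNIV - {a}) V)"
    unfolding affine_measure_def affine_box_def
    using assms by (intro sigma_finite_measure.emeasure_pair_measure_Times[OF Q] sets_PiM_I_finite) auto
  also have "emeasure (Pi\<^sub>M (UNIV - {a}) (\<lambda>_. lborel)) (Pi\<^sub>E (UNIV - {a}) V) = (\<Prod>b\<in>UNIV - {a}. emeasure lborel (V b))"
    using assms by (intro P.emeasure_PiM) auto
  finally show ?thesis .
qed

lemma affine_vec_nonzero: "affine_vec a w \<noteq> 0" and affine_vec_self: "affine_vec a w $ a = 1"
  and affine_vec_other: "b \<noteq> a \<Longrightarrow> affine_vec a w $ b = w b"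
proof -
  show 1: "affine_vec a w $ a = 1" by (simp add: affine_vec_def)
  then show "affine_vec a w \<noteq> 0" by (metis zero_index zero_neq_one)
  show "b \<noteq> a \<Longrightarrow> affine_vec a w $ b = w b" by (simp add: affine_vec_def)
qed

lemma affine_point_in: "affine_point a y \<in> TM0_coords c \<longleftrightarrow> fst y \<in> chart_img c"
  by (simp add: affine_point_def TM0_coords_def affine_vec_nonzero)

text \<open>The integrand is bounded and supported in a box of finite measure.\<close>

lemma affine_integrable:
  fixes h :: "(complex^'n::finite) \<times> (complex^'n) \<Rightarrow> complex"
  assumes c: "open (TM0_coords c)"
    and h: "continuous_on (TM0_coords c) h"
    and K: "compact K" "K \<subseteq> chart_img c \<times> {v. v $ a = 1}"
    and supp: "\<And>x. x \<in> TM0_coords c \<Longrightarrow> snd x $ a = 1 \<Longrightarrow> h x \<noteq> 0 \<Longrightarrow> x \<in> K"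
  shows "integrable (affine_measure a) (\<lambda>y. indicator (chart_img c) (fst y) * h (affine_point a y))"
proof -
  let ?g = "\<lambda>y. indicator (chart_img c) (fst y) * h (affine_point a y)"
  have g_eq: "?g = (\<lambda>y. indicator (TM0_coords c) (affine_point a y) *\<^sub>R h (affine_point a y))"
    by (intro ext) (auto simp: affine_point_in indicator_def)
  have meas: "?g \<in> borel_measurable (affine_measure a)"
    unfolding g_eq
    by (rule measurable_compose[OF affine_point_measurable borel_measurable_continuous_on_indicator[OF borel_open[OF c] h]])
  have "K \<subseteq> TM0_coords c"
  proof
    fix x assume "x \<in> K"
    then have "fst x \<in> chart_img c" "snd x $ a = 1" using K(2) by auto
    moreover from this(2) have "snd x \<noteq> 0" by (metis zero_index zero_neq_one)
    ultimately show "x \<in> TM0_coords c" by (simp add: TM0_coords_def mem_Times_iff)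
  qed
  then have "bounded (h ` K)" using K(1) h by (intro compact_imp_bounded compact_continuous_image) (rule continuous_on_subset)
  then obtain B where B: "\<And>x. x \<in> K \<Longrightarrow> norm (h x) \<le> B" by (auto simp: bounded_iff)
  obtain R where R: "\<And>x. x \<in> K \<Longrightarrow> norm x \<le> R" using compact_imp_bounded[OF K(1)] by (auto simp: bounded_iff)
  have inK: "affine_point a y \<in> K" if "?g y \<noteq> 0" for y
  proof -
    have "fst y \<in> chart_img c" "h (affine_point a y) \<noteq> 0" using that by (auto simp: indicator_def split: if_splits)
    then show ?thesis using affine_point_in[of a y c] by (intro supp) (auto simp: affine_point_def affine_vec_self)
  qed
  define T where "T = affine_box a (cball 0 R) (\<lambda>_. cball 0 R)"
  have inT: "y \<in> T" if y: "y \<in> space (affine_measure a)" "?g y \<noteq> 0" for y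
  proof -
    have n: "norm (affine_point a y) \<le> R" using R[OF inK[OF y(2)]] .
    have n1: "norm (fst y) \<le> R" "norm (affine_vec a (snd y)) \<le> R"
      using n norm_fst_le[of "fst y" "affine_vec a (snd y)"] norm_snd_le[of "affine_vec a (snd y)" "fst y"]
      by (auto simp: affine_point_def)
    have "norm (snd y b) \<le> R" if "b \<noteq> a" for b
      using Finite_Cartesian_Product.norm_nth_le[of "affine_vec a (snd y)" b] n1(2) affine_vec_other[OF that, of "snd y"] by simp
    moreover have "snd y \<in> extensional (UNIV - {a})"
      using y(1) by (auto simp: affine_measure_def space_pair_measure space_PiM PiE_def)
    ultimately show ?thesis using n1(1) by (cases y) (auto simp: T_def affine_box_def PiE_iff)
  qed
  show ?thesis
  proof (rule integrableI_bounded_set[OF _ meas])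
    show "T \<in> sets (affine_measure a)" unfolding T_def by (intro affine_box_measurable) auto
    show "emeasure (affine_measure a) T < \<infinity>"
    proof -
      have "emeasure lborel (cball (0 :: complex^'n) R) < top" "emeasure lborel (cball (0 :: complex) R) < top"
        by (rule emeasure_lborel_cball_finite[unfolded infinity_ennreal_def])+
      then show ?thesis
        unfolding T_def by (subst emeasure_affine_box) (auto simp: ennreal_mult_less_top power_less_top_ennreal)
    qed
    show "AE y in affine_measure a. y \<in> T \<longrightarrow> norm (?g y) \<le> max B 0"
    proof (intro AE_I2 impI)
      fix y
      show "norm (?g y) \<le> max B 0"
      proof (cases "?g y = 0")
        case False
        from B[OF inK[OF False]] show ?thesis by (auto simp: indicator_def norm_mult)
      next
        case True
        then show ?thesis by (simp only: norm_zero max.cobounded2)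
      qed
    qed
    show "AE y in affine_measure a. y \<notin> T \<longrightarrow> ?g y = 0" using inT by (intro AE_I2) blast
  qed
qed

lemma emeasure_ball_nonzero:
  assumes "\<epsilon> > 0"
  shows "emeasure lborel (ball (z :: 'e::euclidean_space) \<epsilon>) \<noteq> 0"
proof
  assume "emeasure lborel (ball z \<epsilon>) = 0"
  then have "measure lborel (ball z \<epsilon>) = 0" by (simp add: measure_def)
  then show False using content_ball_pos[OF assms, of z] by simp
qed

text \<open>The boxes have positive measure, so a continuous nonnegative function with vanishing integral is zero
  everywhere and not merely almost everywhere.\<close>

lemma affine_integral_zero:
  fixes h :: "(complex^'n::finite) \<times> (complex^'n) \<Rightarrow> complex"
  assumes c: "open (TM0_coords c)"
    and h: "continuous_on (TM0_coords c) h"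
    and int: "integrable (affine_measure a) (\<lambda>y. indicator (chart_img c) (fst y) * h (affine_point a y))"
    and nonneg: "\<And>x. x \<in> TM0_coords c \<Longrightarrow> snd x $ a = 1 \<Longrightarrow> Re (h x) \<ge> 0"
    and zero: "Re (\<integral>y. indicator (chart_img c) (fst y) * h (affine_point a y) \<partial>affine_measure a) = 0"
    and x0: "x0 \<in> TM0_coords c" "snd x0 $ a = 1"
  shows "Re (h x0) = 0"
proof (rule ccontr)
  let ?g = "\<lambda>y. indicator (chart_img c) (fst y) * h (affine_point a y)"
  assume "Re (h x0) \<noteq> 0"
  then have pos: "Re (h x0) > 0" using nonneg[OF x0] by simp
  have g_nonneg: "Re (?g y) \<ge> 0" for y
    using nonneg[of "affine_point a y"] affine_point_in[of a y c] affine_vec_self[of a "snd y"]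
    by (auto simp: indicator_def affine_point_def)
  have "integrable (affine_measure a) (\<lambda>y. Re (?g y))"
    using int by (rule integrable_Re)
  moreover have "(\<integral>y. Re (?g y) \<partial>affine_measure a) = 0"
    using zero integral_Re[OF int] by simp
  ultimately have AE0: "AE y in affine_measure a. Re (?g y) = 0"
    using integral_nonneg_eq_0_iff_AE[of "affine_measure a" "\<lambda>y. Re (?g y)"] g_nonneg by blast
  have "continuous_on (TM0_coords c) (\<lambda>x. Re (h x))" using h by (intro continuous_intros)
  then have "open ((\<lambda>x. Re (h x)) -` {0<..} \<inter> TM0_coords c)"
    using continuous_on_open_vimage[OF c] open_greaterThan by blast
  moreover have "x0 \<in> (\<lambda>x. Re (h x)) -` {0<..} \<inter> TM0_coords c" using pos x0 by simp
  ultimately obtain \<delta> where \<delta>: "\<delta> > 0" "ball x0 \<delta> \<subseteq> (\<lambda>x. Re (h x)) -` {0<..} \<inter> TM0_coords c"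
    using open_contains_ball by blast
  \<comment> \<open>One share of the distance for the base point and one for each fibre coordinate.\<close>
  define \<epsilon> where "\<epsilon> = \<delta> / (real CARD('n) + 1)"
  have \<epsilon>: "\<epsilon> > 0" "(real CARD('n) + 1) * \<epsilon> = \<delta>"
    using \<delta>(1) by (simp_all add: \<epsilon>_def add_nonneg_pos)
  define T where "T = affine_box a (ball (fst x0) \<epsilon>) (\<lambda>b. ball (snd x0 $ b) \<epsilon>)"
  have T: "T \<in> sets (affine_measure a)" unfolding T_def by (intro affine_box_measurable) auto
  have Tpos: "Re (?g y) > 0" if y: "y \<in> T" for y
  proof -
    have "fst y \<in> ball (fst x0) \<epsilon>" and snd_y: "snd y \<in> Pi\<^sub>E (UNIV - {a}) (\<lambda>b. ball (snd x0 $ b) \<epsilon>)"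
      using y unfolding T_def affine_box_def by (simp_all add: mem_Times_iff)
    moreover have "snd y b \<in> ball (snd x0 $ b) \<epsilon>" if "b \<noteq> a" for b
      using PiE_mem[OF snd_y, of b] that by simp
    ultimately have 1: "dist (fst x0) (fst y) < \<epsilon>" "\<And>b. b \<noteq> a \<Longrightarrow> dist (snd x0 $ b) (snd y b) < \<epsilon>"
      by simp_all
    have "norm (snd x0 - affine_vec a (snd y)) \<le> (\<Sum>b\<in>UNIV. norm ((snd x0 - affine_vec a (snd y)) $ b))"
      unfolding norm_vec_def by (rule L2_set_le_sum) simp
    also have "\<dots> = (\<Sum>b\<in>UNIV - {a}. norm ((snd x0 - affine_vec a (snd y)) $ b))"
      using x0(2) by (intro sum.mono_neutral_right) (auto simp: affine_vec_self)
    also have "\<dots> \<le> (\<Sum>b\<in>UNIV - {a}. \<epsilon>)"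
      using 1(2) by (intro sum_mono) (auto simp: affine_vec_other dist_norm intro: less_imp_le)
    also have "\<dots> \<le> real CARD('n) * \<epsilon>"
      using \<epsilon>(1) by simp
    finally have "norm (snd x0 - affine_vec a (snd y)) \<le> real CARD('n) * \<epsilon>" .
    then have "dist (snd x0) (snd (affine_point a y)) \<le> real CARD('n) * \<epsilon>" by (simp add: dist_norm affine_point_def)
    moreover have "dist x0 (affine_point a y) \<le> dist (fst x0) (fst (affine_point a y)) + dist (snd x0) (snd (affine_point a y))"
      unfolding dist_prod_def by (rule sqrt_sum_squares_le_sum) auto
    ultimately have "dist x0 (affine_point a y) < \<delta>"
      using 1(1) \<epsilon>(2) by (simp add: affine_point_def algebra_simps)
    then have "Re (h (affine_point a y)) > 0" "affine_point a y \<in> TM0_coords c" using \<delta>(2) by auto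
    then show ?thesis by (simp add: affine_point_in)
  qed
  have "AE y in affine_measure a. y \<notin> T"
    using AE0
  proof eventually_elim
    case (elim y)
    then show "y \<notin> T" using Tpos[of y] by linarith
  qed
  then have "emeasure (affine_measure a) T = 0" using T by (simp add: AE_iff_null_sets[symmetric] null_setsD1)
  then show False
    unfolding T_def using emeasure_ball_nonzero[OF \<epsilon>(1), where 'e = complex] emeasure_ball_nonzero[OF \<epsilon>(1), where 'e = "complex^'n"]
    by (subst (asm) emeasure_affine_box) auto
qed

section \<open>Balanced metrics and differentials of functions\<close>

definition del_fun :: "('a, 'n::finite) chart \<Rightarrow> ('a \<Rightarrow> real) \<Rightarrow> 'n \<Rightarrow> complex^'n \<Rightarrow> complex" where
  "del_fun c w \<alpha> = wirtinger (axis \<alpha> 1) (axis \<alpha> \<i>) (\<lambda>z. complex_of_real (w (chart_inv c z)))"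

definition delbar_del_fun :: "('a, 'n::finite) chart \<Rightarrow> ('a \<Rightarrow> real) \<Rightarrow> 'n \<Rightarrow> 'n \<Rightarrow> complex^'n \<Rightarrow> complex" where
  "delbar_del_fun c w \<alpha> \<beta> = wirtinger_bar (axis \<beta> 1) (axis \<beta> \<i>) (del_fun c w \<alpha>)"

definition del_form :: "('a \<Rightarrow> real) \<Rightarrow> ('a, 'n::finite) hform" where
  "del_form w = (\<lambda>c I J x. if length I = 1 \<and> length J = 0 then del_fun c w (I ! 0) (fst x) else 0)"

abbreviation balance_pairing :: "('a, 'n::finite) chart set \<Rightarrow> (('a, 'n) tvec \<Rightarrow> real) \<Rightarrow> ('a \<Rightarrow> real) \<Rightarrow>
    ('a, 'n) chart \<Rightarrow> (complex^'n) \<times> (complex^'n) \<Rightarrow> complex" where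
  "balance_pairing A F w \<equiv> inner_pt A F 1 1 (delbar_H A F (del_form w)) (omega_H A F)"

lemma hforms_degree:
  assumes "\<phi> \<in> hforms A p q" "length I \<noteq> p \<or> length J \<noteq> q"
  shows "\<phi> c I J x = 0"
proof -
  have "\<forall>c I J x. length I \<noteq> p \<or> length J \<noteq> q \<longrightarrow> \<phi> c I J x = 0"
    using assms(1) unfolding hforms_def mem_Collect_eq by (rule conjunct1)
  then show ?thesis using assms(2) by (elim allE impE)
qed

lemma sum_lists_1: "(\<Sum>K | length K = Suc 0. g K) = (\<Sum>k\<in>(UNIV::'n::finite set). g [k])"
proof -
  have "{K :: 'n list. length K = Suc 0} = (\<lambda>k. [k]) ` UNIV" by (auto simp: length_Suc_conv)
  then show ?thesis by (simp add: sum.reindex inj_on_def)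
qed

context complex_manifold
begin

lemma real_fun_smooth:
  assumes "smooth_fun A w" "c \<in> A"
  shows "smooth_on (chart_img c) (\<lambda>z. complex_of_real (w (chart_inv c z)))"
  using smooth_on_linear[OF chart_open(2)[OF assms(2)] bounded_linear_of_real] assms by (auto simp: smooth_fun_def o_def)

lemma del_fun_smooth: "smooth_fun A w \<Longrightarrow> c \<in> A \<Longrightarrow> smooth_on (chart_img c) (del_fun c w \<alpha>)"
  unfolding del_fun_def by (intro wirtinger_smooth chart_open real_fun_smooth)

lemma delbar_del_fun_smooth: "smooth_fun A w \<Longrightarrow> c \<in> A \<Longrightarrow> smooth_on (chart_img c) (delbar_del_fun c w \<alpha> \<beta>)"
  unfolding delbar_del_fun_def by (intro wirtinger_smooth chart_open del_fun_smooth)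

text \<open>As the transition maps are holomorphic, the \<open>(1,0)\<close>-part of the differential transforms by itself.\<close>

lemma del_fun_change_of_chart:
  assumes w: "smooth_fun A w" and cd: "c \<in> A" "d \<in> A" and z: "z \<in> overlap c d"
  shows "del_fun c w \<alpha> z = (\<Sum>\<kappa>\<in>UNIV. jac c d z \<kappa> \<alpha> * del_fun d w \<kappa> (transition c d z))"
proof -
  let ?D = "frechet_derivative (\<lambda>z. complex_of_real (w (chart_inv d z))) (at (transition c d z))"
  have diff: "(\<lambda>z. complex_of_real (w (chart_inv d z))) differentiable at (transition c d z)"
    by (rule smooth_on_differentiable[OF real_fun_smooth[OF w cd(2)] transition_in_overlap(3)[OF cd z]])
  have e: "frechet_derivative (\<lambda>z. complex_of_real (w (chart_inv c z))) (at z) v = ?D (transition_deriv c d z v)" for v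
    using derivative_change_of_chart[of "\<lambda>p. complex_of_real (w p)", OF diff cd z] .
  have ax: "axis \<alpha> \<i> = \<i> *s (axis \<alpha> 1 :: complex^'n)" by (simp add: axis_def vec_eq_iff)
  have "del_fun c w \<alpha> z = (?D (transition_deriv c d z (axis \<alpha> 1)) - \<i> * ?D (\<i> *s transition_deriv c d z (axis \<alpha> 1))) / 2"
    unfolding del_fun_def wirtinger_def e ax transition_deriv_scale[OF cd z] ..
  also have "\<dots> = (\<Sum>\<kappa>\<in>UNIV. transition_deriv c d z (axis \<alpha> 1) $ \<kappa> * del_fun d w \<kappa> (transition c d z))"
  proof -
    let ?t = "transition_deriv c d z (axis \<alpha> 1)"
    let ?f = "\<lambda>z. complex_of_real (w (chart_inv d z))"
    have "?D ?t - \<i> * ?D (\<i> *s ?t) = 2 * (\<Sum>\<kappa>\<in>UNIV. ?t $ \<kappa> * wirtinger (axis \<kappa> 1) (axis \<kappa> \<i>) ?f (transition c d z))"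
      unfolding wirtinger_expansion[OF diff] sum_distrib_left sum_subtractf[symmetric]
      by (intro sum.cong refl) (simp add: algebra_simps)
    then show ?thesis by (simp add: del_fun_def)
  qed
  finally show ?thesis by (simp add: jac_def)
qed

lemma del_form_in_hforms:
  assumes w: "smooth_fun A w"
  shows "del_form w \<in> hforms A 1 0"
  unfolding hforms_def mem_Collect_eq
proof (intro conjI ballI allI impI)
  fix c :: "('a, 'n) chart" and I J :: "'n list" and x :: "(complex^'n) \<times> (complex^'n)"
  assume "length I \<noteq> 1 \<or> length J \<noteq> 0"
  then show "del_form w c I J x = 0" by (auto simp: del_form_def)
next
  fix c :: "('a, 'n) chart" and I J :: "'n list" assume c: "c \<in> A"
  have o: "open (TM0_coords c)" by (rule TM0_coords_open[OF c])
  show "smooth_on (TM0_coords c) (del_form w c I J)"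
  proof (cases "length I = 1 \<and> length J = 0")
    case True
    then have "del_form w c I J = (\<lambda>x. del_fun c w (I ! 0) (fst x))" by (auto simp: del_form_def)
    then show ?thesis unfolding TM0_coords_def
      using smooth_on_compose_fst[OF chart_open(2)[OF c] open_Compl[OF closed_singleton] del_fun_smooth[OF w c]] by simp
  next
    case False
    then have "del_form w c I J = (\<lambda>x. 0)" by (auto simp: del_form_def)
    then show ?thesis using smooth_on_const[OF o] by simp
  qed
next
  fix c :: "('a, 'n) chart" and I J :: "'n list" and x :: "(complex^'n) \<times> (complex^'n)" and i j
  assume "i < length I" "j < length I" "i \<noteq> j"
  then have "length I \<noteq> 1" by auto
  then show "del_form w c (swap_entries i j I) J x = - del_form w c I J x"
    by (auto simp: del_form_def swap_entries_def)
next
  fix c :: "('a, 'n) chart" and I J :: "'n list" and x :: "(complex^'n) \<times> (complex^'n)" and i j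
  assume "i < length J" "j < length J" "i \<noteq> j"
  then have "length J \<noteq> 0" by auto
  then show "del_form w c I (swap_entries i j J) x = - del_form w c I J x"
    by (auto simp: del_form_def swap_entries_def)
next
  fix c :: "('a, 'n) chart" and I J :: "'n list" and x :: "(complex^'n) \<times> (complex^'n)"
  show "case x of (z, v) \<Rightarrow> \<forall>\<zeta>. \<zeta> \<noteq> 0 \<longrightarrow> del_form w c I J (z, \<zeta> *s v) = del_form w c I J (z, v)"
    by (auto simp: del_form_def)
next
  fix c d :: "('a, 'n) chart" and z v :: "complex^'n" and I J :: "'n list"
  assume cd: "c \<in> A" "d \<in> A" and z: "z \<in> snd c ` (fst c \<inter> fst d)" and IJ: "length I = 1 \<and> length J = 0"
  from IJ obtain \<alpha> where I: "I = [\<alpha>]" by (auto simp: length_Suc_conv)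
  have "del_fun c w \<alpha> z = (\<Sum>\<kappa>\<in>UNIV. jac c d z \<kappa> \<alpha> * del_fun d w \<kappa> (transition c d z))"
    using z by (intro del_fun_change_of_chart[OF w cd]) (simp add: overlap_def)
  then show "del_form w c I J (z, v) = (\<Sum>K | length K = 1. \<Sum>L | length L = 0.
      (\<Prod>i<1. jac c d z (K ! i) (I ! i)) * (\<Prod>j<0. cnj (jac c d z (L ! j) (J ! j))) *
       del_form w d K L (transition c d z, transition_deriv c d z v))"
    using IJ by (simp add: I sum_lists_1 del_form_def)
qed

end

context finsler_chart
begin

definition "trace_hess w x = (\<Sum>\<alpha>\<in>UNIV. \<Sum>\<beta>\<in>UNIV. Ginv A F c x $ \<beta> $ \<alpha> * delbar_del_fun c w \<alpha> \<beta> (fst x))"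

text \<open>Taking the inner product with \<open>omega_H\<close> is a trace: one of the two inverse metrics cancels against
  the metric in \<open>omega_H\<close>. The factor is \<open>\<i>\<close> because \<open>delbar_H\<close> contributes a minus sign and
  \<open>omega_H\<close> a conjugated \<open>\<i>\<close>.\<close>

lemma inner_del_form:
  assumes w: "smooth_fun A w" and x: "x \<in> N"
  shows "balance_pairing A F w c x = \<i> * trace_hess w x"
proof -
  have d: "delbar_H A F (del_form w) c [\<alpha>] [\<beta>] x = - delbar_del_fun c w \<alpha> \<beta> (fst x)" for \<alpha> \<beta>
  proof -
    have "(\<lambda>x. del_form w c [\<alpha>] [] x) = (\<lambda>x. del_fun c w \<alpha> (fst x))" by (simp add: del_form_def)
    then have "delbar_H A F (del_form w) c [\<alpha>] [\<beta>] x = - delta_bar A F c \<beta> (\<lambda>x. del_fun c w \<alpha> (fst x)) x"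
      by (simp add: delbar_H_def remove_nth_def)
    then show ?thesis
      using d_fst(2,4)[OF smooth_on_differentiable[OF del_fun_smooth[OF w c] N_fst[OF x]]]
      by (simp add: delta_bar_def delbar_del_fun_def)
  qed
  have o: "cnj (omega_H A F c [\<kappa>] [\<tau>] x) = - \<i> * Gmat A F c x $ \<tau> $ \<kappa>" for \<kappa> \<tau>
    by (simp add: omega_H_def Gmat_herm[OF x, of \<tau> \<kappa>])
  have s: "(\<Sum>\<kappa>\<in>UNIV. \<Sum>\<tau>\<in>UNIV. Ginv A F c x $ \<kappa> $ \<alpha> * (Ginv A F c x $ \<beta> $ \<tau> * Gmat A F c x $ \<tau> $ \<kappa>)) = Ginv A F c x $ \<beta> $ \<alpha>" for \<alpha> \<beta>
    unfolding sum_distrib_left[symmetric] Ginv_left[OF x]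
    by (simp add: if_distrib[of "\<lambda>t. _ * t"] cong: if_cong)
  have "balance_pairing A F w c x =
    (\<Sum>\<alpha>\<in>UNIV. \<Sum>\<beta>\<in>UNIV. \<Sum>\<kappa>\<in>UNIV. \<Sum>\<tau>\<in>UNIV. - delbar_del_fun c w \<alpha> \<beta> (fst x) *
       Ginv A F c x $ \<kappa> $ \<alpha> * Ginv A F c x $ \<beta> $ \<tau> * (- \<i> * Gmat A F c x $ \<tau> $ \<kappa>))"
    unfolding inner_pt_def by (simp add: sum_lists_1 d o)
  also have "\<dots> = (\<Sum>\<alpha>\<in>UNIV. \<Sum>\<beta>\<in>UNIV. \<i> * delbar_del_fun c w \<alpha> \<beta> (fst x) *
     (\<Sum>\<kappa>\<in>UNIV. \<Sum>\<tau>\<in>UNIV. Ginv A F c x $ \<kappa> $ \<alpha> * (Ginv A F c x $ \<beta> $ \<tau> * Gmat A F c x $ \<tau> $ \<kappa>)))"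
    by (simp add: sum_distrib_left mult_ac)
  also have "\<dots> = \<i> * trace_hess w x"
    unfolding s trace_hess_def by (simp add: sum_distrib_left mult_ac)
  finally show ?thesis .
qed

lemma trace_hess_continuous:
  assumes w: "smooth_fun A w"
  shows "continuous_on N (trace_hess w)"
proof -
  have "smooth_on N (\<lambda>x. delbar_del_fun c w \<alpha> \<beta> (fst x))" for \<alpha> \<beta>
    unfolding TM0_coords_def by (intro smooth_on_compose_fst chart_open c delbar_del_fun_smooth w) auto
  then show ?thesis
    unfolding trace_hess_def[abs_def]
    by (intro continuous_intros smooth_on_continuous[OF Ginv_smooth] smooth_on_continuous)
qed

end

text \<open>The adjoints in \<open>balanced\<close> have bidegrees \<open>(0,1)\<close> and \<open>(1,0)\<close>, so their sum vanishes only if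
  both do. That a partition of unity exists is used to know that the partition selected in
  \<open>PTM_integral\<close> involves charts of the atlas only.\<close>

lemma balanced_zero:
  fixes A :: "('a::topological_space, 'n::finite) chart set"
  assumes part: "\<exists>I \<theta>. PTM_partition A I \<theta>" and bal: "balanced A F" and \<phi>: "\<phi> \<in> hforms A 1 0"
  shows "inner_PTM A F 1 1 (delbar_H A F \<phi>) (omega_H A F) = 0"
proof -
  obtain \<eta> \<eta>' where \<eta>: "\<eta> \<in> hforms A 0 1" and \<eta>': "delbar_H_adjoint A F 1 0 (omega_H A F) \<eta>'"
    and eq: "hform_eq A (hform_add \<eta> \<eta>') hform_zero"
    using bal unfolding balanced_def del_H_adjoint_def by blast
  have \<eta>'_form: "\<eta>' \<in> hforms A 1 0" using \<eta>' by (simp add: delbar_H_adjoint_def)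
  have zero: "\<eta>' c K L x = 0" if "c \<in> A" "x \<in> TM0_coords c" for c K L x
  proof (cases "length K = 1 \<and> length L = 0")
    case True
    then have "\<eta> c K L x = 0" using hforms_degree[OF \<eta>, of K L c x] by simp
    moreover have "\<eta> c K L x + \<eta>' c K L x = 0"
      using eq that unfolding hform_eq_def hform_add_def hform_zero_def by blast
    ultimately show ?thesis by simp
  next
    case False
    then show ?thesis using hforms_degree[OF \<eta>'_form, of K L c x] by blast
  qed
  obtain I \<theta> where P: "(SOME P. PTM_partition A (fst P) (snd P)) = (I, \<theta>)" by (meson surj_pair)
  have "PTM_partition A (fst (SOME P. PTM_partition A (fst P) (snd P))) (snd (SOME P. PTM_partition A (fst P) (snd P)))"
    using part by (intro someI_ex[of "\<lambda>P. PTM_partition A (fst P) (snd P)"]) auto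
  then have IA: "I \<subseteq> A \<times> UNIV" unfolding P by (simp add: PTM_partition_def)
  have "inner_PTM A F 1 0 \<phi> \<eta>' = 0"
    unfolding inner_PTM_def PTM_integral_def P Let_def prod.case PTM_integral_wrt_def
  proof (rule sum.neutral, safe)
    fix c a assume "(c, a) \<in> I"
    then have c: "c \<in> A" using IA by auto
    have "indicator (chart_img c) (fst y) * complex_of_real (\<theta> (c, a) (tvec_of A c (fst y, affine_vec a (snd y)))) *
        inner_pt A F 1 0 \<phi> \<eta>' c (fst y, affine_vec a (snd y)) * vol_density A F c a (fst y, affine_vec a (snd y)) = 0" for y
    proof (cases "fst y \<in> chart_img c")
      case True
      then have "(fst y, affine_vec a (snd y)) \<in> TM0_coords c" using affine_point_in[of a y c] by (simp add: affine_point_def)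
      then have "inner_pt A F 1 0 \<phi> \<eta>' c (fst y, affine_vec a (snd y)) = 0"
        unfolding inner_pt_def by (simp add: zero[OF c])
      then show ?thesis by simp
    qed simp
    then show "(\<integral>y. indicator (chart_img c) (fst y) * complex_of_real (\<theta> (c, a) (tvec_of A c (fst y, affine_vec a (snd y)))) *
        inner_pt A F 1 0 \<phi> \<eta>' c (fst y, affine_vec a (snd y)) * vol_density A F c a (fst y, affine_vec a (snd y))
        \<partial>(lborel \<Otimes>\<^sub>M Pi\<^sub>M (UNIV - {a}) (\<lambda>_. lborel))) = 0"
      by (simp only:) simp
  qed
  then show ?thesis using \<eta>' \<phi> unfolding delbar_H_adjoint_def by simp
qed

section \<open>Uniqueness of balanced metrics in a conformal class\<close>

context conformal_chart
begin

text \<open>The exponent \<open>n - 1\<close> is what remains of the conformal change of the volume, of weight \<open>n\<close>, and of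
  the trace, of weight \<open>-1\<close>.\<close>

definition "u p = exp (real (CARD('n) - 1) * \<rho> p)"
definition "w p = u p * u p / 2"

lemma u_smooth: "smooth_fun A u" and w_smooth: "smooth_fun A w"
proof -
  have us: "smooth_on (chart_img d) (\<lambda>z. u (chart_inv d z))" if "d \<in> A" for d
    unfolding u_def using rho that chart_open(2)[OF that]
    by (intro smooth_on_exp smooth_on_mult smooth_on_const) (auto simp: smooth_fun_def o_def)
  then show "smooth_fun A u" by (simp add: smooth_fun_def o_def)
  have "smooth_on (chart_img d) (\<lambda>z. w (chart_inv d z))" if "d \<in> A" for d
    unfolding w_def divide_inverse using us[OF that] chart_open(2)[OF that]
    by (intro smooth_on_mult smooth_on_const)
  then show "smooth_fun A w" by (simp add: smooth_fun_def o_def)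
qed

lemma del_w:
  assumes z: "z \<in> chart_img c"
  shows "delbar_del_fun c w \<alpha> \<beta> z = cnj (del_fun c u \<beta> z) * del_fun c u \<alpha> z
      + complex_of_real (u (chart_inv c z)) * delbar_del_fun c u \<alpha> \<beta> z"
proof -
  let ?U = "\<lambda>z. complex_of_real (u (chart_inv c z))"
  have U: "smooth_on (chart_img c) ?U" by (rule real_fun_smooth[OF u_smooth c])
  have dU: "?U differentiable (at y)" if "y \<in> chart_img c" for y by (rule smooth_on_differentiable[OF U that])
  have dU2: "(\<lambda>z. ?U z * ?U z) differentiable (at y)" if "y \<in> chart_img c" for y
    by (rule smooth_on_differentiable[OF smooth_on_mult[OF chart_open(2)[OF c] U U] that])
  have w: "(\<lambda>z. complex_of_real (w (chart_inv c z))) = (\<lambda>z. (1/2) * (?U z * ?U z))"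
    by (auto simp: w_def)
  have 1: "del_fun c w \<alpha> y = ?U y * del_fun c u \<alpha> y" if "y \<in> chart_img c" for y
    unfolding del_fun_def w
    using wirtinger_cmult(1)[OF dU2[OF that], of _ _ "1/2"] wirtinger_mult(1)[OF dU[OF that] dU[OF that]] by simp
  have "delbar_del_fun c w \<alpha> \<beta> z = wirtinger_bar (axis \<beta> 1) (axis \<beta> \<i>) (\<lambda>y. ?U y * del_fun c u \<alpha> y) z"
    unfolding delbar_del_fun_def by (rule wirtinger_cong(2)[OF chart_open(2)[OF c] z 1])
  also have "\<dots> = wirtinger_bar (axis \<beta> 1) (axis \<beta> \<i>) ?U z * del_fun c u \<alpha> z + ?U z * delbar_del_fun c u \<alpha> \<beta> z"
    unfolding delbar_del_fun_def
    by (rule wirtinger_mult(2)[OF dU[OF z] smooth_on_differentiable[OF del_fun_smooth[OF u_smooth c] z]])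
  also have "wirtinger_bar (axis \<beta> 1) (axis \<beta> \<i>) ?U z = cnj (del_fun c u \<beta> z)"
    unfolding del_fun_def using wirtinger_of_real[OF smooth_fun_derivative[OF u_smooth c z]] by simp
  finally show ?thesis .
qed

text \<open>The integrands of the two balance conditions, tested with \<open>\<partial>w\<close> for \<open>F\<close> and with \<open>\<partial>u\<close> for \<open>F'\<close>,
  both contain \<open>u\<close> times the trace of the Hessian of \<open>u\<close>. What remains of the difference is the squared
  norm of \<open>\<partial>u\<close> times the volume density; the factor \<open>- \<i>\<close> cancels the one in \<open>omega_H\<close>.\<close>

lemma trace_hess_difference:
  assumes F': "finsler_chart A F' c" and x: "x \<in> N" and a: "snd x $ a = 1" and card: "CARD('n) \<ge> 2"
  shows "\<exists>q\<ge>0. - \<i> * (balance_pairing A F w c x * vol_density A F c a x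
      - balance_pairing A F' u c x * vol_density A F' c a x) = complex_of_real q \<and>
      (q = 0 \<longrightarrow> (\<forall>\<alpha>. del_fun c u \<alpha> (fst x) = 0))"
proof -
  interpret F': finsler_chart A F' c by (rule F')
  define D :: "complex^'n" where "D = (\<chi> \<alpha>. del_fun c u \<alpha> (fst x))"
  define Q where "Q = (\<Sum>\<alpha>\<in>UNIV. \<Sum>\<beta>\<in>UNIV. Ginv A F c x $ \<beta> $ \<alpha> * D $ \<alpha> * cnj (D $ \<beta>))"
  obtain v where v: "v > 0" "vol_density A F c a x = complex_of_real v"
    using vol_density_pos[OF x a card] by blast
  have U: "complex_of_real (u (chart_inv c (fst x))) = exp (- rho_lift x) * exp (rho_lift x) ^ CARD('n)"
  proof -
    obtain k where k: "CARD('n) = Suc k" using card by (cases "CARD('n)") auto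
    have "complex_of_real (u (chart_inv c (fst x))) = exp (of_nat k * rho_lift x)"
      by (simp add: u_def k rho_lift_def rho_loc_def exp_of_real[symmetric])
    also have "\<dots> = exp (rho_lift x) ^ k" by (rule exp_of_nat_mult)
    also have "\<dots> = exp (- rho_lift x) * exp (rho_lift x) ^ CARD('n)" by (simp add: k exp_minus)
    finally show ?thesis .
  qed
  have w_eq: "trace_hess w x = Q + complex_of_real (u (chart_inv c (fst x))) * trace_hess u x"
    unfolding trace_hess_def Q_def D_def vec_lambda_beta del_w[OF N_fst[OF x]]
    by (simp add: distrib_left sum.distrib sum_distrib_left mult_ac)
  have u_eq: "F'.trace_hess u x = exp (- rho_lift x) * trace_hess u x"
    unfolding trace_hess_def F'.trace_hess_def Ginv_conformal[OF x] by (simp add: sum_distrib_left mult_ac)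
  have "- \<i> * (balance_pairing A F w c x * vol_density A F c a x
      - balance_pairing A F' u c x * vol_density A F' c a x)
      = - \<i> * (\<i> * trace_hess w x * complex_of_real v - \<i> * (exp (- rho_lift x) * trace_hess u x) * (exp (rho_lift x) ^ CARD('n) * complex_of_real v))"
    unfolding inner_del_form[OF w_smooth x] F'.inner_del_form[OF u_smooth x] u_eq vol_density_conformal[OF x F'] v(2) ..
  also have "\<dots> = (trace_hess w x - (exp (- rho_lift x) * exp (rho_lift x) ^ CARD('n)) * trace_hess u x) * complex_of_real v"
    by (simp add: algebra_simps)
  also have "\<dots> = Q * complex_of_real v" unfolding w_eq U by simp
  finally have eq: "- \<i> * (balance_pairing A F w c x * vol_density A F c a x
      - balance_pairing A F' u c x * vol_density A F' c a x) = Q * complex_of_real v" .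
  show ?thesis
  proof (cases "D = 0")
    case True
    then have "Q = 0" "\<And>\<alpha>. del_fun c u \<alpha> (fst x) = 0" by (auto simp: Q_def D_def vec_eq_iff)
    then show ?thesis unfolding eq by (intro exI[of _ 0]) simp
  next
    case False
    have "Im Q = 0" "Re Q > 0"
      using positive_definite_inverse_pos[OF Gmat_pos[OF x] False] unfolding Q_def Ginv_def by blast+
    then show ?thesis unfolding eq using v(1) by (intro exI[of _ "Re Q * v"]) (auto simp: complex_eq_iff)
  qed
qed

end

text \<open>For a real function \<open>\<partial>f = 0\<close> means that the whole differential vanishes, and by the chain rule this
  holds in every chart once it holds in one. So \<open>f\<close> is locally constant.\<close>

lemma constant_from_zero_differential:
  fixes A :: "('a::topological_space, 'n::finite) chart set" and f :: "'a \<Rightarrow> real"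
  assumes A: "complex_atlas A" and conn: "connected (UNIV :: 'a set)" and f: "smooth_fun A f"
    and zero: "\<And>p. \<exists>c\<in>A. p \<in> fst c \<and> (\<forall>\<alpha>. del_fun c f \<alpha> (snd c p) = 0)"
  shows "\<exists>k. \<forall>p. f p = k"
proof -
  interpret complex_manifold A using A by unfold_locales
  have deriv0: "frechet_derivative (\<lambda>z. complex_of_real (f (chart_inv d z))) (at z) v = 0"
    if d: "d \<in> A" and z: "z \<in> chart_img d" for d z v
  proof -
    let ?f = "\<lambda>p. complex_of_real (f p)"
    obtain c where c: "c \<in> A" "chart_inv d z \<in> fst c" "\<And>\<alpha>. del_fun c f \<alpha> (snd c (chart_inv d z)) = 0"
      using zero by blast
    have ov: "z \<in> overlap d c" using z c(2) by (simp add: overlap_iff[OF d])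
    have t: "transition d c z = snd c (chart_inv d z)" by (rule transition_apply)
    have "transition d c z \<in> chart_img c" by (rule transition_in_overlap(3)[OF d c(1) ov])
    then have diff: "(\<lambda>z. ?f (chart_inv c z)) differentiable at (transition d c z)"
      and fdiff: "(\<lambda>z. f (chart_inv c z)) differentiable at (transition d c z)"
      using smooth_on_differentiable[OF real_fun_smooth[OF f c(1)]] smooth_fun_derivative[OF f c(1)] by blast+
    have w0: "wirtinger (axis \<alpha> 1) (axis \<alpha> \<i>) (\<lambda>z. ?f (chart_inv c z)) (transition d c z) = 0" for \<alpha>
      using c(3)[of \<alpha>] unfolding del_fun_def t .
    then have wb0: "wirtinger_bar (axis \<alpha> 1) (axis \<alpha> \<i>) (\<lambda>z. ?f (chart_inv c z)) (transition d c z) = 0" for \<alpha>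
      using wirtinger_of_real[OF fdiff, of "axis \<alpha> 1" "axis \<alpha> \<i>"] by simp
    show ?thesis
      unfolding derivative_change_of_chart[of ?f, OF diff d c(1) ov] wirtinger_expansion[OF diff] w0 wb0 by simp
  qed
  have loc: "\<exists>T. open T \<and> p \<in> T \<and> (\<forall>q\<in>T. f q = f p)" for p
  proof -
    obtain d where d: "d \<in> A" "p \<in> fst d" using chart_cover by blast
    obtain \<epsilon> where \<epsilon>: "\<epsilon> > 0" "ball (snd d p) \<epsilon> \<subseteq> chart_img d"
      using chart_open(2)[OF d(1)] chart_in_img[OF d(2)] open_contains_ball by blast
    let ?g = "\<lambda>z. complex_of_real (f (chart_inv d z))"
    have "(?g has_derivative (\<lambda>h. 0)) (at z within ball (snd d p) \<epsilon>)" if "z \<in> ball (snd d p) \<epsilon>" for z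
    proof -
      have z: "z \<in> chart_img d" using \<epsilon> that by blast
      have "frechet_derivative ?g (at z) = (\<lambda>h. 0)" using deriv0[OF d(1) z] by (rule ext)
      then show ?thesis
        using frechet_derivative_has[OF smooth_on_differentiable[OF real_fun_smooth[OF f d(1)] z]]
        by (simp add: has_derivative_at_withinI)
    qed
    then obtain k where k: "\<And>z. z \<in> ball (snd d p) \<epsilon> \<Longrightarrow> ?g z = k"
      using has_derivative_zero_constant[OF convex_ball, of "snd d p" \<epsilon> ?g] by blast
    define T where "T = fst d \<inter> snd d -` ball (snd d p) \<epsilon>"
    have "open T"
      using continuous_on_open_vimage[OF chart_open(1)[OF d(1)]] chart_continuous[OF d(1)] unfolding T_def
      by (metis inf_commute open_ball)
    moreover have "p \<in> T" using d \<epsilon> by (simp add: T_def)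
    moreover have "f q = f p" if "q \<in> T" for q
    proof -
      have "?g (snd d q) = k" "?g (snd d p) = k" using that \<epsilon>(1) by (auto intro!: k simp: T_def)
      then have "?g (snd d q) = ?g (snd d p)" by simp
      then show ?thesis using that d by (simp add: T_def chart_inv_left)
    qed
    ultimately show ?thesis by blast
  qed
  show ?thesis
  proof (rule ccontr)
    assume "\<not> ?thesis"
    then obtain p q where pq: "f q \<noteq> f p" by metis
    have "open {x. f x = f p}"
      unfolding open_subopen[of "{x. f x = f p}"] using loc by (metis (mono_tags, lifting) mem_Collect_eq subsetI)
    moreover have "open {x. f x \<noteq> f p}"
      unfolding open_subopen[of "{x. f x \<noteq> f p}"] using loc by (metis (mono_tags, lifting) mem_Collect_eq subsetI)
    ultimately show False
      using connectedD[OF conn, of "{x. f x = f p}" "{x. f x \<noteq> f p}"] pq by auto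
  qed
qed

text \<open>Both balance conditions are integrals against the same selected partition of unity, because the
  selection does not depend on the metric. Their difference is a sum of integrals of continuous
  nonnegative functions, hence \<open>\<partial>u\<close> vanishes wherever some member of the partition does not, that is,
  everywhere.\<close>

lemma balanced_conformal_factor_constant:
  fixes A :: "('a::t2_space, 'n::finite) chart set"
  assumes A: "complex_atlas A" and conn: "connected (UNIV :: 'a set)" and card: "CARD('n) \<ge> 2"
    and comp: "compact (UNIV :: 'a set)"
    and bal: "balanced A F" "balanced A F'" and rho: "smooth_fun A \<rho>"
    and conf: "\<And>t. t \<in> TM A \<Longrightarrow> F' t = conformal_change \<rho> F t"
  shows "\<exists>k. \<forall>p. \<rho> p = k"
proof -
  interpret complex_manifold A using A by unfold_locales
  have cc: "conformal_chart A F c F' \<rho>" and F': "finsler_chart A F' c" if "c \<in> A" for c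
    using A that bal rho conf
    by (auto simp: conformal_chart_def conformal_chart_axioms_def finsler_chart_def finsler_chart_axioms_def
        complex_manifold_def balanced_def)
  define u where "u p = exp (real (CARD('n) - 1) * \<rho> p)" for p
  define w where "w p = u p * u p / 2" for p
  \<comment> \<open>The test functions do not depend on the chart.\<close>
  have c_u: "conformal_chart.u TYPE('n) \<rho> = u" if "c \<in> A" for c :: "('a, 'n) chart"
    using conformal_chart.u_def[OF cc[OF that]] by (auto simp: u_def)
  have c_w: "conformal_chart.w TYPE('n) \<rho> = w" if "c \<in> A" for c :: "('a, 'n) chart"
    using conformal_chart.w_def[OF cc[OF that]] by (auto simp: w_def c_u[OF that])
  obtain c0 where c0: "c0 \<in> A" using chart_cover by blast
  have u_smooth: "smooth_fun A u" and w_smooth: "smooth_fun A w"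
    using conformal_chart.u_smooth[OF cc[OF c0]] conformal_chart.w_smooth[OF cc[OF c0]] c_u[OF c0] c_w[OF c0] by simp_all
  obtain I \<theta> where P: "(SOME P. PTM_partition A (fst P) (snd P)) = (I, \<theta>)" by (meson surj_pair)
  have ex: "\<exists>I \<theta>. PTM_partition A I \<theta>" by (rule PTM_partition_exists[OF A comp])
  then have "PTM_partition A (fst (SOME P. PTM_partition A (fst P) (snd P))) (snd (SOME P. PTM_partition A (fst P) (snd P)))"
    by (intro someI_ex[of "\<lambda>P. PTM_partition A (fst P) (snd P)"]) auto
  then have part: "PTM_partition A I \<theta>" unfolding P by simp
  then have finI: "finite I" and IA: "I \<subseteq> A \<times> UNIV"
    and \<theta>_cont: "\<And>k d. k \<in> I \<Longrightarrow> d \<in> A \<Longrightarrow> continuous_on (TM0_coords d) (\<lambda>x. \<theta> k (tvec_of A d x))"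
    and \<theta>_nonneg: "\<And>k t. k \<in> I \<Longrightarrow> t \<in> TM0 A \<Longrightarrow> \<theta> k t \<ge> 0"
    and \<theta>_scale: "\<And>k t \<zeta>. k \<in> I \<Longrightarrow> t \<in> TM0 A \<Longrightarrow> \<zeta> \<noteq> 0 \<Longrightarrow> \<theta> k (tscale \<zeta> t) = \<theta> k t"
    and \<theta>_sum: "\<And>t. t \<in> TM0 A \<Longrightarrow> (\<Sum>k\<in>I. \<theta> k t) = 1"
    unfolding PTM_partition_def by simp_all
  have \<theta>_supp: "\<exists>K. compact K \<and> K \<subseteq> chart_img c \<times> {v. v $ a = 1} \<and>
        (\<forall>t\<in>TM0 A. \<theta> (c, a) t \<noteq> 0 \<longrightarrow> fst t \<in> fst c \<and> snd t c $ a \<noteq> 0 \<and>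
           (snd c (fst t), (1 / (snd t c $ a)) *s snd t c) \<in> K)" if "(c, a) \<in> I" for c a
    using part that unfolding PTM_partition_def by fast
  define h1 where "h1 c a x = complex_of_real (\<theta> (c, a) (tvec_of A c x)) *
     balance_pairing A F w c x * vol_density A F c a x" for c a x
  define h2 where "h2 c a x = complex_of_real (\<theta> (c, a) (tvec_of A c x)) *
     balance_pairing A F' u c x * vol_density A F' c a x" for c a x
  define g where "g h c a y = indicator (chart_img c) (fst y) * h c a (affine_point a y)"
    for h :: "('a, 'n) chart \<Rightarrow> 'n \<Rightarrow> (complex^'n) \<times> (complex^'n) \<Rightarrow> complex"
      and c :: "('a, 'n) chart" and a and y :: "(complex^'n) \<times> ('n \<Rightarrow> complex)"
  have int1: "(\<Sum>(c, a)\<in>I. \<integral>y. g h1 c a y \<partial>affine_measure a) = 0"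
    using balanced_zero[OF ex bal(1) del_form_in_hforms[OF w_smooth]]
    unfolding inner_PTM_def PTM_integral_def P Let_def prod.case PTM_integral_wrt_def
    by (simp add: g_def h1_def affine_point_def affine_measure_def mult.assoc)
  have int2: "(\<Sum>(c, a)\<in>I. \<integral>y. g h2 c a y \<partial>affine_measure a) = 0"
    using balanced_zero[OF ex bal(2) del_form_in_hforms[OF u_smooth]]
    unfolding inner_PTM_def PTM_integral_def P Let_def prod.case PTM_integral_wrt_def
    by (simp add: g_def h2_def affine_point_def affine_measure_def mult.assoc)
  define h where "h c a x = - \<i> * (h1 c a x - h2 c a x)" for c a x
  have TM0x: "tvec_of A c x \<in> TM0 A" if "c \<in> A" "x \<in> TM0_coords c" for c x
    using tvec_of_in_TM0[OF that] .
  have h_pos: "\<exists>q\<ge>0. h c a x = complex_of_real (\<theta> (c, a) (tvec_of A c x)) * complex_of_real q \<and>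
      (q = 0 \<longrightarrow> (\<forall>\<alpha>. del_fun c u \<alpha> (fst x) = 0))"
    if ca: "(c, a) \<in> I" and x: "x \<in> TM0_coords c" "snd x $ a = 1" for c a x
  proof -
    have c: "c \<in> A" using ca IA by auto
    from conformal_chart.trace_hess_difference[OF cc[OF c] F'[OF c] x card, unfolded c_u[OF c] c_w[OF c]]
    obtain q where q: "q \<ge> 0" "- \<i> * (balance_pairing A F w c x * vol_density A F c a x
      - balance_pairing A F' u c x * vol_density A F' c a x) = complex_of_real q"
      "q = 0 \<longrightarrow> (\<forall>\<alpha>. del_fun c u \<alpha> (fst x) = 0)" by blast
    have "h c a x = complex_of_real (\<theta> (c, a) (tvec_of A c x)) * (- \<i> * (balance_pairing A F w c x * vol_density A F c a x
      - balance_pairing A F' u c x * vol_density A F' c a x))"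
      unfolding h_def h1_def h2_def by (simp add: algebra_simps)
    then show ?thesis unfolding q(2) using q(1,3) by blast
  qed
  have integrable: "continuous_on (TM0_coords c) (hh c a) \<and> integrable (affine_measure a) (g hh c a)"
    if ca: "(c, a) \<in> I" and hh: "hh = h1 \<or> hh = h2 \<or> hh = h" for hh c a
  proof -
    have c: "c \<in> A" using ca IA by auto
    interpret cc: conformal_chart A F c F' \<rho> by (rule cc[OF c])
    interpret F': finsler_chart A F' c by (rule F'[OF c])
    have \<theta>c: "continuous_on (TM0_coords c) (\<lambda>x. \<theta> (c, a) (tvec_of A c x))" using \<theta>_cont[OF ca c] .
    have 1: "continuous_on (TM0_coords c) (h1 c a)"
    proof (rule continuous_on_eq)
      show "continuous_on (TM0_coords c) (\<lambda>x. complex_of_real (\<theta> (c, a) (tvec_of A c x)) *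
        (\<i> * cc.trace_hess w x) * vol_density A F c a x)"
        by (intro continuous_intros \<theta>c cc.trace_hess_continuous[OF w_smooth] cc.vol_density_continuous)
    qed (simp add: h1_def cc.inner_del_form[OF w_smooth, simplified])
    have 2: "continuous_on (TM0_coords c) (h2 c a)"
    proof (rule continuous_on_eq)
      show "continuous_on (TM0_coords c) (\<lambda>x. complex_of_real (\<theta> (c, a) (tvec_of A c x)) *
        (\<i> * F'.trace_hess u x) * vol_density A F' c a x)"
        by (intro continuous_intros \<theta>c F'.trace_hess_continuous[OF u_smooth] F'.vol_density_continuous)
    qed (simp add: h2_def F'.inner_del_form[OF u_smooth, simplified])
    have 3: "continuous_on (TM0_coords c) (h c a)"
      unfolding h_def by (intro continuous_intros 1 2)
    have cont: "continuous_on (TM0_coords c) (hh c a)" using hh 1 2 3 by auto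
    obtain K where K: "compact K" "K \<subseteq> chart_img c \<times> {v. v $ a = 1}"
      "\<And>t. t \<in> TM0 A \<Longrightarrow> \<theta> (c, a) t \<noteq> 0 \<Longrightarrow> fst t \<in> fst c \<and> snd t c $ a \<noteq> 0 \<and>
           (snd c (fst t), (1 / (snd t c $ a)) *s snd t c) \<in> K" using \<theta>_supp[OF ca] by blast
    have supp: "x \<in> K" if x: "x \<in> TM0_coords c" "snd x $ a = 1" and nz: "hh c a x \<noteq> 0" for x
    proof -
      have "\<theta> (c, a) (tvec_of A c x) \<noteq> 0" using nz hh by (auto simp: h_def h1_def h2_def)
      from K(3)[OF TM0x[OF c x(1)] this] show ?thesis
        using x chart_inv_right[OF c] tvec_of_comp_self[OF c, of x] by (simp add: TM0_coords_def mem_Times_iff)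
    qed
    show ?thesis
      using affine_integrable[OF TM0_coords_open[OF c] cont K(1,2) supp] cont unfolding g_def by blast
  qed
  have g_h: "(\<integral>y. g h c a y \<partial>affine_measure a) =
      - \<i> * ((\<integral>y. g h1 c a y \<partial>affine_measure a) - (\<integral>y. g h2 c a y \<partial>affine_measure a))" if "(c, a) \<in> I" for c a
  proof -
    have "g h c a = (\<lambda>y. - \<i> * (g h1 c a y - g h2 c a y))" by (intro ext) (simp add: g_def h_def algebra_simps)
    then show ?thesis using integrable[OF that, of h1] integrable[OF that, of h2] by simp
  qed
  have Re_nonneg: "Re (h c a x) \<ge> 0" if ca: "(c, a) \<in> I" and x: "x \<in> TM0_coords c" "snd x $ a = 1" for c a x
  proof -
    have "c \<in> A" using ca IA by auto
    then show ?thesis using h_pos[OF ca x] \<theta>_nonneg[OF ca TM0x[OF _ x(1)]] by auto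
  qed
  have int_nonneg: "Re (\<integral>y. g h c a y \<partial>affine_measure a) \<ge> 0" if ca: "(c, a) \<in> I" for c a
  proof -
    have "Re (g h c a y) \<ge> 0" for y
      using Re_nonneg[OF ca, of "affine_point a y"] affine_point_in[of a y c] affine_vec_self[of a "snd y"]
      by (auto simp: g_def indicator_def affine_point_def)
    then show ?thesis
      unfolding integral_Re[OF conjunct2[OF integrable[OF ca, of h]], simplified, symmetric] by (intro integral_nonneg_AE) auto
  qed
  have "(\<Sum>(c, a)\<in>I. \<integral>y. g h c a y \<partial>affine_measure a) = 0"
  proof -
    have "(\<Sum>(c, a)\<in>I. \<integral>y. g h c a y \<partial>affine_measure a) =
      (\<Sum>k\<in>I. - \<i> * ((\<integral>y. g h1 (fst k) (snd k) y \<partial>affine_measure (snd k)) - (\<integral>y. g h2 (fst k) (snd k) y \<partial>affine_measure (snd k))))"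
      using g_h by (intro sum.cong refl) (auto simp: case_prod_beta)
    also have "\<dots> = 0"
      unfolding sum_distrib_left[symmetric] sum_subtractf
      using int1[unfolded case_prod_beta] int2[unfolded case_prod_beta] by (simp only: diff_self mult_zero_right)
    finally show ?thesis .
  qed
  then have "(\<Sum>k\<in>I. \<integral>y. g h (fst k) (snd k) y \<partial>affine_measure (snd k)) = 0"
    unfolding case_prod_beta .
  from arg_cong[OF this, of Re]
  have "(\<Sum>k\<in>I. Re (\<integral>y. g h (fst k) (snd k) y \<partial>affine_measure (snd k))) = 0"
    by (simp only: Re_sum zero_complex.sel)
  then have int0: "Re (\<integral>y. g h c a y \<partial>affine_measure a) = 0" if "(c, a) \<in> I" for c a
    using sum_nonneg_eq_0_iff[OF finI, of "\<lambda>k. Re (\<integral>y. g h (fst k) (snd k) y \<partial>affine_measure (snd k))"] int_nonneg that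
    by fastforce
  have "\<exists>c\<in>A. p \<in> fst c \<and> (\<forall>\<alpha>. del_fun c u \<alpha> (snd c p) = 0)" for p
  proof -
    obtain d where d: "d \<in> A" "p \<in> fst d" using chart_cover by blast
    define t where "t = tvec_of A d (snd d p, axis (undefined :: 'n) 1)"
    have "(snd d p, axis (undefined :: 'n) (1::complex)) \<in> TM0_coords d"
      using chart_in_img[OF d(2)] by (simp add: TM0_coords_def axis_eq_0_iff)
    then have t: "t \<in> TM0 A" "fst t = p" using TM0x[OF d(1)] chart_inv_left[OF d] by (simp_all add: t_def)
    have "\<exists>k\<in>I. \<theta> k t \<noteq> 0" using \<theta>_sum[OF t(1)] by (metis sum.neutral zero_neq_one)
    then obtain c a where ca: "(c, a) \<in> I" "\<theta> (c, a) t \<noteq> 0" by auto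
    have c: "c \<in> A" using ca IA by auto
    have pc: "p \<in> fst c" "snd t c $ a \<noteq> 0" using \<theta>_supp[OF ca(1)] t ca(2) by blast+
    \<comment> \<open>Rescale the vector so that it lies in the affine chart.\<close>
    define \<zeta> where "\<zeta> = 1 / (snd t c $ a)"
    define x where "x = (snd c p, \<zeta> *s snd t c)"
    have \<zeta>: "\<zeta> \<noteq> 0" using pc by (simp add: \<zeta>_def)
    have xa: "snd x $ a = 1" using pc by (simp add: x_def \<zeta>_def)
    then have "snd x \<noteq> 0" by (metis zero_index zero_neq_one)
    then have x: "x \<in> TM0_coords c" using chart_in_img[OF pc(1)] by (simp add: TM0_coords_def x_def)
    have tTM: "t \<in> TM A" using t(1) by (simp add: TM0_def)
    have "tvec_of A c x = tscale \<zeta> t"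
      using TM_tvec_of[OF tTM c] pc t(2) tscale_tvec_of[OF c chart_in_img[OF pc(1)], of \<zeta> "snd t c"] by (simp add: x_def)
    then have \<theta>x: "\<theta> (c, a) (tvec_of A c x) \<noteq> 0" using \<theta>_scale[OF ca(1) t(1) \<zeta>] ca(2) by simp
    have h_int: "continuous_on (TM0_coords c) (h c a)" "integrable (affine_measure a) (g h c a)"
      using integrable[OF ca(1), of h] by simp_all
    have "Re (h c a x) = 0"
      using TM0_coords_open[OF c] h_int(1) h_int(2)[unfolded g_def] _ int0[OF ca(1), unfolded g_def] x xa
      by (rule affine_integral_zero) (rule Re_nonneg[OF ca(1)])
    then have "\<forall>\<alpha>. del_fun c u \<alpha> (fst x) = 0" using h_pos[OF ca(1) x xa] \<theta>x by auto
    then show ?thesis using c pc(1) by (auto simp: x_def)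
  qed
  from constant_from_zero_differential[OF A conn u_smooth this]
  obtain k where k: "\<And>p. u p = k" by blast
  have "\<rho> p = ln k / real (CARD('n) - 1)" for p
    using card by (simp add: k[of p, symmetric] u_def)
  then show ?thesis by blast
qed

section \<open>Conformal changes of Rund Kaehler-Finsler-like metrics\<close>

lemma Re_of_real_times: "Re (complex_of_real e * y) = e * Re y"
  by simp

text \<open>The fibre Hessian is multiplied by the positive function \<open>exp \<rho>\<close>.\<close>

lemma strongly_pseudoconvex_conformal_change:
  fixes A :: "('a::topological_space, 'n::finite) chart set"
  assumes A: "complex_atlas A" and spc: "strongly_pseudoconvex A F" and rho: "smooth_fun A \<rho>"
  shows "strongly_pseudoconvex A (conformal_change \<rho> F)"
proof -
  let ?F = "conformal_change \<rho> F"
  interpret complex_manifold A using A by unfold_locales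
  have F: "complex_finsler A F" using spc by (simp add: strongly_pseudoconvex_def)
  have cc: "conformal_chart A F c ?F \<rho>" if "c \<in> A" for c
    using A that spc rho
    by (auto simp: conformal_chart_def conformal_chart_axioms_def finsler_chart_def finsler_chart_axioms_def
        complex_manifold_def)
  have cont: "continuous_on (TM_coords c) (\<lambda>x. ?F (tvec_of A c x))" if c: "c \<in> A" for c
  proof -
    have "continuous_on (chart_img c) (\<lambda>z. \<rho> (chart_inv c z))"
      using rho c smooth_on_continuous by (auto simp: smooth_fun_def o_def)
    then have "continuous_on (TM_coords c) (\<lambda>x. \<rho> (chart_inv c (fst x)))"
      by (rule continuous_on_compose2) (auto simp: TM_coords_def intro: continuous_intros)
    moreover have "continuous_on (TM_coords c) (\<lambda>x. F (tvec_of A c x))"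
      using F c by (simp add: complex_finsler_def)
    ultimately show ?thesis unfolding conformal_change_def tvec_of_fst by (intro continuous_intros) auto
  qed
  have smooth: "smooth_on (TM0_coords c) (G_loc A ?F c)" if c: "c \<in> A" for c
  proof -
    interpret conformal_chart A F c ?F \<rho> by (rule cc[OF c])
    have "smooth_on N (\<lambda>x. exp (\<rho> (chart_inv c (fst x))) * G_loc A F c x)"
      using rho c by (intro smooth_on_mult smooth_on_exp N_open G_loc_smooth smooth_fst) (auto simp: smooth_fun_def o_def)
    moreover have "G_loc A ?F c x = exp (\<rho> (chart_inv c (fst x))) * G_loc A F c x" if "x \<in> N" for x
      using G_loc_conformal that TM0_coords_subset by blast
    ultimately show ?thesis by (subst smooth_on_cong[OF N_open])
  qed
  have pd: "positive_definite (Gmat A ?F c x)" if c: "c \<in> A" and x: "x \<in> TM0_coords c" for c x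
  proof -
    interpret conformal_chart A F c ?F \<rho> by (rule cc[OF c])
    define e where "e = exp (\<rho> (chart_inv c (fst x)))"
    have e: "exp (rho_lift x) = complex_of_real e" by (simp add: rho_lift_def rho_loc_def e_def exp_of_real)
    have G: "Gmat A ?F c x $ \<alpha> $ \<beta> = complex_of_real e * Gmat A F c x $ \<alpha> $ \<beta>" for \<alpha> \<beta>
      using Gmat_conformal[OF x] by (simp add: e)
    have "(\<Sum>\<alpha>\<in>UNIV. \<Sum>\<beta>\<in>UNIV. Gmat A ?F c x $ \<alpha> $ \<beta> * v $ \<alpha> * cnj (v $ \<beta>)) =
       complex_of_real e * (\<Sum>\<alpha>\<in>UNIV. \<Sum>\<beta>\<in>UNIV. Gmat A F c x $ \<alpha> $ \<beta> * v $ \<alpha> * cnj (v $ \<beta>))" for v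
      by (simp add: G sum_distrib_left mult.assoc)
    then have Re_eq: "Re (\<Sum>\<alpha>\<in>UNIV. \<Sum>\<beta>\<in>UNIV. Gmat A ?F c x $ \<alpha> $ \<beta> * v $ \<alpha> * cnj (v $ \<beta>)) =
       e * Re (\<Sum>\<alpha>\<in>UNIV. \<Sum>\<beta>\<in>UNIV. Gmat A F c x $ \<alpha> $ \<beta> * v $ \<alpha> * cnj (v $ \<beta>))" for v
      by (simp only: Re_of_real_times)
    have e_pos: "e > 0" by (simp add: e_def)
    show ?thesis
      unfolding positive_definite_def
    proof (intro conjI allI impI)
      show "Gmat A ?F c x $ \<beta> $ \<alpha> = cnj (Gmat A ?F c x $ \<alpha> $ \<beta>)" for \<alpha> \<beta>
        by (simp only: G Gmat_herm[OF x, of \<beta> \<alpha>] complex_cnj_mult complex_cnj_complex_of_real)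
      show "0 < Re (\<Sum>\<alpha>\<in>UNIV. \<Sum>\<beta>\<in>UNIV. Gmat A ?F c x $ \<alpha> $ \<beta> * v $ \<alpha> * cnj (v $ \<beta>))"
        if "v \<noteq> 0" for v
        unfolding Re_eq using Gmat_pos[OF x] that e_pos unfolding positive_definite_def by (intro mult_pos_pos) blast+
    qed
  qed
  have hom: "?F (tscale \<zeta> t) = cmod \<zeta> * ?F t" if "t \<in> TM A" for t \<zeta>
    using F that by (simp add: complex_finsler_def conformal_change_def) (simp add: tscale_def)
  have "?F t \<ge> 0" if "t \<in> TM A" for t using F that by (simp add: complex_finsler_def conformal_change_def)
  moreover have "?F t > 0" if "t \<in> TM0 A" for t using F that by (simp add: complex_finsler_def conformal_change_def)
  ultimately show ?thesis
    unfolding strongly_pseudoconvex_def complex_finsler_def using cont smooth pd hom by blast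
qed

lemma rund_kaehler_finsler_like_conformal_change_iff:
  fixes A :: "('a::topological_space, 'n::finite) chart set"
  assumes A: "complex_atlas A" and card: "CARD('n) \<ge> 2"
    and F: "rund_kaehler_finsler_like A F" and rho: "smooth_fun A \<rho>"
  shows "rund_kaehler_finsler_like A (conformal_change \<rho> F) \<longleftrightarrow> ddbar_zero A \<rho>"
proof -
  let ?F = "conformal_change \<rho> F"
  have spc: "strongly_pseudoconvex A F" using F by (simp add: rund_kaehler_finsler_like_def)
  have curv: "rund_curvature A ?F c \<alpha> \<beta> \<mu> \<nu> x =
      rund_curvature A F c \<alpha> \<beta> \<mu> \<nu> x - (if \<beta> = \<alpha> then cnj (ddbar c \<rho> \<nu> \<mu> (fst x)) else 0)"
    if "c \<in> A" "x \<in> TM0_coords c" for c x \<alpha> \<beta> \<mu> \<nu>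
  proof -
    have "conformal_chart A F c ?F \<rho>"
      using A that(1) spc rho
      by (auto simp: conformal_chart_def conformal_chart_axioms_def finsler_chart_def finsler_chart_axioms_def
          complex_manifold_def)
    from conformal_chart.rund_curvature_conformal[OF this that(2)] show ?thesis .
  qed
  have sym: "rund_curvature A F c \<alpha> \<beta> \<mu> \<nu> x = rund_curvature A F c \<alpha> \<mu> \<beta> \<nu> x"
    if "c \<in> A" "x \<in> TM0_coords c" for c x \<alpha> \<beta> \<mu> \<nu>
    using F that by (simp add: rund_kaehler_finsler_like_def)
  show ?thesis
  proof
    assume F': "rund_kaehler_finsler_like A ?F"
    show "ddbar_zero A \<rho>"
      unfolding ddbar_zero_def
    proof (intro ballI allI)
      fix c z and \<nu> \<mu> :: 'n assume c: "c \<in> A" and z: "z \<in> chart_img c"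
      have "\<not> (UNIV :: 'n set) \<subseteq> {\<mu>}" using card_mono[of "{\<mu>}" "UNIV :: 'n set"] card by auto
      then obtain \<gamma> :: 'n where \<gamma>: "\<gamma> \<noteq> \<mu>" by auto
      \<comment> \<open>The curvature identity holds at every nonzero vector over \<open>z\<close>; any one of them will do.\<close>
      have x: "(z, axis \<mu> 1) \<in> TM0_coords c" using z by (simp add: TM0_coords_def axis_eq_0_iff)
      have "rund_curvature A ?F c \<gamma> \<gamma> \<mu> \<nu> (z, axis \<mu> 1) = rund_curvature A ?F c \<gamma> \<mu> \<gamma> \<nu> (z, axis \<mu> 1)"
        using F' c x by (simp add: rund_kaehler_finsler_like_def)
      then show "ddbar c \<rho> \<nu> \<mu> z = 0"
        using curv[OF c x] sym[OF c x, of \<gamma> \<gamma> \<mu> \<nu>] \<gamma> by simp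
    qed
  next
    assume "ddbar_zero A \<rho>"
    then have z: "ddbar c \<rho> \<nu> \<mu> (fst x) = 0" if "c \<in> A" "x \<in> TM0_coords c" for c x \<nu> \<mu>
      using that unfolding ddbar_zero_def TM0_coords_def by auto
    have "rund_curvature A ?F c \<alpha> \<beta> \<mu> \<nu> x = rund_curvature A ?F c \<alpha> \<mu> \<beta> \<nu> x"
      if "c \<in> A" "x \<in> TM0_coords c" for c x \<alpha> \<beta> \<mu> \<nu>
      unfolding curv[OF that] using sym[OF that, of \<alpha> \<beta> \<mu> \<nu>] z[OF that] by simp
    then show "rund_kaehler_finsler_like A ?F"
      unfolding rund_kaehler_finsler_like_def
      using strongly_pseudoconvex_conformal_change[OF A spc rho] by blast
  qed
qed

theorem theorem1p6:
  fixes A :: "('a::{t2_space, second_countable_topology}, 'n::finite) chart set"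
  assumes "complex_atlas A"
    and "connected (UNIV :: 'a set)"
    and "CARD('n) \<ge> 2"
  shows
    "(compact (UNIV :: 'a set) \<longrightarrow>
       (\<forall>F\<^sub>0. strongly_pseudoconvex A F\<^sub>0 \<longrightarrow>
         (\<forall>F\<in>conformal_class A F\<^sub>0. \<forall>F'\<in>conformal_class A F\<^sub>0.
            balanced A F \<and> balanced A F' \<longrightarrow> (\<exists>k>0. \<forall>t\<in>TM A. F' t = k * F t)))) \<and>
     (\<not> compact (UNIV :: 'a set) \<longrightarrow>
       (\<forall>F \<rho>. rund_kaehler_finsler_like A F \<and> smooth_fun A \<rho> \<longrightarrow>
          (rund_kaehler_finsler_like A (conformal_change \<rho> F) \<longleftrightarrow> ddbar_zero A \<rho>)))"
proof (intro conjI impI allI ballI)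
  fix F\<^sub>0 F F'
  assume comp: "compact (UNIV :: 'a set)" and FF': "F \<in> conformal_class A F\<^sub>0" "F' \<in> conformal_class A F\<^sub>0"
    and bal: "balanced A F \<and> balanced A F'"
  obtain \<rho>1 where \<rho>1: "smooth_fun A \<rho>1" "\<And>t. t \<in> TM A \<Longrightarrow> F t = conformal_change \<rho>1 F\<^sub>0 t"
    using FF'(1) unfolding conformal_class_def by blast
  obtain \<rho>2 where \<rho>2: "smooth_fun A \<rho>2" "\<And>t. t \<in> TM A \<Longrightarrow> F' t = conformal_change \<rho>2 F\<^sub>0 t"
    using FF'(2) unfolding conformal_class_def by blast
  define \<rho> where "\<rho> p = \<rho>2 p - \<rho>1 p" for p
  interpret complex_manifold A using assms(1) by unfold_locales
  have rho: "smooth_fun A \<rho>"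
    using \<rho>1(1) \<rho>2(1) chart_open(2) unfolding smooth_fun_def \<rho>_def o_def by (auto intro: smooth_on_diff)
  have conf: "F' t = conformal_change \<rho> F t" if "t \<in> TM A" for t
    unfolding \<rho>1(2)[OF that] \<rho>2(2)[OF that] conformal_change_def \<rho>_def
    by (simp add: mult.assoc[symmetric] exp_add[symmetric] diff_divide_distrib)
  obtain k where "\<And>p. \<rho> p = k"
    using balanced_conformal_factor_constant[OF assms(1,2,3) comp _ _ rho conf] bal by blast
  then show "\<exists>k>0. \<forall>t\<in>TM A. F' t = k * F t"
    using conf by (intro exI[of _ "exp (k / 2)"]) (auto simp: conformal_change_def)
next
  fix F \<rho> assume "rund_kaehler_finsler_like A F \<and> smooth_fun A \<rho>"
  then show "rund_kaehler_finsler_like A (conformal_change \<rho> F) \<longleftrightarrow> ddbar_zero A \<rho>"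
    using rund_kaehler_finsler_like_conformal_change_iff[OF assms(1,3)] by blast
qed

end
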